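(* Let $n\in\mathbb{N}$, let $K$ be a field of characteristic $0$, let $W$ be the $n$-th Weyl algebra over $K$, and let $M$ be a finitely generated left $W$-module. There exists $s_{(1|1)}\in\mathbb{N}_0$ such that for all $\omega\in\Omega$ and all $s\in\mathbb{N}$ with $s>s_{(1|1)}$ one has $$\mathcal{C}^{\omega}(M)=\mathcal{V}^{(1|1)+s\omega}(M)=\mathcal{C}^{(1|1)+s\omega}(M).$$
   Context: $\mathbb{N}=\{1,2,\dots\}$, $\mathbb{N}_0=\mathbb{N}\cup\{0\}$. $K[X,Y]=K[X_1,\dots,X_n,Y_1,\dots,Y_n]$. The $n$-th Weyl algebra $W$ is the $K$-subalgebra of $\mathrm{End}_K(K[X_1,\dots,X_n])$ generated by $\xi_i$ (multiplication by $X_i$) and $\partial_i=\partial/\partial X_i$, $1\le i\le n$. It has $K$-basis $\{\xi^\lambda\partial^\mu\mid\lambda,\mu\in\mathbb{N}_0^n\}$; for $w=\sum c_{\lambda\mu}\xi^\lambda\partial^\mu$ put $\mathrm{supp}(w)=\{(\lambda,\mu)\mid c_{\lambda\mu}\neq0\}$. For $\lambda,\mu\in\mathbb{N}_0^n$, $(\lambda|\mu)\in\mathbb{N}_0^{2n}$ denotes concatenation; for $r,s\in\mathbb{N}_0$, $(r|s)\in\mathbb{N}_0^{2n}$ is the vector whose first $n$ entries are $r$ and last $n$ entries are $s$. For $\omega\in\mathbb{N}_0^{2n}$, $\deg^\omega(w)=\sup\{\omega\cdot(\lambda|\mu)\mid(\lambda,\mu)\in\mathrm{supp}(w)\}$ (so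 $\deg^\omega(0)=-\infty$). $\Omega=\{\omega\in\mathbb{N}_0^{2n}\mid\omega_i+\omega_{n+i}>0\text{ for }1\le i\le n\}$. For $\omega\in\Omega$, $W$ is filtered by $\mathrm{F}^\omega_iW=\{w\in W\mid\deg^\omega(w)\le i\}$, $i\in\mathbb{Z}$; the associated graded ring $\mathrm{G}^\omega W=\bigoplus_i\mathrm{F}^\omega_iW/\mathrm{F}^\omega_{i-1}W$ is commutative and is identified with $K[X,Y]$ by letting $X_i,Y_i$ correspond to the classes of $\xi_i,\partial_i$ in degrees $\omega_i,\omega_{n+i}$. A filtration $(\mathrm{F}_iM)_{i\in\mathbb{Z}}$ of $M$ over $W$ with the $\omega$-filtration is good if there are finitely many $m_j\in M$, $p_j\in\mathbb{Z}$ with $\mathrm{F}_iM=\sum_j\mathrm{F}^\omega_{i-p_j}W\,m_j$ for all $i$. For $M$ finitely generated, $\mathrm{G}^\omega M=\bigoplus_i\mathrm{F}_iM/\mathrm{F}_{i-1}M$ is the associated graded $K[X,Y]$-module with respect to a good filtration; the radical $\sqrt{(0:\mathrm{G}^\omega M)}$ of its annihilator in $K[X,Y]$ is independent of the good filtration. For an ideal $I$ of $K[X,Y]$, $\mathrm{G}^{(1|1)}I$ denotes the ideal of $K[X,Y]$ generated by the homogeneous components of greatest total degree of the elements of $I$ (the associated graded ideal for the total degree filtration). $\mathrm{Var}(I)$ is the closed set of primes of $\mathrm{Spec}(K[X,Y])$ containing $I$. The $\omega$-characteristic variety of $M$ is $\mathcal{V}^\omega(M)=\mathrm{Var}(0:\mathrm{G}^\omega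 M)$, and the $\omega$-critical cone of $M$ is $\mathcal{C}^\omega(M)=\mathrm{Var}\bigl(\mathrm{G}^{(1|1)}\sqrt{(0:\mathrm{G}^\omega M)}\bigr)$. *)

theory Defs
  imports
    "HOL-Library.Poly_Mapping"
    "HOL-Library.Set_Algebras"
    "HOL-Library.Extended_Real"
    "HOL-Algebra.Ideal"
begin

section \<open>Polynomial rings\<close>

text \<open>
  Polynomials over \<open>'k\<close> in variables indexed by a type \<open>'v\<close> are finitely supported coefficient
  functions on the exponents \<open>'v \<Rightarrow>\<^sub>0 nat\<close>, with the convolution product of Poly_Mapping.
  With \<open>'n\<close> a finite type with \<open>n\<close> elements, \<open>('n, 'k) mpoly\<close> is \<open>K[X\<^sub>1,\<dots>,X\<^sub>n]\<close> and
  \<open>('n + 'n, 'k) mpoly\<close> is \<open>K[X\<^sub>1,\<dots>,X\<^sub>n,Y\<^sub>1,\<dots>,Y\<^sub>n]\<close>, where \<open>Inl i\<close> indexes \<open>X\<^sub>i\<close> and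
  \<open>Inr i\<close> indexes \<open>Y\<^sub>i\<close>. Likewise \<open>('n + 'n) \<Rightarrow>\<^sub>0 nat\<close> and \<open>'n + 'n \<Rightarrow> nat\<close> stand for
  \<open>\<nat>\<^sub>0\<^sup>2\<^sup>n\<close> (exponents and weights, respectively).
\<close>

type_synonym ('v, 'k) mpoly = "('v \<Rightarrow>\<^sub>0 nat) \<Rightarrow>\<^sub>0 'k"

definition mvar :: "'v \<Rightarrow> ('v, 'k::comm_ring_1) mpoly" where
  "mvar i = Poly_Mapping.single (Poly_Mapping.single i 1) 1"

definition mconst :: "'k \<Rightarrow> ('v, 'k::comm_ring_1) mpoly" where
  "mconst c = Poly_Mapping.single 0 c"

text \<open>
  The truncated subtraction in the exponent is harmless: if the exponent of the variable is \<open>0\<close>,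
  the coefficient vanishes.
\<close>

definition mderiv :: "'v \<Rightarrow> ('v, 'k::comm_ring_1) mpoly \<Rightarrow> ('v, 'k) mpoly" where
  "mderiv i p = (\<Sum>t\<in>Poly_Mapping.keys p.
     Poly_Mapping.single (t - Poly_Mapping.single i 1)
       (of_nat (Poly_Mapping.lookup t i) * Poly_Mapping.lookup p t))"

lemma mderiv_superset:
  assumes "finite A" "Poly_Mapping.keys p \<subseteq> A"
  shows "mderiv i p = (\<Sum>t\<in>A. Poly_Mapping.single (t - Poly_Mapping.single i 1)
           (of_nat (Poly_Mapping.lookup t i) * Poly_Mapping.lookup p t))"
  unfolding mderiv_def
  by (rule sum.mono_neutral_left) (use assms in \<open>auto simp: in_keys_iff\<close>)

lemma mderiv_add: "mderiv i (p + q) = mderiv i p + mderiv i q"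
proof -
  let ?A = "Poly_Mapping.keys p \<union> Poly_Mapping.keys q"
  show ?thesis
    by (subst (1 2 3) mderiv_superset[of ?A])
       (auto simp: lookup_add single_add distrib_left sum.distrib dest: subsetD[OF keys_add])
qed

lemma mderiv_single:
  "mderiv i (Poly_Mapping.single t c) =
     Poly_Mapping.single (t - Poly_Mapping.single i 1) (of_nat (Poly_Mapping.lookup t i) * c)"
  by (subst mderiv_superset[of "{t}"]) auto


section \<open>The Weyl algebra\<close>

text \<open>
  The \<open>K\<close>-subalgebra of the endomorphism algebra of \<open>K[X]\<close> generated by the multiplications by
  the variables and by the partial derivatives. It is turned into a type, with composition as
  multiplication.
\<close>

inductive_set weyl_ops :: "(('n, 'k::comm_ring_1) mpoly \<Rightarrow> ('n, 'k) mpoly) set" where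
  id: "(\<lambda>p. p) \<in> weyl_ops"
| mult_var: "(\<lambda>p. mvar i * p) \<in> weyl_ops"
| deriv: "mderiv i \<in> weyl_ops"
| add: "f \<in> weyl_ops \<Longrightarrow> g \<in> weyl_ops \<Longrightarrow> (\<lambda>p. f p + g p) \<in> weyl_ops"
| scale: "f \<in> weyl_ops \<Longrightarrow> (\<lambda>p. mconst c * f p) \<in> weyl_ops"
| comp: "f \<in> weyl_ops \<Longrightarrow> g \<in> weyl_ops \<Longrightarrow> (\<lambda>p. f (g p)) \<in> weyl_ops"

lemma weyl_ops_additive: "f \<in> weyl_ops \<Longrightarrow> f (p + q) = f p + f q"
  by (induction arbitrary: p q rule: weyl_ops.induct) (simp_all add: mderiv_add algebra_simps)

lemma mconst_0 [simp]: "mconst 0 = 0" and mconst_1 [simp]: "mconst 1 = 1"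
  and mconst_uminus: "mconst (- c) = - mconst c"
  by (simp_all add: mconst_def single_uminus)

lemma weyl_ops_zero: "(\<lambda>p. 0) \<in> weyl_ops"
  using weyl_ops.scale[OF weyl_ops.id, of 0] by simp

lemma weyl_ops_uminus: "f \<in> weyl_ops \<Longrightarrow> (\<lambda>p. - f p) \<in> weyl_ops"
  using weyl_ops.scale[of f "- 1"] by (simp add: mconst_uminus)

typedef (overloaded) ('n, 'k) weyl =
    "weyl_ops :: (('n, 'k::comm_ring_1) mpoly \<Rightarrow> ('n, 'k) mpoly) set"
  morphisms weyl_apply Abs_weyl
  using weyl_ops.id by blast

setup_lifting type_definition_weyl

instantiation weyl :: (type, comm_ring_1) ring_1
begin

lift_definition zero_weyl :: "('a, 'b) weyl" is "\<lambda>p. 0" by (rule weyl_ops_zero)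
lift_definition one_weyl :: "('a, 'b) weyl" is "\<lambda>p. p" by (rule weyl_ops.id)
lift_definition plus_weyl :: "('a, 'b) weyl \<Rightarrow> ('a, 'b) weyl \<Rightarrow> ('a, 'b) weyl"
  is "\<lambda>f g p. f p + g p" by (rule weyl_ops.add)
lift_definition uminus_weyl :: "('a, 'b) weyl \<Rightarrow> ('a, 'b) weyl"
  is "\<lambda>f p. - f p" by (rule weyl_ops_uminus)
lift_definition minus_weyl :: "('a, 'b) weyl \<Rightarrow> ('a, 'b) weyl \<Rightarrow> ('a, 'b) weyl"
  is "\<lambda>f g p. f p - g p"
  using weyl_ops.add[OF _ weyl_ops_uminus] by force
lift_definition times_weyl :: "('a, 'b) weyl \<Rightarrow> ('a, 'b) weyl \<Rightarrow> ('a, 'b) weyl"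
  is "\<lambda>f g p. f (g p)" by (rule weyl_ops.comp)

instance
proof
  show "(0::('a, 'b) weyl) \<noteq> 1"
    by transfer (auto simp: fun_eq_iff intro!: exI[of _ 1])
qed (transfer; simp add: algebra_simps weyl_ops_additive)+

end

lift_definition weyl_scale :: "'k \<Rightarrow> ('n, 'k::comm_ring_1) weyl \<Rightarrow> ('n, 'k) weyl"
  is "\<lambda>c f p. mconst c * f p" by (rule weyl_ops.scale)

lift_definition weyl_xi :: "'n \<Rightarrow> ('n, 'k::comm_ring_1) weyl"
  is "\<lambda>i p. mvar i * p" by (rule weyl_ops.mult_var)

lift_definition weyl_d :: "'n \<Rightarrow> ('n, 'k::comm_ring_1) weyl"
  is "\<lambda>i. mderiv i" by (rule weyl_ops.deriv)

text \<open>
  The ordered products \<open>\<Prod>\<^sub>i g\<^sub>i\<^bsup>e i\<^esup>\<close>; the type of \<open>g\<^sub>i\<close> is not commutative, but the fold is only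
  used for the pairwise commuting families \<open>\<xi>\<close> and \<open>\<partial>\<close>.
\<close>

definition weyl_pow ::
    "('n::finite \<Rightarrow> ('n, 'k::comm_ring_1) weyl) \<Rightarrow> ('n \<Rightarrow> nat) \<Rightarrow> ('n, 'k) weyl" where
  "weyl_pow g e = Finite_Set.fold (\<lambda>i w. g i ^ e i * w) 1 UNIV"

text \<open>\<open>weyl_monom t\<close> is \<open>\<xi>\<^bsup>\<lambda>\<^esup>\<partial>\<^bsup>\<mu>\<^esup>\<close> for \<open>t = (\<lambda>|\<mu>)\<close>.\<close>

definition weyl_monom :: "(('n::finite + 'n) \<Rightarrow>\<^sub>0 nat) \<Rightarrow> ('n, 'k::comm_ring_1) weyl" where
  "weyl_monom t = weyl_pow weyl_xi (\<lambda>i. Poly_Mapping.lookup t (Inl i))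
                  * weyl_pow weyl_d (\<lambda>i. Poly_Mapping.lookup t (Inr i))"

definition weyl_sum :: "('n::finite + 'n, 'k::comm_ring_1) mpoly \<Rightarrow> ('n, 'k) weyl" where
  "weyl_sum c = (\<Sum>t\<in>Poly_Mapping.keys c. weyl_scale (Poly_Mapping.lookup c t) (weyl_monom t))"


subsection \<open>The standard basis\<close>

lemma weyl_rel_xi: "weyl_xi i * weyl_xi j = weyl_xi j * weyl_xi i"
  by transfer (simp add: fun_eq_iff algebra_simps)

lemma mderiv_sum: "mderiv i (\<Sum>x\<in>A. f x) = (\<Sum>x\<in>A. mderiv i (f x))"
  by (induction A rule: infinite_finite_induct) (simp_all add: mderiv_add, simp_all add: mderiv_def)

lemma mpoly_sum_single:
  "p = (\<Sum>t\<in>Poly_Mapping.keys p. Poly_Mapping.single t (Poly_Mapping.lookup p t))"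
  by (rule poly_mapping_eqI) (auto simp: lookup_sum lookup_single when_def in_keys_iff)

lemma additive_eqI:
  fixes f g :: "('v, 'k::comm_ring_1) mpoly \<Rightarrow> ('v, 'k) mpoly"
  assumes "\<And>p q. f (p + q) = f p + f q" "\<And>p q. g (p + q) = g p + g q"
    and "\<And>t c. f (Poly_Mapping.single t c) = g (Poly_Mapping.single t c)"
  shows "f p = g p"
proof -
  have z: "f 0 = 0" "g 0 = 0" using assms(1)[of 0 0] assms(2)[of 0 0] by auto
  have s: "f (\<Sum>x\<in>A. h x) = (\<Sum>x\<in>A. f (h x))" "g (\<Sum>x\<in>A. h x) = (\<Sum>x\<in>A. g (h x))"
    if "finite A" for A :: "('v \<Rightarrow>\<^sub>0 nat) set" and h
    using that by (induction A) (simp_all add: z assms)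
  show ?thesis
    by (subst (1 2) mpoly_sum_single[of p]) (simp add: s assms)
qed

lemma minus_single_commute:
  fixes t :: "'v \<Rightarrow>\<^sub>0 nat" shows "t - a - b = t - b - a"
  by (rule poly_mapping_eqI) (simp add: lookup_minus)

lemma weyl_rel_d: "weyl_d i * weyl_d j = weyl_d j * weyl_d i"
proof (transfer, rule ext)
  fix i j :: 'a and p :: "('a, 'b) mpoly"
  show "mderiv i (mderiv j p) = mderiv j (mderiv i p)"
    by (rule additive_eqI[of "\<lambda>p. mderiv i (mderiv j p)" "\<lambda>p. mderiv j (mderiv i p)"])
       (auto simp: mderiv_add mderiv_single minus_single_commute[of _ "Poly_Mapping.single i (Suc 0)"]
          lookup_minus lookup_single when_def ac_simps)
qed

lemma mderiv_mvar_mult: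
  fixes p :: "('a, 'b::comm_ring_1) mpoly"
  shows "mderiv i (mvar j * p) = mvar j * mderiv i p + (if i = j then p else 0)"
proof (rule additive_eqI[of "\<lambda>p. mderiv i (mvar j * p)"])
  fix t :: "'a \<Rightarrow>\<^sub>0 nat" and c :: 'b
  have *: "Poly_Mapping.single j 1 + t - Poly_Mapping.single i 1 =
        Poly_Mapping.single j 1 + (t - Poly_Mapping.single i 1)"
    if "i \<noteq> j \<or> Poly_Mapping.lookup t i \<noteq> 0"
  proof (rule poly_mapping_eqI)
    fix k
    show "Poly_Mapping.lookup (Poly_Mapping.single j 1 + t - Poly_Mapping.single i 1) k =
        Poly_Mapping.lookup (Poly_Mapping.single j 1 + (t - Poly_Mapping.single i 1)) k"
      by (insert that, cases "Poly_Mapping.lookup t i"; cases "k = i"; cases "k = j")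
        (auto simp add: lookup_minus lookup_add lookup_single when_def)
  qed
  have **: "Poly_Mapping.single i 1 + t - Poly_Mapping.single i 1 = t"
    by (intro poly_mapping_eqI) (auto simp: lookup_minus lookup_add lookup_single when_def)
  show "mderiv i (mvar j * Poly_Mapping.single t c) =
      mvar j * mderiv i (Poly_Mapping.single t c) + (if i = j then Poly_Mapping.single t c else 0)"
    using * **
    by (cases "Poly_Mapping.lookup t i = 0"; cases "i = j")
       (auto simp: mvar_def mult_single mderiv_single lookup_add lookup_single single_add[symmetric]
         algebra_simps)
qed (simp_all add: mderiv_add algebra_simps)

lemma weyl_rel_d_xi:
  "weyl_d i * weyl_xi j = weyl_xi j * weyl_d i + (if i = j then 1 else 0)"
  by transfer (auto simp: fun_eq_iff mderiv_mvar_mult)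

lemma comp_fun_commute_weyl:
  assumes "\<And>i j. g i * g j = g j * g i"
  shows "comp_fun_commute (\<lambda>i w. g i ^ e i * w :: ('n, 'k::comm_ring_1) weyl)"
proof
  fix i j
  have "g i ^ e i * g j ^ e j = g j ^ e j * g i ^ e i"
    by (rule power_commuting_commutes) (rule sym, rule power_commuting_commutes, rule assms)
  thus "(\<lambda>w. g j ^ e j * w) \<circ> (\<lambda>w. g i ^ e i * w) = (\<lambda>w. g i ^ e i * w) \<circ> (\<lambda>w. g j ^ e j * w)"
    by (simp add: fun_eq_iff mult.assoc[symmetric])
qed

lemma weyl_pow_split:
  assumes "\<And>i j. g i * g j = g j * g i"
  shows "weyl_pow g e = g i ^ e i * Finite_Set.fold (\<lambda>i w. g i ^ e i * w) 1 (UNIV - {i})"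
proof -
  interpret comp_fun_commute "\<lambda>i w. g i ^ e i * w" by (rule comp_fun_commute_weyl[OF assms])
  show ?thesis unfolding weyl_pow_def by (rule fold_rec) auto
qed

lemma weyl_pow_fold_cong:
  fixes g :: "'n::finite \<Rightarrow> ('n, 'k::comm_ring_1) weyl"
  assumes "\<And>i j. g i * g j = g j * g i" "\<And>i. i \<in> A \<Longrightarrow> e i = e' i"
  shows "Finite_Set.fold (\<lambda>i w. g i ^ e i * w) 1 A =
         Finite_Set.fold (\<lambda>i w. g i ^ e' i * w) 1 A"
proof -
  interpret a: comp_fun_commute "\<lambda>i w. g i ^ e i * w" by (rule comp_fun_commute_weyl[OF assms(1)])
  interpret b: comp_fun_commute "\<lambda>i w. g i ^ e' i * w" by (rule comp_fun_commute_weyl[OF assms(1)])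
  have "finite A" by simp
  thus ?thesis using assms(2) by (induction A) auto
qed

lemma weyl_pow_Suc:
  assumes "\<And>i j. g i * g j = g j * g i"
  shows "weyl_pow g (e(i := Suc (e i))) = g i * weyl_pow g e"
  unfolding weyl_pow_split[OF assms, of _ _ i]
  by (subst weyl_pow_fold_cong[OF assms, of _ _ e]) (auto simp: mult.assoc)

lemma weyl_pow_0:
  "weyl_pow g (\<lambda>_. 0) = (1::('n::finite, 'k::comm_ring_1) weyl)"
proof -
  interpret comp_fun_commute "\<lambda>i w. g i ^ 0 * w :: ('n, 'k) weyl" by standard auto
  have "Finite_Set.fold (\<lambda>i w. g i ^ 0 * w) (1::('n, 'k) weyl) A = 1" if "finite A" for A
    using that by (induction A) (simp_all del: power_0, simp)
  thus ?thesis by (simp add: weyl_pow_def)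
qed

lemma weyl_d_xi_power:
  "weyl_d i * weyl_xi i ^ k = weyl_xi i ^ k * weyl_d i + of_nat k * weyl_xi i ^ (k - 1)"
proof -
  have *: "d * x ^ k = x ^ k * d + of_nat k * x ^ (k - 1)"
    if "d * x = x * d + 1" for d x :: "('a, 'b) weyl"
  proof (induction k)
    case (Suc k)
    have "x * (of_nat k * x ^ (k - 1)) = of_nat k * x ^ k"
      by (cases k) (simp_all del: of_nat_Suc add: mult.assoc[symmetric],
          simp only: mult_of_nat_commute[of _ x, symmetric])
    moreover have "d * x ^ Suc k = x * (d * x ^ k) + x ^ k"
      by (simp add: mult.assoc[symmetric] that distrib_right)
    ultimately show ?case
      by (simp add: Suc distrib_left distrib_right mult.assoc add.assoc add.commute)
  qed simp
  show ?thesis by (rule *) (simp add: weyl_rel_d_xi)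
qed

lemma weyl_d_xi_pow:
  "weyl_d i * weyl_pow weyl_xi e = weyl_pow weyl_xi e * weyl_d i
      + of_nat (e i) * weyl_pow weyl_xi (e(i := e i - 1))"
proof -
  let ?R = "\<lambda>A. Finite_Set.fold (\<lambda>i w. weyl_xi i ^ e i * w) (1::('a, 'b) weyl) A"
  interpret comp_fun_commute "\<lambda>i w. weyl_xi i ^ e i * w :: ('a, 'b) weyl"
    by (rule comp_fun_commute_weyl) (rule weyl_rel_xi)
  have *: "weyl_d i * ?R A = ?R A * weyl_d i" if "finite A" "i \<notin> A" for A
    using that
  proof (induction A)
    case (insert j A)
    have "weyl_d i * weyl_xi j = (weyl_xi j * weyl_d i :: ('a, 'b) weyl)"
      using insert by (simp add: weyl_rel_d_xi)
    hence "weyl_d i * weyl_xi j ^ e j = (weyl_xi j ^ e j * weyl_d i :: ('a, 'b) weyl)"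
      by (intro sym[OF power_commuting_commutes]) (rule sym)
    hence "weyl_d i * (weyl_xi j ^ e j * ?R A) = weyl_xi j ^ e j * (weyl_d i * ?R A)"
      by (simp only: mult.assoc[symmetric])
    thus ?case using insert by (simp add: mult.assoc)
  qed simp
  have "weyl_d i * weyl_pow weyl_xi e =
     (weyl_xi i ^ e i * weyl_d i + of_nat (e i) * weyl_xi i ^ (e i - 1)) * ?R (UNIV - {i})"
    unfolding weyl_pow_split[where g = weyl_xi, OF weyl_rel_xi, where e = e and i = i]
    by (simp add: mult.assoc[symmetric] weyl_d_xi_power)
  also have "\<dots> = weyl_xi i ^ e i * ?R (UNIV - {i}) * weyl_d i
      + of_nat (e i) * (weyl_xi i ^ (e i - 1) * ?R (UNIV - {i}))"
    using *[of "UNIV - {i}"] by (simp add: algebra_simps)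
  also have "weyl_xi i ^ (e i - 1) * ?R (UNIV - {i}) = weyl_pow weyl_xi (e(i := e i - 1))"
    unfolding weyl_pow_split[where g = weyl_xi, OF weyl_rel_xi, where e = "e(i := e i - 1)" and i = i]
    by (subst weyl_pow_fold_cong[where g = weyl_xi, OF weyl_rel_xi, where e = "e(i := e i - 1)" and e' = e]) auto
  finally show ?thesis by (simp add: weyl_pow_split[where g = weyl_xi, OF weyl_rel_xi, where e = e and i = i])
qed

lemma weyl_xi_monom:
  "weyl_xi i * weyl_monom t = weyl_monom (t + Poly_Mapping.single (Inl i) 1)"
proof -
  have "(\<lambda>j. Poly_Mapping.lookup (t + Poly_Mapping.single (Inl i) 1) (Inl j)) =
     (\<lambda>j. Poly_Mapping.lookup t (Inl j))(i := Suc (Poly_Mapping.lookup t (Inl i)))"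
    by (auto simp: lookup_add lookup_single when_def)
  moreover have "(\<lambda>j. Poly_Mapping.lookup (t + Poly_Mapping.single (Inl i) 1) (Inr j)) =
     (\<lambda>j. Poly_Mapping.lookup t (Inr j))"
    by (auto simp: lookup_add lookup_single when_def)
  ultimately show ?thesis unfolding weyl_monom_def
    by (simp only: weyl_pow_Suc[where g = weyl_xi, OF weyl_rel_xi,
          where e = "\<lambda>j. Poly_Mapping.lookup t (Inl j)" and i = i] mult.assoc)
qed

lemma weyl_d_monom:
  "weyl_d i * weyl_monom t = weyl_monom (t + Poly_Mapping.single (Inr i) 1)
     + of_nat (Poly_Mapping.lookup t (Inl i)) * weyl_monom (t - Poly_Mapping.single (Inl i) 1)"
proof -
  have 1: "(\<lambda>j. Poly_Mapping.lookup (t + Poly_Mapping.single (Inr i) 1) (Inr j)) =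
     (\<lambda>j. Poly_Mapping.lookup t (Inr j))(i := Suc (Poly_Mapping.lookup t (Inr i)))"
    by (auto simp: lookup_add lookup_single when_def)
  have 2: "(\<lambda>j. Poly_Mapping.lookup (t + Poly_Mapping.single (Inr i) 1) (Inl j)) =
     (\<lambda>j. Poly_Mapping.lookup t (Inl j))"
    by (auto simp: lookup_add lookup_single when_def)
  have 3: "(\<lambda>j. Poly_Mapping.lookup (t - Poly_Mapping.single (Inl i) 1) (Inl j)) =
     (\<lambda>j. Poly_Mapping.lookup t (Inl j))(i := Poly_Mapping.lookup t (Inl i) - 1)"
    by (auto simp: lookup_minus lookup_single when_def)
  have 4: "(\<lambda>j. Poly_Mapping.lookup (t - Poly_Mapping.single (Inl i) 1) (Inr j)) =
     (\<lambda>j. Poly_Mapping.lookup t (Inr j))"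
    by (auto simp: lookup_minus lookup_single when_def)
  have 5: "weyl_pow weyl_d ((\<lambda>j. Poly_Mapping.lookup t (Inr j))(i := Suc (Poly_Mapping.lookup t (Inr i)))) =
     weyl_d i * (weyl_pow weyl_d (\<lambda>j. Poly_Mapping.lookup t (Inr j)) :: ('a, 'b) weyl)"
    by (rule weyl_pow_Suc) (rule weyl_rel_d)
  have 6: "weyl_monom (t + Poly_Mapping.single (Inr i) 1) =
       weyl_pow weyl_xi (\<lambda>j. Poly_Mapping.lookup t (Inl j)) *
        (weyl_d i * (weyl_pow weyl_d (\<lambda>j. Poly_Mapping.lookup t (Inr j)) :: ('a, 'b) weyl))"
    unfolding weyl_monom_def 1 2 5 ..
  have 7: "weyl_monom (t - Poly_Mapping.single (Inl i) 1) =
       weyl_pow weyl_xi ((\<lambda>j. Poly_Mapping.lookup t (Inl j))(i := Poly_Mapping.lookup t (Inl i) - 1)) *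
        (weyl_pow weyl_d (\<lambda>j. Poly_Mapping.lookup t (Inr j)) :: ('a, 'b) weyl)"
    unfolding weyl_monom_def 3 4 ..
  show ?thesis
    unfolding 6 7 unfolding weyl_monom_def[of t]
    by (simp only: mult.assoc[symmetric] weyl_d_xi_pow distrib_right)
qed

lemma mconst_add: "mconst (a + b) = mconst a + mconst b"
  and mconst_mult: "mconst (a * b) = mconst a * mconst b"
  by (simp_all add: mconst_def single_add mult_single)

lemma mconst_mult_single:
  "mconst c * Poly_Mapping.single t a = Poly_Mapping.single t (c * a)"
  by (simp add: mconst_def mult_single)

lemma mderiv_mconst: "mderiv i (mconst c * p) = mconst c * mderiv i p"
  by (rule additive_eqI)
     (simp_all add: mderiv_add distrib_left mconst_mult_single mderiv_single ac_simps)

lemma weyl_ops_mconst: "f \<in> weyl_ops \<Longrightarrow> f (mconst c * p) = mconst c * f p"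
  by (induction arbitrary: p rule: weyl_ops.induct)
     (simp_all add: mderiv_mconst distrib_left mult.left_commute)

lemma weyl_scale_mult_left: "weyl_scale c v * w = weyl_scale c (v * w)"
  by transfer simp

lemma weyl_scale_mult_right: "v * weyl_scale c w = weyl_scale c (v * w)"
  by transfer (simp add: weyl_ops_mconst)

lemma weyl_scale_add_right: "weyl_scale c (v + w) = weyl_scale c v + weyl_scale c w"
  by transfer (simp add: distrib_left)

lemma weyl_scale_add_left: "weyl_scale (c + d) v = weyl_scale c v + weyl_scale d v"
  by transfer (simp add: mconst_add distrib_right)

lemma weyl_scale_scale: "weyl_scale c (weyl_scale d v) = weyl_scale (c * d) v"
  by transfer (simp add: mconst_mult mult.assoc)

lemma weyl_scale_0 [simp]: "weyl_scale 0 v = 0" "weyl_scale c 0 = 0"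
  by (transfer; simp)+

lemma weyl_scale_1 [simp]: "weyl_scale 1 v = v"
  by transfer simp

lemma weyl_scale_of_nat: "of_nat k * v = weyl_scale (of_nat k) v"
  by (induction k) (simp_all add: distrib_right weyl_scale_add_left)

lemma weyl_sum_superset:
  assumes "finite A" "Poly_Mapping.keys c \<subseteq> A"
  shows "weyl_sum c = (\<Sum>t\<in>A. weyl_scale (Poly_Mapping.lookup c t) (weyl_monom t))"
  unfolding weyl_sum_def
  by (rule sum.mono_neutral_left) (use assms in \<open>auto simp: in_keys_iff\<close>)

lemma weyl_sum_add: "weyl_sum (c + d) = weyl_sum c + weyl_sum d"
proof -
  let ?A = "Poly_Mapping.keys c \<union> Poly_Mapping.keys d"
  show ?thesis
    by (subst (1 2 3) weyl_sum_superset[of ?A])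
       (auto simp: lookup_add weyl_scale_add_left sum.distrib dest: subsetD[OF keys_add])
qed

lemma weyl_sum_single: "weyl_sum (Poly_Mapping.single t a) = weyl_scale a (weyl_monom t)"
  by (subst weyl_sum_superset[of "{t}"]) auto

lemma weyl_sum_0 [simp]: "weyl_sum 0 = 0"
  by (simp add: weyl_sum_def)

lemma weyl_scale_sum:
  fixes f :: "'a \<Rightarrow> ('n, 'k::comm_ring_1) weyl"
  shows "weyl_scale a (\<Sum>x\<in>A. f x) = (\<Sum>x\<in>A. weyl_scale a (f x))"
  by (induction A rule: infinite_finite_induct) (simp_all add: weyl_scale_add_right)

lemma weyl_span_scale: "w \<in> range weyl_sum \<Longrightarrow> weyl_scale a w \<in> range weyl_sum"
proof (elim imageE)
  fix c assume "w = weyl_sum c"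
  moreover have "weyl_scale a (weyl_sum c) = weyl_sum (mconst a * c)"
  proof -
    have *: "Poly_Mapping.lookup (mconst a * c) t = a * Poly_Mapping.lookup c t" for t
      unfolding mconst_def mult_map_scale_conv_mult[symmetric] by (simp add: Poly_Mapping.map.rep_eq when_def)
    show ?thesis
      by (subst (1 2) weyl_sum_superset[of "Poly_Mapping.keys c"])
         (auto simp: * in_keys_iff weyl_scale_sum weyl_scale_scale)
  qed
  ultimately show ?thesis by auto
qed

lemma weyl_span_add:
  "v \<in> range weyl_sum \<Longrightarrow> w \<in> range weyl_sum \<Longrightarrow> v + w \<in> range weyl_sum"
proof (elim imageE)
  fix c d assume "v = weyl_sum c" "w = weyl_sum d"
  hence "v + w = weyl_sum (c + d)" by (simp add: weyl_sum_add)
  thus ?thesis by (rule range_eqI)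
qed

lemma weyl_span_0: "0 \<in> range weyl_sum"
  by (rule range_eqI) (rule weyl_sum_0[symmetric])

lemma weyl_span_sum:
  fixes f :: "'a \<Rightarrow> ('n::finite, 'k::comm_ring_1) weyl"
  assumes "\<And>x. x \<in> A \<Longrightarrow> f x \<in> range weyl_sum"
  shows "(\<Sum>x\<in>A. f x) \<in> range weyl_sum"
  using assms
proof (induction A rule: infinite_finite_induct)
  case (insert x A)
  hence "f x + sum f A \<in> range weyl_sum" by (intro weyl_span_add) auto
  moreover have "sum f (insert x A) = f x + sum f A" using insert by simp
  ultimately show ?case by (simp only:)
next
  case (infinite A)
  show ?case unfolding sum.infinite[OF infinite(1)] by (rule weyl_span_0)
next
  case empty
  show ?case unfolding sum.empty by (rule weyl_span_0)
qed

lemma weyl_span_monom: "weyl_monom t \<in> range weyl_sum"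
  using weyl_sum_single[of t 1] by (metis rangeI weyl_scale_1)

lemma weyl_span_mult_left:
  assumes "\<And>t. v * weyl_monom t \<in> range weyl_sum" and "w \<in> range weyl_sum"
  shows "v * w \<in> range weyl_sum"
proof -
  from assms(2) obtain c where w: "w = weyl_sum c" by auto
  have "v * w = (\<Sum>t\<in>Poly_Mapping.keys c. weyl_scale (Poly_Mapping.lookup c t) (v * weyl_monom t))"
    by (simp add: w weyl_sum_def sum_distrib_left weyl_scale_mult_right)
  thus ?thesis by (simp only:) (intro weyl_span_sum weyl_span_scale assms(1))
qed

theorem weyl_span:
  fixes w :: "('n::finite, 'k::comm_ring_1) weyl"
  shows "w \<in> range weyl_sum"
proof -
  have "\<forall>v \<in> range weyl_sum. Abs_weyl f * v \<in> range weyl_sum" if "f \<in> weyl_ops"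
    for f :: "('n, 'k) mpoly \<Rightarrow> ('n, 'k) mpoly"
    using that
  proof (induction rule: weyl_ops.induct)
    case id
    have "Abs_weyl (\<lambda>p :: ('n, 'k) mpoly. p) = 1" by (simp only: one_weyl_def map_fun_def id_apply)
    thus ?case by simp
  next
    case (mult_var i)
    have *: "Abs_weyl ((*) (mvar i) :: ('n, 'k) mpoly \<Rightarrow> _) = weyl_xi i"
      unfolding weyl_xi_def map_fun_def by (simp only: id_apply o_def)
    show ?case unfolding *
      by (rule ballI, rule weyl_span_mult_left) (simp_all only: weyl_xi_monom weyl_span_monom)
  next
    case (deriv i)
    have *: "Abs_weyl (mderiv i :: ('n, 'k) mpoly \<Rightarrow> _) = weyl_d i"
      by (simp add: weyl_d_def)
    have "weyl_d i * weyl_monom t \<in> range (weyl_sum :: _ \<Rightarrow> ('n, 'k) weyl)" for t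
      unfolding weyl_d_monom weyl_scale_of_nat
      by (rule weyl_span_add[OF weyl_span_monom weyl_span_scale[OF weyl_span_monom]])
    thus ?case unfolding * by (intro ballI) (rule weyl_span_mult_left)
  next
    case (add f g)
    have "Abs_weyl (\<lambda>p. f p + g p) = Abs_weyl f + Abs_weyl g"
      using add by (simp add: plus_weyl.abs_eq eq_onp_same_args)
    thus ?case using add by (simp add: distrib_right weyl_span_add)
  next
    case (scale f c)
    have "Abs_weyl (\<lambda>p. mconst c * f p) = weyl_scale c (Abs_weyl f)"
      using scale by (simp add: weyl_scale.abs_eq eq_onp_same_args)
    thus ?case using scale by (simp add: weyl_scale_mult_left weyl_span_scale)
  next
    case (comp f g)
    have "Abs_weyl (\<lambda>p. f (g p)) = Abs_weyl f * Abs_weyl g"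
      using comp by (simp add: times_weyl.abs_eq eq_onp_same_args)
    moreover have "Abs_weyl f * (Abs_weyl g * v) \<in> range weyl_sum" if "v \<in> range weyl_sum" for v
      using comp that by blast
    ultimately show ?case by (simp only: mult.assoc) blast
  qed
  from this[OF weyl_apply, of w] have "\<forall>v \<in> range weyl_sum. w * v \<in> range weyl_sum"
    by (simp add: weyl_apply_inverse)
  moreover have "weyl_monom 0 = (1::('n, 'k) weyl)"
    by (simp add: weyl_monom_def weyl_pow_0)
  hence "1 \<in> range (weyl_sum :: _ \<Rightarrow> ('n, 'k) weyl)" by (metis weyl_span_monom)
  ultimately show ?thesis by (metis mult.right_neutral)
qed

lemma weyl_apply_add: "weyl_apply w (p + q) = weyl_apply w p + weyl_apply w q"
  by (rule weyl_ops_additive[OF weyl_apply])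

lemma weyl_apply_0: "weyl_apply w 0 = 0"
  using weyl_apply_add[of w 0 0] by simp

lemma weyl_apply_mconst: "weyl_apply w (mconst c * p) = mconst c * weyl_apply w p"
  by (rule weyl_ops_mconst[OF weyl_apply])

lemma weyl_apply_single:
  "weyl_apply w (Poly_Mapping.single t c) = mconst c * weyl_apply w (Poly_Mapping.single t 1)"
  using weyl_apply_mconst[of w c "Poly_Mapping.single t 1"] by (simp add: mconst_mult_single)

lemma weyl_apply_sum: "weyl_apply (\<Sum>x\<in>A. f x) p = (\<Sum>x\<in>A. weyl_apply (f x) p)"
  by (induction A rule: infinite_finite_induct) (simp_all add: zero_weyl.rep_eq plus_weyl.rep_eq)

lemma multi_exp_induct [case_names zero Suc]:
  fixes e :: "'n::finite \<Rightarrow> nat"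
  assumes "P (\<lambda>_. 0)" "\<And>e i. P e \<Longrightarrow> P (e(i := Suc (e i)))"
  shows "P e"
proof (induction "\<Sum>i\<in>UNIV. e i" arbitrary: e)
  case 0
  hence "e = (\<lambda>_. 0)" by (simp add: fun_eq_iff)
  thus ?case using assms(1) by simp
next
  case (Suc k)
  have "\<not> (\<forall>i. e i = 0)"
  proof
    assume "\<forall>i. e i = 0"
    hence "(\<Sum>i\<in>UNIV. e i) = 0" by simp
    thus False using Suc(2) by linarith
  qed
  then obtain i where i: "e i \<noteq> 0" by blast
  define e' where "e' = e(i := e i - 1)"
  have e: "e = e'(i := Suc (e' i))" using i by (auto simp: e'_def)
  have "(\<Sum>j\<in>UNIV. e j) = e i + (\<Sum>j\<in>UNIV - {i}. e j)" "(\<Sum>j\<in>UNIV. e' j) = e' i + (\<Sum>j\<in>UNIV - {i}. e' j)"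
    by (rule sum.remove; simp)+
  moreover have "(\<Sum>j\<in>UNIV - {i}. e j) = (\<Sum>j\<in>UNIV - {i}. e' j)"
    by (intro sum.cong) (auto simp: e'_def)
  moreover have "e i = Suc (e' i)" using i by (simp add: e'_def)
  ultimately have "k = (\<Sum>j\<in>UNIV. e' j)" using Suc(2) by linarith
  hence "P e'" by (rule Suc(1))
  from assms(2)[OF this, of i] show ?case unfolding e[symmetric] .
qed

lemma weyl_xi_pow_const:
  fixes e :: "'n::finite \<Rightarrow> nat" and a :: "'k::comm_ring_1"
  shows "weyl_apply (weyl_pow weyl_xi e) (mconst a) = Poly_Mapping.single (Abs_poly_mapping e) a"
proof (induction e rule: multi_exp_induct)
  case zero
  thus ?case by (simp add: weyl_pow_0 one_weyl.rep_eq mconst_def)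
next
  case (Suc e i)
  have 1: "Poly_Mapping.single i 1 + Abs_poly_mapping e = Abs_poly_mapping (e(i := Suc (e i)))"
    by (rule poly_mapping_eqI) (auto simp: lookup_add lookup_single when_def)
  have 2: "weyl_apply (weyl_pow weyl_xi (e(i := Suc (e i)))) (mconst a) =
      mvar i * weyl_apply (weyl_pow weyl_xi e) (mconst a)"
    by (subst weyl_pow_Suc[where g = weyl_xi, OF weyl_rel_xi])
       (simp only: times_weyl.rep_eq weyl_xi.rep_eq)
  show ?case unfolding 2 Suc mvar_def mult_single 1 by (simp only: mult_1_left)
qed

text \<open>
  The operator \<open>\<partial>\<^bsup>\<mu>\<^esup>\<close> maps \<open>X\<^bsup>\<mu>\<^esup>\<close> to a nonzero constant and kills all other monomials of degree
  at most \<open>|\<mu>|\<close>.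
\<close>

lemma weyl_d_pow_monom:
  fixes e :: "'n::finite \<Rightarrow> nat"
  shows "\<exists>a::'k::field_char_0. a \<noteq> 0 \<and> (\<forall>t. (\<Sum>i\<in>UNIV. Poly_Mapping.lookup t i) \<le> (\<Sum>i\<in>UNIV. e i) \<longrightarrow>
     weyl_apply (weyl_pow weyl_d e) (Poly_Mapping.single t 1) =
       (if Poly_Mapping.lookup t = e then mconst a else 0))"
proof (induction e rule: multi_exp_induct)
  case zero
  have "Poly_Mapping.lookup t = (\<lambda>_. 0) \<longleftrightarrow> t = 0" for t :: "'n \<Rightarrow>\<^sub>0 nat"
    by (auto intro!: poly_mapping_eqI)
  moreover have "(\<Sum>i\<in>UNIV. Poly_Mapping.lookup t i) \<le> 0 \<longleftrightarrow> t = 0" for t :: "'n \<Rightarrow>\<^sub>0 nat"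
    by (auto intro!: poly_mapping_eqI)
  ultimately show ?case
    by (intro exI[of _ 1]) (auto simp: weyl_pow_0 one_weyl.rep_eq)
next
  case (Suc e i)
  then obtain a :: 'k where a: "a \<noteq> 0"
    and IH: "\<And>t. (\<Sum>i\<in>UNIV. Poly_Mapping.lookup t i) \<le> (\<Sum>i\<in>UNIV. e i) \<Longrightarrow>
       weyl_apply (weyl_pow weyl_d e) (Poly_Mapping.single t 1) =
       (if Poly_Mapping.lookup t = e then mconst a else 0)" by blast
  let ?e = "e(i := Suc (e i))"
  let ?a = "of_nat (Suc (e i)) * a"
  have comm: "weyl_d i * weyl_pow weyl_d e = weyl_pow weyl_d e * (weyl_d i :: ('n, 'k) weyl)"
  proof (induction e rule: multi_exp_induct)
    case (Suc e j)
    have "weyl_d i * weyl_pow weyl_d (e(j := Suc (e j))) =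
        (weyl_d j * (weyl_d i * weyl_pow weyl_d e) :: ('n, 'k) weyl)"
      unfolding weyl_pow_Suc[where g = weyl_d, OF weyl_rel_d]
      by (simp only: mult.assoc[symmetric] weyl_rel_d[of i j])
    thus ?case unfolding Suc weyl_pow_Suc[where g = weyl_d, OF weyl_rel_d] by (simp only: mult.assoc)
  qed (simp add: weyl_pow_0)
  have e_sum: "(\<Sum>j\<in>UNIV. ?e j) = Suc (\<Sum>j\<in>UNIV. e j)"
    by (simp add: sum.remove[of UNIV i])
  show ?case
  proof (intro exI[of _ ?a] conjI allI impI)
    show "?a \<noteq> 0" using a by (simp del: of_nat_Suc)
    fix t :: "'n \<Rightarrow>\<^sub>0 nat" assume le: "(\<Sum>j\<in>UNIV. Poly_Mapping.lookup t j) \<le> (\<Sum>j\<in>UNIV. ?e j)"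
    let ?t = "t - Poly_Mapping.single i 1"
    have eq: "weyl_apply (weyl_pow weyl_d ?e) (Poly_Mapping.single t (1::'k)) =
        mconst (of_nat (Poly_Mapping.lookup t i)) *
        weyl_apply (weyl_pow weyl_d e) (Poly_Mapping.single ?t 1)"
      unfolding weyl_pow_Suc[where g = weyl_d, OF weyl_rel_d] comm times_weyl.rep_eq
      by (simp only: weyl_d.rep_eq mderiv_single mult_1_right)
         (rule weyl_apply_single)
    show "weyl_apply (weyl_pow weyl_d ?e) (Poly_Mapping.single t 1) =
        (if Poly_Mapping.lookup t = ?e then mconst ?a else 0)"
    proof (cases "Poly_Mapping.lookup t i")
      case 0
      hence "Poly_Mapping.lookup t \<noteq> ?e" by auto
      thus ?thesis using 0 by (simp add: eq)
    next
      case (Suc k)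
      have l: "Poly_Mapping.lookup t = (Poly_Mapping.lookup ?t)(i := Suc (Poly_Mapping.lookup ?t i))"
        using Suc by (auto simp: lookup_minus lookup_single when_def)
      have "(\<Sum>j\<in>UNIV. Poly_Mapping.lookup t j) = Suc (\<Sum>j\<in>UNIV. Poly_Mapping.lookup ?t j)"
        by (subst l) (simp add: sum.remove[of UNIV i])
      hence "(\<Sum>j\<in>UNIV. Poly_Mapping.lookup ?t j) \<le> (\<Sum>j\<in>UNIV. e j)"
        using le e_sum by simp
      note IH = IH[OF this]
      have iff: "Poly_Mapping.lookup t = ?e \<longleftrightarrow> Poly_Mapping.lookup ?t = e"
        by (subst l) (auto simp: fun_eq_iff split: if_splits)
      show ?thesis
      proof (cases "Poly_Mapping.lookup t = ?e")
        case True
        hence "Poly_Mapping.lookup t i = Suc (e i)" by simp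
        thus ?thesis unfolding eq IH using True iff by (simp only: mconst_mult if_True simp_thms)
      next
        case False
        thus ?thesis unfolding eq IH using iff by simp
      qed
    qed
  qed
qed

lemma weyl_sum_eq_0:
  fixes c :: "('n::finite + 'n, 'k::field_char_0) mpoly"
  assumes "weyl_sum c = 0"
  shows "c = 0"
proof (rule ccontr)
  assume "c \<noteq> 0"
  hence ne: "Poly_Mapping.keys c \<noteq> {}" by simp
  let ?x = "\<lambda>(t :: 'n + 'n \<Rightarrow>\<^sub>0 nat) i. Poly_Mapping.lookup t (Inl i)"
  let ?d = "\<lambda>(t :: 'n + 'n \<Rightarrow>\<^sub>0 nat) i. Poly_Mapping.lookup t (Inr i)"
  let ?w = "\<lambda>t. \<Sum>i\<in>UNIV. ?d t i"
  obtain s where s: "s \<in> Poly_Mapping.keys c" "\<And>t. t \<in> Poly_Mapping.keys c \<Longrightarrow> ?w s \<le> ?w t"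
  proof -
    from ne obtain s0 where "s0 \<in> Poly_Mapping.keys c" by blast
    from ex_has_least_nat[of "\<lambda>t. t \<in> Poly_Mapping.keys c", OF this, of ?w]
    show ?thesis using that by blast
  qed
  define v where "v = Abs_poly_mapping (?d s)"
  have v: "Poly_Mapping.lookup v = ?d s" by (simp add: v_def)
  obtain a :: 'k where a: "a \<noteq> 0"
    "weyl_apply (weyl_pow weyl_d (?d s)) (Poly_Mapping.single v 1) = mconst a"
  proof -
    obtain a :: 'k where "a \<noteq> 0" and *: "\<And>t. (\<Sum>i\<in>UNIV. Poly_Mapping.lookup t i) \<le> ?w s \<Longrightarrow>
        weyl_apply (weyl_pow weyl_d (?d s)) (Poly_Mapping.single t 1) =
          (if Poly_Mapping.lookup t = ?d s then mconst a else 0)"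
      using weyl_d_pow_monom[where 'k = 'k, of "?d s"] by blast
    moreover have "weyl_apply (weyl_pow weyl_d (?d s)) (Poly_Mapping.single v 1) = mconst a"
      using *[of v] unfolding v by (simp only: order_refl if_True simp_thms)
    ultimately show ?thesis using that by blast
  qed
  have d: "weyl_apply (weyl_pow weyl_d (?d t)) (Poly_Mapping.single v 1) =
      (if ?d t = ?d s then mconst a else 0)" if "t \<in> Poly_Mapping.keys c" for t
  proof (cases "?d t = ?d s")
    case True
    show ?thesis unfolding True using a(2) by (simp only: if_True simp_thms)
  next
    case False
    obtain b :: 'k where *: "\<And>u. (\<Sum>i\<in>UNIV. Poly_Mapping.lookup u i) \<le> ?w t \<Longrightarrow>
        weyl_apply (weyl_pow weyl_d (?d t)) (Poly_Mapping.single u 1) =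
          (if Poly_Mapping.lookup u = ?d t then mconst b else 0)"
      using weyl_d_pow_monom[where 'k = 'k, of "?d t"] by blast
    show ?thesis using *[of v] s(2)[OF that] False not_sym[OF False] unfolding v
      by (simp only: if_False)
  qed
  have "weyl_apply (weyl_sum c) (Poly_Mapping.single v 1) =
     (\<Sum>t\<in>Poly_Mapping.keys c. if ?d t = ?d s
        then Poly_Mapping.single (Abs_poly_mapping (?x t)) (Poly_Mapping.lookup c t * a) else 0)"
    unfolding weyl_sum_def weyl_apply_sum
  proof (intro sum.cong refl)
    fix t assume "t \<in> Poly_Mapping.keys c"
    note d = d[OF this]
    show "weyl_apply (weyl_scale (Poly_Mapping.lookup c t) (weyl_monom t)) (Poly_Mapping.single v 1) =
        (if ?d t = ?d s
         then Poly_Mapping.single (Abs_poly_mapping (?x t)) (Poly_Mapping.lookup c t * a) else 0)"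
      unfolding weyl_scale.rep_eq weyl_monom_def times_weyl.rep_eq d
      by (cases "?d t = ?d s")
         (simp_all only: if_True if_False simp_thms weyl_xi_pow_const mconst_mult_single
           weyl_apply_0 mult_zero_right)
  qed
  hence "0 = Poly_Mapping.lookup (\<Sum>t\<in>Poly_Mapping.keys c. if ?d t = ?d s
        then Poly_Mapping.single (Abs_poly_mapping (?x t)) (Poly_Mapping.lookup c t * a) else 0)
        (Abs_poly_mapping (?x s))"
    using assms by (simp add: zero_weyl.rep_eq)
  also have "\<dots> = (\<Sum>t\<in>Poly_Mapping.keys c. if t = s then Poly_Mapping.lookup c t * a else 0)"
    unfolding lookup_sum
  proof (intro sum.cong refl)
    fix t
    have "t = s \<longleftrightarrow> ?d t = ?d s \<and> Abs_poly_mapping (?x t) = Abs_poly_mapping (?x s)"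
    proof (intro iffI conjI)
      assume *: "?d t = ?d s \<and> Abs_poly_mapping (?x t) = Abs_poly_mapping (?x s)"
      hence "Poly_Mapping.lookup (Abs_poly_mapping (?x t)) = Poly_Mapping.lookup (Abs_poly_mapping (?x s))"
        by simp
      hence x: "?x t = ?x s" by (subst (asm) (1 2) lookup_Abs_poly_mapping) simp_all
      show "t = s"
      proof (rule poly_mapping_eqI)
        fix k
        show "Poly_Mapping.lookup t k = Poly_Mapping.lookup s k"
          using fun_cong[OF x] fun_cong[OF conjunct1[OF *]] by (cases k) auto
      qed
    qed auto
    thus "Poly_Mapping.lookup (if ?d t = ?d s
        then Poly_Mapping.single (Abs_poly_mapping (?x t)) (Poly_Mapping.lookup c t * a) else 0)
        (Abs_poly_mapping (?x s)) = (if t = s then Poly_Mapping.lookup c t * a else 0)"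
      by (cases "?d t = ?d s") (simp_all add: lookup_single when_def)
  qed
  also have "\<dots> = Poly_Mapping.lookup c s * a" using s(1) by simp
  finally show False using s(1) a(1) by (simp add: in_keys_iff)
qed

theorem weyl_basis:
  fixes w :: "('n::finite, 'k::field_char_0) weyl"
  shows "\<exists>!c. w = weyl_sum c"
proof (rule ex_ex1I)
  show "\<exists>c. w = weyl_sum c" using weyl_span[of w] by auto
  fix c d assume "w = weyl_sum c" "w = weyl_sum d"
  moreover have "weyl_sum c = weyl_sum (c - d) + weyl_sum d" by (simp flip: weyl_sum_add)
  ultimately have "weyl_sum (c - d) = 0" by simp
  hence "c - d = 0" by (rule weyl_sum_eq_0)
  thus "c = d" by simp
qed


section \<open>Weighted degrees and filtrations of the Weyl algebra\<close>

definition weyl_coeffs :: "('n::finite, 'k::field_char_0) weyl \<Rightarrow> ('n + 'n, 'k) mpoly" where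
  "weyl_coeffs w = (THE c. w = weyl_sum c)"

definition weyl_supp :: "('n::finite, 'k::field_char_0) weyl \<Rightarrow> ('n + 'n \<Rightarrow>\<^sub>0 nat) set" where
  "weyl_supp w = Poly_Mapping.keys (weyl_coeffs w)"

definition wdot :: "('v::finite \<Rightarrow> nat) \<Rightarrow> ('v \<Rightarrow>\<^sub>0 nat) \<Rightarrow> nat" where
  "wdot \<omega> t = (\<Sum>v\<in>UNIV. \<omega> v * Poly_Mapping.lookup t v)"

text \<open>\<open>weight_pair r s\<close> is \<open>(r|s)\<close>.\<close>

definition weight_pair :: "nat \<Rightarrow> nat \<Rightarrow> 'n + 'n \<Rightarrow> nat" where
  "weight_pair r s = case_sum (\<lambda>_. r) (\<lambda>_. s)"

definition Omega :: "('n + 'n \<Rightarrow> nat) set" where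
  "Omega = {\<omega>. \<forall>i. \<omega> (Inl i) + \<omega> (Inr i) > 0}"

text \<open>The supremum is taken in the extended reals, so that \<open>weyl_deg \<omega> 0 = - \<infinity>\<close>.\<close>

definition weyl_deg :: "('n::finite + 'n \<Rightarrow> nat) \<Rightarrow> ('n, 'k::field_char_0) weyl \<Rightarrow> ereal" where
  "weyl_deg \<omega> w = (SUP t\<in>weyl_supp w. ereal (real (wdot \<omega> t)))"

definition weyl_filt :: "('n::finite + 'n \<Rightarrow> nat) \<Rightarrow> int \<Rightarrow> ('n, 'k::field_char_0) weyl set" where
  "weyl_filt \<omega> i = {w. weyl_deg \<omega> w \<le> ereal (real_of_int i)}"

lemma weyl_sum_coeffs: "weyl_sum (weyl_coeffs w) = w"
  unfolding weyl_coeffs_def using theI'[OF weyl_basis[of w]] by simp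

lemma weyl_coeffs_sum: "weyl_coeffs (weyl_sum c) = c"
  using weyl_basis[of "weyl_sum c"] weyl_sum_coeffs[of "weyl_sum c"] by metis

lemma weyl_filt_iff:
  "w \<in> weyl_filt \<omega> i \<longleftrightarrow> (\<forall>t\<in>Poly_Mapping.keys (weyl_coeffs w). int (wdot \<omega> t) \<le> i)"
proof -
  have "real n \<le> real_of_int i \<longleftrightarrow> int n \<le> i" for n by linarith
  thus ?thesis by (simp add: weyl_filt_def weyl_deg_def weyl_supp_def SUP_le_iff)
qed

lemma weyl_coeffs_add: "weyl_coeffs (v + w) = weyl_coeffs v + weyl_coeffs w"
  using weyl_coeffs_sum[of "weyl_coeffs v + weyl_coeffs w"] by (simp add: weyl_sum_add weyl_sum_coeffs)

lemma weyl_coeffs_0: "weyl_coeffs 0 = (0 :: ('n::finite + 'n, 'k::field_char_0) mpoly)"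
  using weyl_coeffs_sum[of "0 :: ('n + 'n, 'k) mpoly"] by simp

lemma weyl_coeffs_uminus: "weyl_coeffs (- w) = - weyl_coeffs w"
proof -
  have "weyl_coeffs (- w) + weyl_coeffs w = 0"
    by (simp flip: weyl_coeffs_add add: weyl_coeffs_0)
  thus ?thesis by (simp add: eq_neg_iff_add_eq_0)
qed

lemma weyl_coeffs_scale_monom:
  "weyl_coeffs (weyl_scale a (weyl_monom t)) = Poly_Mapping.single t a"
  by (metis weyl_coeffs_sum weyl_sum_single)

lemma weyl_filt_0: "0 \<in> weyl_filt \<omega> i"
  by (simp add: weyl_filt_iff weyl_coeffs_0)

lemma weyl_filt_add: "v \<in> weyl_filt \<omega> i \<Longrightarrow> w \<in> weyl_filt \<omega> i \<Longrightarrow> v + w \<in> weyl_filt \<omega> i"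
  by (auto simp: weyl_filt_iff weyl_coeffs_add dest: subsetD[OF keys_add])

lemma weyl_filt_uminus: "w \<in> weyl_filt \<omega> i \<Longrightarrow> - w \<in> weyl_filt \<omega> i"
  by (auto simp: weyl_filt_iff weyl_coeffs_uminus in_keys_iff)

lemma weyl_filt_sum: "(\<And>x. x \<in> A \<Longrightarrow> f x \<in> weyl_filt \<omega> i) \<Longrightarrow> (\<Sum>x\<in>A. f x) \<in> weyl_filt \<omega> i"
  by (induction A rule: infinite_finite_induct) (simp_all add: weyl_filt_0 weyl_filt_add)

lemma weyl_filt_mono: "i \<le> j \<Longrightarrow> w \<in> weyl_filt \<omega> i \<Longrightarrow> w \<in> weyl_filt \<omega> j"
  by (auto simp: weyl_filt_iff)

lemma weyl_filt_exhaustive: "\<exists>i. w \<in> weyl_filt \<omega> i"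
proof (intro exI)
  show "w \<in> weyl_filt \<omega> (\<Sum>t\<in>Poly_Mapping.keys (weyl_coeffs w). int (wdot \<omega> t))"
    unfolding weyl_filt_iff by (intro ballI member_le_sum) auto
qed

lemma weyl_filt_scale_monom: "int (wdot \<omega> t) \<le> i \<Longrightarrow> weyl_scale a (weyl_monom t) \<in> weyl_filt \<omega> i"
  by (auto simp: weyl_filt_iff weyl_coeffs_scale_monom split: if_splits)

lemma weyl_filt_scale:
  assumes "u \<in> weyl_filt \<omega> i"
  shows "weyl_scale a u \<in> weyl_filt \<omega> i"
proof -
  have "weyl_scale a u = (\<Sum>t\<in>Poly_Mapping.keys (weyl_coeffs u).
      weyl_scale (a * Poly_Mapping.lookup (weyl_coeffs u) t) (weyl_monom t))"
    by (subst weyl_sum_coeffs[of u, symmetric])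
       (simp only: weyl_sum_def weyl_scale_sum weyl_scale_scale)
  also have "\<dots> \<in> weyl_filt \<omega> i"
    using assms by (intro weyl_filt_sum weyl_filt_scale_monom) (simp add: weyl_filt_iff)
  finally show ?thesis .
qed

lemma weyl_filt_mult_monom:
  fixes v w :: "('n::finite, 'k::field_char_0) weyl"
  assumes "\<And>t. v * weyl_monom t \<in> weyl_filt \<omega> (d + int (wdot \<omega> t))" and "w \<in> weyl_filt \<omega> j"
  shows "v * w \<in> weyl_filt \<omega> (d + j)"
proof -
  have "v * w = (\<Sum>t\<in>Poly_Mapping.keys (weyl_coeffs w).
      weyl_scale (Poly_Mapping.lookup (weyl_coeffs w) t) (v * weyl_monom t))"
    by (subst weyl_sum_coeffs[of w, symmetric])
       (simp only: weyl_sum_def sum_distrib_left weyl_scale_mult_right)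
  also have "\<dots> \<in> weyl_filt \<omega> (d + j)"
  proof (intro weyl_filt_sum weyl_filt_scale)
    fix t assume "t \<in> Poly_Mapping.keys (weyl_coeffs w)"
    hence "d + int (wdot \<omega> t) \<le> d + j" using assms(2) by (simp add: weyl_filt_iff)
    thus "v * weyl_monom t \<in> weyl_filt \<omega> (d + j)" using assms(1) by (rule weyl_filt_mono)
  qed
  finally show ?thesis .
qed

lemma wdot_add: "wdot \<omega> (s + t) = wdot \<omega> s + wdot \<omega> t"
  by (simp add: wdot_def lookup_add distrib_left sum.distrib)

lemma wdot_single: "wdot \<omega> (Poly_Mapping.single v k) = \<omega> v * k"
  by (simp add: wdot_def lookup_single when_def if_distrib cong: if_cong)

lemma weyl_filt_xi_mult:
  fixes w :: "('n::finite, 'k::field_char_0) weyl"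
  assumes "w \<in> weyl_filt \<omega> j"
  shows "weyl_xi i * w \<in> weyl_filt \<omega> (int (\<omega> (Inl i)) + j)"
proof (rule weyl_filt_mult_monom[OF _ assms])
  fix t
  have "weyl_scale 1 (weyl_monom (t + Poly_Mapping.single (Inl i) 1) :: ('n, 'k) weyl)
      \<in> weyl_filt \<omega> (int (\<omega> (Inl i)) + int (wdot \<omega> t))"
    by (rule weyl_filt_scale_monom) (simp add: wdot_add wdot_single)
  thus "weyl_xi i * weyl_monom t \<in> (weyl_filt \<omega> (int (\<omega> (Inl i)) + int (wdot \<omega> t)) :: ('n, 'k) weyl set)"
    by (simp only: weyl_xi_monom weyl_scale_1)
qed

lemma weyl_filt_d_mult:
  fixes w :: "('n::finite, 'k::field_char_0) weyl"
  assumes "w \<in> weyl_filt \<omega> j"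
  shows "weyl_d i * w \<in> weyl_filt \<omega> (int (\<omega> (Inr i)) + j)"
proof (rule weyl_filt_mult_monom[OF _ assms])
  fix t
  let ?F = "weyl_filt \<omega> (int (\<omega> (Inr i)) + int (wdot \<omega> t)) :: ('n, 'k) weyl set"
  have "weyl_scale 1 (weyl_monom (t + Poly_Mapping.single (Inr i) 1) :: ('n, 'k) weyl) \<in> ?F"
    by (rule weyl_filt_scale_monom) (simp add: wdot_add wdot_single)
  moreover have "wdot \<omega> (t - Poly_Mapping.single (Inl i) 1) \<le> wdot \<omega> t"
    unfolding wdot_def by (intro sum_mono mult_left_mono) (auto simp: lookup_minus)
  hence "weyl_scale (of_nat (Poly_Mapping.lookup t (Inl i)))
      (weyl_monom (t - Poly_Mapping.single (Inl i) 1)) \<in> ?F"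
    by (intro weyl_filt_scale_monom) simp
  ultimately show "weyl_d i * weyl_monom t \<in> ?F"
    unfolding weyl_d_monom weyl_scale_of_nat weyl_scale_1 by (rule weyl_filt_add)
qed

lemma weyl_filt_pow_mult:
  fixes g :: "'n::finite \<Rightarrow> ('n, 'k::field_char_0) weyl"
  assumes comm: "\<And>i j. g i * g j = g j * g i"
    and g: "\<And>i j w. w \<in> weyl_filt \<omega> j \<Longrightarrow> g i * w \<in> weyl_filt \<omega> (int (h i) + j)"
    and w: "w \<in> weyl_filt \<omega> j"
  shows "weyl_pow g e * w \<in> weyl_filt \<omega> (int (\<Sum>i\<in>UNIV. h i * e i) + j)"
proof (induction e rule: multi_exp_induct)
  case zero
  show ?case using w by (simp add: weyl_pow_0)
next
  case (Suc e i)
  have "(\<Sum>j\<in>UNIV. h j * (e(i := Suc (e i))) j) = h i + (\<Sum>j\<in>UNIV. h j * e j)"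
    by (simp add: sum.remove[of UNIV i])
  hence "int (\<Sum>j\<in>UNIV. h j * (e(i := Suc (e i))) j) + j = int (h i) + (int (\<Sum>j\<in>UNIV. h j * e j) + j)"
    by (simp only: of_nat_add add.assoc)
  moreover have "weyl_pow g (e(i := Suc (e i))) * w = g i * (weyl_pow g e * w)"
    by (subst weyl_pow_Suc[where g = g, OF comm]) (rule mult.assoc)
  ultimately show ?case using g[OF Suc, of i] by (simp only:)
qed

lemma weyl_filt_monom_mult:
  fixes w :: "('n::finite, 'k::field_char_0) weyl"
  assumes "w \<in> weyl_filt \<omega> j"
  shows "weyl_monom t * w \<in> weyl_filt \<omega> (int (wdot \<omega> t) + j)"
proof -
  let ?x = "\<lambda>i. Poly_Mapping.lookup t (Inl i)" and ?y = "\<lambda>i. Poly_Mapping.lookup t (Inr i)"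
  let ?a = "\<Sum>i\<in>UNIV. \<omega> (Inl i) * ?x i" and ?b = "\<Sum>i\<in>UNIV. \<omega> (Inr i) * ?y i"
  have "wdot \<omega> t = ?a + ?b"
    unfolding wdot_def UNIV_Plus_UNIV[symmetric] by (subst sum.Plus) simp_all
  moreover have "weyl_pow weyl_d ?y * w \<in> weyl_filt \<omega> (int ?b + j)"
    by (intro weyl_filt_pow_mult[where g = weyl_d and h = "\<lambda>i. \<omega> (Inr i)"] weyl_rel_d weyl_filt_d_mult assms)
  hence "weyl_pow weyl_xi ?x * (weyl_pow weyl_d ?y * w) \<in> weyl_filt \<omega> (int ?a + (int ?b + j))"
    by (intro weyl_filt_pow_mult[where g = weyl_xi and h = "\<lambda>i. \<omega> (Inl i)"] weyl_rel_xi weyl_filt_xi_mult)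
  ultimately show ?thesis by (simp only: weyl_monom_def mult.assoc add.assoc of_nat_add)
qed

lemma weyl_filt_mult:
  assumes "v \<in> weyl_filt \<omega> i" "w \<in> weyl_filt \<omega> j"
  shows "v * w \<in> weyl_filt \<omega> (i + j)"
proof -
  have "v * w = (\<Sum>t\<in>Poly_Mapping.keys (weyl_coeffs v).
      weyl_scale (Poly_Mapping.lookup (weyl_coeffs v) t) (weyl_monom t * w))"
    by (subst weyl_sum_coeffs[of v, symmetric])
       (simp only: weyl_sum_def sum_distrib_right weyl_scale_mult_left)
  also have "\<dots> \<in> weyl_filt \<omega> (i + j)"
  proof (intro weyl_filt_sum weyl_filt_scale)
    fix t assume "t \<in> Poly_Mapping.keys (weyl_coeffs v)"
    hence "int (wdot \<omega> t) + j \<le> i + j" using assms(1) by (simp add: weyl_filt_iff)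
    thus "weyl_monom t * w \<in> weyl_filt \<omega> (i + j)"
      using weyl_filt_monom_mult[OF assms(2)] by (rule weyl_filt_mono)
  qed
  finally show ?thesis .
qed


section \<open>Filtered modules and their associated graded modules\<close>

locale left_module =
  fixes act :: "'r::ring_1 \<Rightarrow> 'm::ab_group_add \<Rightarrow> 'm"
  assumes act_add_right: "act a (x + y) = act a x + act a y"
    and act_add_left: "act (a + b) x = act a x + act b x"
    and act_act: "act a (act b x) = act (a * b) x"
    and act_one: "act 1 x = x"

definition finitely_generated :: "('r::ring_1 \<Rightarrow> 'm::ab_group_add \<Rightarrow> 'm) \<Rightarrow> bool" where
  "finitely_generated act \<longleftrightarrow> (\<exists>S. finite S \<and> (\<forall>x. \<exists>a. x = (\<Sum>m\<in>S. act (a m) m)))"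

text \<open>
  Filtrations are ascending, exhaustive, indexed by the integers, and compatible with the
  filtration of the Weyl algebra.
\<close>

definition module_filtration ::
    "('n::finite + 'n \<Rightarrow> nat) \<Rightarrow> (('n, 'k::field_char_0) weyl \<Rightarrow> 'm::ab_group_add \<Rightarrow> 'm)
      \<Rightarrow> (int \<Rightarrow> 'm set) \<Rightarrow> bool" where
  "module_filtration \<omega> act F \<longleftrightarrow>
     (\<forall>i. 0 \<in> F i \<and> (\<forall>x\<in>F i. \<forall>y\<in>F i. x - y \<in> F i)) \<and>
     (\<forall>i j. i \<le> j \<longrightarrow> F i \<subseteq> F j) \<and>
     (\<Union>i. F i) = UNIV \<and>
     (\<forall>i j. \<forall>w\<in>weyl_filt \<omega> i. \<forall>x\<in>F j. act w x \<in> F (i + j))"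

definition good_filtration ::
    "('n::finite + 'n \<Rightarrow> nat) \<Rightarrow> (('n, 'k::field_char_0) weyl \<Rightarrow> 'm::ab_group_add \<Rightarrow> 'm)
      \<Rightarrow> (int \<Rightarrow> 'm set) \<Rightarrow> bool" where
  "good_filtration \<omega> act F \<longleftrightarrow> module_filtration \<omega> act F \<and>
     (\<exists>S :: ('m \<times> int) set. finite S \<and>
        (\<forall>i. F i = {\<Sum>(m, p)\<in>S. act (a (m, p)) m | a. \<forall>(m, p)\<in>S. a (m, p) \<in> weyl_filt \<omega> (i - p)}))"

lemma good_filtration_exists:
  fixes act :: "('n::finite, 'k::field_char_0) weyl \<Rightarrow> 'm::ab_group_add \<Rightarrow> 'm"
  assumes "left_module act" "finitely_generated act"
  shows "\<exists>F. good_filtration \<omega> act F"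
proof -
  interpret left_module act by fact
  obtain S where S: "finite S" "\<And>x. \<exists>a. x = (\<Sum>m\<in>S. act (a m) m)"
    using assms(2) unfolding finitely_generated_def by blast
  define F where "F i = {\<Sum>m\<in>S. act (a m) m | a. \<forall>m\<in>S. a m \<in> weyl_filt \<omega> i}" for i
  have act0: "act w 0 = 0" for w using act_add_right[of w 0 0] by simp
  have act0': "act 0 x = 0" for x using act_add_left[of 0 0 x] by simp
  have actm: "act (a - b) x = act a x - act b x" for a b x
    using act_add_left[of "a - b" b x] by (simp add: algebra_simps)
  have acts: "act w (\<Sum>m\<in>S. f m) = (\<Sum>m\<in>S. act w (f m))" for w f
    using S(1) by (induction S) (simp_all add: act0 act_add_right)
  have "module_filtration \<omega> act F"
    unfolding module_filtration_def
  proof (intro conjI allI ballI impI)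
    fix i
    show "0 \<in> F i"
      unfolding F_def by (auto intro!: exI[of _ "\<lambda>_. 0"] simp: act0' weyl_filt_0)
    fix x y assume "x \<in> F i" "y \<in> F i"
    then obtain a b where ab: "x = (\<Sum>m\<in>S. act (a m) m)" "\<forall>m\<in>S. a m \<in> weyl_filt \<omega> i"
       "y = (\<Sum>m\<in>S. act (b m) m)" "\<forall>m\<in>S. b m \<in> weyl_filt \<omega> i" unfolding F_def by blast
    have "x - y = (\<Sum>m\<in>S. act (a m - b m) m)" by (simp add: ab actm sum_subtractf)
    moreover have "\<forall>m\<in>S. a m - b m \<in> weyl_filt \<omega> i"
      using ab weyl_filt_add[OF _ weyl_filt_uminus] by fastforce
    ultimately show "x - y \<in> F i" unfolding F_def by (intro CollectI exI[of _ "\<lambda>m. a m - b m"] conjI)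
  next
    fix i j :: int assume "i \<le> j"
    thus "F i \<subseteq> F j" unfolding F_def using weyl_filt_mono by blast
  next
    have "\<exists>i. x \<in> F i" for x
    proof -
      obtain a where a: "x = (\<Sum>m\<in>S. act (a m) m)" using S(2) by blast
      define d where "d m = (SOME i. a m \<in> weyl_filt \<omega> i)" for m
      have d: "a m \<in> weyl_filt \<omega> (d m)" for m
        unfolding d_def by (rule someI_ex) (rule weyl_filt_exhaustive)
      have "d m \<le> (\<Sum>m\<in>S. \<bar>d m\<bar>)" if "m \<in> S" for m
        using member_le_sum[of m S "\<lambda>m. \<bar>d m\<bar>"] that S(1) by auto
      hence "\<forall>m\<in>S. a m \<in> weyl_filt \<omega> (\<Sum>m\<in>S. \<bar>d m\<bar>)" using d weyl_filt_mono by blast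
      thus ?thesis using a unfolding F_def by blast
    qed
    thus "(\<Union>i. F i) = UNIV" by auto
  next
    fix i j x and w :: "('n, 'k) weyl" assume w: "w \<in> weyl_filt \<omega> i" and "x \<in> F j"
    then obtain a where a: "x = (\<Sum>m\<in>S. act (a m) m)" "\<forall>m\<in>S. a m \<in> weyl_filt \<omega> j"
      unfolding F_def by blast
    have "act w x = (\<Sum>m\<in>S. act (w * a m) m)" by (simp add: a acts act_act)
    moreover have "\<forall>m\<in>S. w * a m \<in> weyl_filt \<omega> (i + j)" using a w weyl_filt_mult by blast
    ultimately show "act w x \<in> F (i + j)"
      unfolding F_def by (intro CollectI exI[of _ "\<lambda>m. w * a m"]) blast
  qed
  moreover have "F i = {\<Sum>(m, p)\<in>S \<times> {0}. act (a (m, p)) m | a.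
      \<forall>(m, p)\<in>S \<times> {0}. a (m, p) \<in> weyl_filt \<omega> (i - p)}" (is "_ = ?G") for i
  proof -
    have *: "(\<Sum>(m, p)\<in>S \<times> {0}. act (a (m, p)) m) = (\<Sum>m\<in>S. act (a (m, 0)) m)"
      for a :: "'m \<times> int \<Rightarrow> _"
      by (subst sum.cartesian_product[symmetric]) simp
    show ?thesis
    proof (intro equalityI subsetI)
      fix x assume "x \<in> F i"
      then obtain a where a: "x = (\<Sum>m\<in>S. act (a m) m)" "\<forall>m\<in>S. a m \<in> weyl_filt \<omega> i"
        unfolding F_def by blast
      show "x \<in> ?G"
        unfolding * using a by (intro CollectI exI[of _ "\<lambda>(m, p). a m"]) simp
    next
      fix x assume "x \<in> ?G"
      then obtain a where a: "x = (\<Sum>m\<in>S. act (a (m, 0)) m)"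
          "\<forall>(m, p)\<in>S \<times> {0}. a (m, p) \<in> weyl_filt \<omega> (i - p)"
        unfolding * by blast
      from a(2) have "\<forall>m\<in>S. a (m, 0) \<in> weyl_filt \<omega> i" by simp
      with a(1) show "x \<in> F i" unfolding F_def by (intro CollectI exI[of _ "\<lambda>m. a (m, 0)"] conjI)
    qed
  qed
  ultimately show ?thesis
    unfolding good_filtration_def using S(1) by (intro exI[of _ F] conjI exI[of _ "S \<times> {0}"]) auto
qed

text \<open>
  Elements of \<open>\<Oplus>\<^sub>i F\<^sub>i / F\<^sub>i\<^sub>-\<^sub>1\<close> are families of cosets \<open>x\<^sub>i + F\<^sub>i\<^sub>-\<^sub>1\<close> with \<open>x\<^sub>i \<in> F\<^sub>i\<close>, almost all of
  them trivial.
\<close>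

definition gr_carrier :: "(int \<Rightarrow> 'a::ab_group_add set) \<Rightarrow> (int \<Rightarrow> 'a set) set" where
  "gr_carrier F = {g. (\<forall>i. \<exists>x\<in>F i. g i = x +o F (i - 1)) \<and> finite {i. g i \<noteq> F (i - 1)}}"

definition gr_zero :: "(int \<Rightarrow> 'a::ab_group_add set) \<Rightarrow> int \<Rightarrow> 'a set" where
  "gr_zero F = (\<lambda>i. F (i - 1))"

text \<open>
  The product \<open>gr R \<times> gr M \<rightarrow> gr M\<close> induced by \<open>act\<close>, that is, the biadditive extension of
  \<open>(a + E\<^sub>i\<^sub>-\<^sub>1) (x + F\<^sub>j\<^sub>-\<^sub>1) = a x + F\<^sub>i\<^sub>+\<^sub>j\<^sub>-\<^sub>1\<close>. Sums of sets are element-wise; the products of all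
  representatives lie in one coset, and adding the submodule in degree \<open>k - 1\<close> yields the whole coset.
\<close>

definition gr_act :: "('r::ab_group_add \<Rightarrow> 'm::ab_group_add \<Rightarrow> 'm) \<Rightarrow> (int \<Rightarrow> 'r set) \<Rightarrow> (int \<Rightarrow> 'm set)
    \<Rightarrow> (int \<Rightarrow> 'r set) \<Rightarrow> (int \<Rightarrow> 'm set) \<Rightarrow> int \<Rightarrow> 'm set" where
  "gr_act act E F f g =
     (\<lambda>k. F (k - 1) + (\<Sum>i | f i \<noteq> E (i - 1). {act a x | a x. a \<in> f i \<and> x \<in> g (k - i)}))"

text \<open>
  The identification of \<open>K[X,Y]\<close> with the associated graded ring of the Weyl algebra: the monomial
  \<open>X\<^bsup>\<lambda>\<^esup>Y\<^bsup>\<mu>\<^esup>\<close> corresponds to the class of \<open>\<xi>\<^bsup>\<lambda>\<^esup>\<partial>\<^bsup>\<mu>\<^esup>\<close> in degree \<open>\<omega> \<cdot> (\<lambda>|\<mu>)\<close>, which is the product of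
  powers of the classes of the \<open>\<xi>\<^sub>i\<close> and \<open>\<partial>\<^sub>i\<close>.
\<close>

definition gr_weyl_of_poly ::
    "('n::finite + 'n \<Rightarrow> nat) \<Rightarrow> ('n + 'n, 'k::field_char_0) mpoly \<Rightarrow> int \<Rightarrow> ('n, 'k) weyl set" where
  "gr_weyl_of_poly \<omega> p =
     (\<lambda>d. (\<Sum>t | t \<in> Poly_Mapping.keys p \<and> int (wdot \<omega> t) = d.
             weyl_scale (Poly_Mapping.lookup p t) (weyl_monom t)) +o weyl_filt \<omega> (d - 1))"

lemma weyl_monom_var:
  "weyl_monom (Poly_Mapping.single (Inl i) 1) = (weyl_xi i :: ('n::finite, 'k::comm_ring_1) weyl)"
  "weyl_monom (Poly_Mapping.single (Inr i) 1) = (weyl_d i :: ('n, 'k) weyl)"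
proof -
  have 0: "weyl_monom 0 = (1 :: ('n, 'k) weyl)" by (simp add: weyl_monom_def weyl_pow_0)
  show "weyl_monom (Poly_Mapping.single (Inl i) 1) = (weyl_xi i :: ('n, 'k) weyl)"
    using weyl_xi_monom[where 'b = 'k, of i 0] by (simp add: 0)
  show "weyl_monom (Poly_Mapping.single (Inr i) 1) = (weyl_d i :: ('n, 'k) weyl)"
    using weyl_d_monom[where 'b = 'k, of i 0] by (simp add: 0)
qed

lemma gr_weyl_of_var:
  "gr_weyl_of_poly \<omega> (mvar (Inl i)) =
     (\<lambda>d. (if d = int (\<omega> (Inl i)) then weyl_xi i else 0) +o weyl_filt \<omega> (d - 1))"
  "gr_weyl_of_poly \<omega> (mvar (Inr i)) =
     (\<lambda>d. (if d = int (\<omega> (Inr i)) then weyl_d i else 0) +o weyl_filt \<omega> (d - 1))"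
proof -
  have *: "{t. t = s \<and> int (wdot \<omega> t) = d} = (if d = int (wdot \<omega> s) then {s} else {})" for s d
    by auto
  show "gr_weyl_of_poly \<omega> (mvar (Inl i)) =
     (\<lambda>d. (if d = int (\<omega> (Inl i)) then weyl_xi i else 0) +o weyl_filt \<omega> (d - 1))"
    by (rule ext) (simp add: gr_weyl_of_poly_def mvar_def * wdot_single weyl_monom_var[simplified])
  show "gr_weyl_of_poly \<omega> (mvar (Inr i)) =
     (\<lambda>d. (if d = int (\<omega> (Inr i)) then weyl_d i else 0) +o weyl_filt \<omega> (d - 1))"
    by (rule ext) (simp add: gr_weyl_of_poly_def mvar_def * wdot_single weyl_monom_var[simplified])
qed

definition gr_poly_act ::
    "('n::finite + 'n \<Rightarrow> nat) \<Rightarrow> (('n, 'k::field_char_0) weyl \<Rightarrow> 'm::ab_group_add \<Rightarrow> 'm)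
      \<Rightarrow> (int \<Rightarrow> 'm set) \<Rightarrow> ('n + 'n, 'k) mpoly \<Rightarrow> (int \<Rightarrow> 'm set) \<Rightarrow> int \<Rightarrow> 'm set" where
  "gr_poly_act \<omega> act F p g = gr_act act (weyl_filt \<omega>) F (gr_weyl_of_poly \<omega> p) g"

definition gr_annihilator ::
    "('n::finite + 'n \<Rightarrow> nat) \<Rightarrow> (('n, 'k::field_char_0) weyl \<Rightarrow> 'm::ab_group_add \<Rightarrow> 'm)
      \<Rightarrow> (int \<Rightarrow> 'm set) \<Rightarrow> ('n + 'n, 'k) mpoly set" where
  "gr_annihilator \<omega> act F = {p. \<forall>g\<in>gr_carrier F. gr_poly_act \<omega> act F p g = gr_zero F}"


section \<open>Characteristic varieties and critical cones\<close>

definition poly_ring :: "('v, 'k::comm_ring_1) mpoly ring" where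
  "poly_ring = \<lparr>carrier = UNIV, mult = (*), one = 1, zero = 0, add = (+)\<rparr>"

definition poly_radical :: "('v, 'k::comm_ring_1) mpoly set \<Rightarrow> ('v, 'k) mpoly set" where
  "poly_radical I = {p. \<exists>k. p ^ k \<in> I}"

definition Var :: "('v, 'k::comm_ring_1) mpoly set \<Rightarrow> ('v, 'k) mpoly set set" where
  "Var I = {P. primeideal P poly_ring \<and> I \<subseteq> P}"

text \<open>
  The homogeneous component of greatest total degree; it is \<open>0\<close> for the zero polynomial.
\<close>

definition top_form :: "('n::finite + 'n, 'k::comm_ring_1) mpoly \<Rightarrow> ('n + 'n, 'k) mpoly" where
  "top_form p =
     (\<Sum>t | t \<in> Poly_Mapping.keys p \<and>
            wdot (weight_pair 1 1) t = Max (wdot (weight_pair 1 1) ` Poly_Mapping.keys p).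
        Poly_Mapping.single t (Poly_Mapping.lookup p t))"

definition gr_ideal :: "('n::finite + 'n, 'k::comm_ring_1) mpoly set \<Rightarrow> ('n + 'n, 'k) mpoly set" where
  "gr_ideal I = genideal poly_ring (top_form ` I)"

text \<open>
  The associated graded module of \<open>M\<close> is formed with respect to a chosen good filtration, which
  exists for finitely generated \<open>M\<close>; the radical of its annihilator does not depend on the choice.
\<close>

definition gr_module_annihilator ::
    "('n::finite + 'n \<Rightarrow> nat) \<Rightarrow> (('n, 'k::field_char_0) weyl \<Rightarrow> 'm::ab_group_add \<Rightarrow> 'm)
      \<Rightarrow> ('n + 'n, 'k) mpoly set" where
  "gr_module_annihilator \<omega> act = gr_annihilator \<omega> act (SOME F. good_filtration \<omega> act F)"

definition char_variety ::
    "('n::finite + 'n \<Rightarrow> nat) \<Rightarrow> (('n, 'k::field_char_0) weyl \<Rightarrow> 'm::ab_group_add \<Rightarrow> 'm)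
      \<Rightarrow> ('n + 'n, 'k) mpoly set set" where
  "char_variety \<omega> act = Var (gr_module_annihilator \<omega> act)"

definition critical_cone ::
    "('n::finite + 'n \<Rightarrow> nat) \<Rightarrow> (('n, 'k::field_char_0) weyl \<Rightarrow> 'm::ab_group_add \<Rightarrow> 'm)
      \<Rightarrow> ('n + 'n, 'k) mpoly set set" where
  "critical_cone \<omega> act = Var (gr_ideal (poly_radical (gr_module_annihilator \<omega> act)))"

end

theory Submission
  imports Defs
begin

text \<open>
  Choose generators \<open>m\<^sub>0, \<dots>, m\<^sub>r\<^sub>-\<^sub>1\<close> of \<open>M\<close>, so that \<open>M\<close> is the quotient of \<open>W\<^sup>r\<close> by the module \<open>N\<close> of
  their relations. For the filtration generated by the \<open>m\<^sub>j\<close> in degree \<open>0\<close>, the associated graded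
  module is \<open>K[X,Y]\<^sup>r / gr\<^sup>\<omega> N\<close>, where \<open>gr\<^sup>\<omega> N\<close> is spanned by the leading \<open>\<omega>\<close>-forms of relations, and its
  annihilator \<open>A\<^sub>\<omega>\<close> consists of the \<open>x\<close> with \<open>x e\<^sub>k \<in> gr\<^sup>\<omega> N\<close> for all \<open>k\<close>. Any two good filtrations are
  contained in shifts of each other; hence homogeneous elements of one annihilator have powers in the
  other one, and both the characteristic variety and the critical cone can be computed from \<open>A\<^sub>\<omega>\<close>
  (\<open>annihilators_power_dominated\<close>).

  The bound \<open>s\<^sub>0\<close> can be chosen independently of \<open>\<omega>\<close> because \<open>N\<close> has a finite universal Groebner basis
  \<open>U\<close>: one finite set that is a Groebner basis for all term orders at once
  (\<open>universal_groebner_basis\<close>). As every weight is refined by a term order, for every weight each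
  relation is a combination of elements of \<open>U\<close> whose summands do not exceed its degree
  (\<open>universal_weighted_span\<close>). Take \<open>s\<^sub>0\<close> to bound the total degrees of the terms of elements of \<open>U\<close>. If
  \<open>s > s\<^sub>0\<close>, then a difference of \<open>\<omega>\<close>-degrees of two terms of some \<open>u \<in> U\<close> outweighs, after multiplication
  by \<open>s\<close>, any difference of their total degrees. So the leading form of \<open>u\<close> for the weight
  \<open>(1|1) + s \<omega>\<close> is the component of greatest total degree of its leading \<open>\<omega>\<close>-form, for all these \<open>s\<close>
  simultaneously. This transports leading forms of relations between all weights \<open>(1|1) + s \<omega>\<close> with
  \<open>s > s\<^sub>0\<close> (\<open>ex_bihomogeneous_lift\<close>), and for large \<open>s\<close>, depending on the relation, the leading form for
  \<open>(1|1) + s \<omega>\<close> is the top form of the leading \<open>\<omega>\<close>-form.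

  It follows that the ideal \<open>A\<close> belonging to \<open>(1|1) + s \<omega>\<close> is bigraded by \<open>\<omega>\<close>-degree and total degree, which
  is why the critical cone and the characteristic variety agree for this weight, and that it contains
  the top forms of elements of \<open>A\<^sub>\<omega>\<close>. Conversely, for a bihomogeneous element \<open>p\<close> of \<open>A\<close> the
  multiplication by \<open>p\<close> on \<open>K[X,Y]\<^sup>r / gr\<^sup>\<omega> N\<close> agrees, on the generators, with a matrix of polynomials of
  total degree less than that of \<open>p\<close>. Eliminating the generators one by one, as in the
  Cayley-Hamilton theorem, yields an element of \<open>A\<^sub>\<omega>\<close> whose top form is a power of \<open>p\<close>
  (\<open>symbol_ann_shifted_power\<close>). Thus a prime ideal contains the top forms of the elements of \<open>A\<^sub>\<omega>\<close>
  if and only if it contains \<open>A\<close>.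
\<close>


section \<open>Homogeneous components of polynomials\<close>

abbreviation lookup :: "('a \<Rightarrow>\<^sub>0 'b::zero) \<Rightarrow> 'a \<Rightarrow> 'b" where "lookup \<equiv> Poly_Mapping.lookup"
abbreviation keys :: "('a \<Rightarrow>\<^sub>0 'b::zero) \<Rightarrow> 'a set" where "keys \<equiv> Poly_Mapping.keys"
abbreviation single :: "'a \<Rightarrow> 'b \<Rightarrow> 'a \<Rightarrow>\<^sub>0 'b::zero" where "single \<equiv> Poly_Mapping.single"

lemma single_mult_eq_sum:
  fixes p :: "('v, 'k::comm_ring_1) mpoly"
  shows "single t c * p = (\<Sum>v\<in>keys p. single (t + v) (c * lookup p v))"
  by (subst mpoly_sum_single[of p]) (simp add: sum_distrib_left mult_single)

lemma lookup_single_mult: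
  fixes p :: "('v, 'k::comm_ring_1) mpoly"
  shows "lookup (single t c * p) (t + v) = c * lookup p v"
proof -
  have "lookup (single t c * p) (t + v) = (\<Sum>w\<in>keys p. if w = v then c * lookup p w else 0)"
    unfolding single_mult_eq_sum lookup_sum by (intro sum.cong) (auto simp: lookup_single when_def)
  thus ?thesis by (auto simp: in_keys_iff)
qed

lemma keys_single_mult:
  fixes p :: "('v, 'k::comm_ring_1) mpoly"
  shows "keys (single t c * p) \<subseteq> (\<lambda>v. t + v) ` keys p"
  using keys_mult[of "single t c" p] by (auto split: if_splits)

lemma keys_diff_subset: "keys (p - q) \<subseteq> keys p \<union> keys (q :: 'a \<Rightarrow>\<^sub>0 'b::ab_group_add)"
  by (auto simp: in_keys_iff lookup_minus)

lemma keys_add_subset: "keys (p + q) \<subseteq> keys p \<union> keys (q :: 'a \<Rightarrow>\<^sub>0 'b::ab_group_add)"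
  by (auto simp: in_keys_iff lookup_add)

definition pm_restrict :: "('a \<Rightarrow> bool) \<Rightarrow> ('a \<Rightarrow>\<^sub>0 'b::comm_monoid_add) \<Rightarrow> 'a \<Rightarrow>\<^sub>0 'b" where
  "pm_restrict P p = (\<Sum>t | t \<in> keys p \<and> P t. single t (lookup p t))"

lemma lookup_pm_restrict: "lookup (pm_restrict P p) t = (if P t then lookup p t else 0)"
  unfolding pm_restrict_def lookup_sum
  by (auto simp: lookup_single when_def in_keys_iff sum.delta' intro!: sum.neutral)

definition hcomp :: "('v::finite \<Rightarrow> nat) \<Rightarrow> nat \<Rightarrow> ('v, 'k::comm_ring_1) mpoly \<Rightarrow> ('v, 'k) mpoly" where
  "hcomp w d p = pm_restrict (\<lambda>t. wdot w t = d) p"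

definition deg_le :: "('v::finite \<Rightarrow> nat) \<Rightarrow> nat \<Rightarrow> ('v, 'k::comm_ring_1) mpoly \<Rightarrow> bool" where
  "deg_le w d p \<longleftrightarrow> (\<forall>t\<in>keys p. wdot w t \<le> d)"

definition deg_less :: "('v::finite \<Rightarrow> nat) \<Rightarrow> nat \<Rightarrow> ('v, 'k::comm_ring_1) mpoly \<Rightarrow> bool" where
  "deg_less w d p \<longleftrightarrow> (\<forall>t\<in>keys p. wdot w t < d)"

lemma lookup_hcomp: "lookup (hcomp w d p) t = (if wdot w t = d then lookup p t else 0)"
  by (simp add: hcomp_def lookup_pm_restrict)

lemma keys_hcomp: "keys (hcomp w d p) = {t \<in> keys p. wdot w t = d}"
  by (auto simp: in_keys_iff lookup_hcomp split: if_splits)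

lemma hcomp_0 [simp]: "hcomp w d 0 = 0"
  by (rule poly_mapping_eqI) (simp add: lookup_hcomp)

lemma hcomp_add: "hcomp w d (p + q) = hcomp w d p + hcomp w d q"
  by (rule poly_mapping_eqI) (simp add: lookup_hcomp lookup_add)

lemma hcomp_diff: "hcomp w d (p - q) = hcomp w d p - hcomp w d q"
  by (rule poly_mapping_eqI) (simp add: lookup_hcomp lookup_minus)

lemma hcomp_commute: "hcomp w d (hcomp w' d' p) = hcomp w' d' (hcomp w d p)"
  by (rule poly_mapping_eqI) (simp add: lookup_hcomp)

lemma hcomp_hcomp: "hcomp w d (hcomp w d' p) = (if d = d' then hcomp w d p else 0)"
  by (rule poly_mapping_eqI) (simp add: lookup_hcomp)

lemma hcomp_id: "(\<And>t. t \<in> keys p \<Longrightarrow> wdot w t = d) \<Longrightarrow> hcomp w d p = p"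
  by (rule poly_mapping_eqI) (auto simp: lookup_hcomp in_keys_iff)

lemma hcomp_eq_0: "deg_less w d p \<Longrightarrow> hcomp w d p = 0"
  by (rule poly_mapping_eqI) (auto simp: lookup_hcomp deg_less_def in_keys_iff)

lemma deg_less_diff_hcomp: "deg_le w d p \<Longrightarrow> deg_less w d (p - hcomp w d p)"
  by (force simp: deg_less_def deg_le_def in_keys_iff lookup_minus lookup_hcomp split: if_splits)

lemma deg_le_hcomp: "deg_le w d (hcomp w d p)"
  by (simp add: deg_le_def keys_hcomp)

lemma deg_less_imp_le: "deg_less w d p \<Longrightarrow> deg_le w d p"
  by (auto simp: deg_less_def deg_le_def)

lemma deg_le_add: "deg_le w d p \<Longrightarrow> deg_le w d q \<Longrightarrow> deg_le w d (p + q)"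
  and deg_le_diff: "deg_le w d p \<Longrightarrow> deg_le w d q \<Longrightarrow> deg_le w d (p - q)"
  and deg_less_add: "deg_less w d p \<Longrightarrow> deg_less w d q \<Longrightarrow> deg_less w d (p + q)"
  and deg_less_diff: "deg_less w d p \<Longrightarrow> deg_less w d q \<Longrightarrow> deg_less w d (p - q)"
  using keys_add_subset[of p q] keys_diff_subset[of p q] by (auto simp: deg_le_def deg_less_def)

lemma deg_le_mult: "deg_le w a p \<Longrightarrow> deg_le w b q \<Longrightarrow> deg_le w (a + b) (p * q)"
  using keys_mult[of p q] by (fastforce simp: deg_le_def wdot_add intro: add_mono)

lemma deg_less_le_mult: "deg_less w a p \<Longrightarrow> deg_le w b q \<Longrightarrow> deg_less w (a + b) (p * q)"
  using keys_mult[of p q] by (fastforce simp: deg_le_def deg_less_def wdot_add intro: add_less_le_mono)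

lemma deg_le_less_mult: "deg_le w a p \<Longrightarrow> deg_less w b q \<Longrightarrow> deg_less w (a + b) (p * q)"
  using deg_less_le_mult[of w b q a p] by (simp add: ac_simps)

lemma deg_le_power: "deg_le w a p \<Longrightarrow> deg_le w (k * a) (p ^ k)"
proof (induction k)
  case 0
  show ?case by (auto simp: deg_le_def wdot_def simp flip: single_one)
qed (auto intro: deg_le_mult)

lemma hcomp_mult_top:
  assumes "deg_le w a p" "deg_le w b q"
  shows "hcomp w (a + b) (p * q) = hcomp w a p * hcomp w b q"
proof -
  define p' q' where "p' = p - hcomp w a p" and "q' = q - hcomp w b q"
  have l: "deg_less w a p'" "deg_less w b q'"
    using assms by (auto simp: p'_def q'_def deg_less_diff_hcomp)
  have eq: "p * q = hcomp w a p * hcomp w b q + (hcomp w a p * q' + p' * q)"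
    by (simp add: p'_def q'_def algebra_simps)
  have "hcomp w (a + b) (hcomp w a p * hcomp w b q) = hcomp w a p * hcomp w b q"
    using keys_mult[of "hcomp w a p" "hcomp w b q"] 
    by (intro hcomp_id) (auto simp: keys_hcomp wdot_add)
  moreover have "hcomp w (a + b) (hcomp w a p * q' + p' * q) = 0"
    by (intro hcomp_eq_0 deg_less_add deg_less_le_mult deg_le_less_mult l assms deg_le_hcomp)
  ultimately show ?thesis by (subst eq, subst hcomp_add) simp
qed

lemma hcomp_power_top: "deg_le w a p \<Longrightarrow> hcomp w (k * a) (p ^ k) = hcomp w a p ^ k"
proof (induction k)
  case 0
  have "hcomp w 0 (1 :: ('a, 'b) mpoly) = 1"
    by (rule hcomp_id) (auto simp: wdot_def simp flip: single_one split: if_splits)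
  thus ?case by simp
next
  case (Suc k)
  thus ?case by (simp add: hcomp_mult_top[OF _ deg_le_power])
qed

lemma sum_hcomp:
  assumes "finite D" "wdot w ` keys p \<subseteq> D"
  shows "p = (\<Sum>d\<in>D. hcomp w d p)"
proof (rule poly_mapping_eqI)
  fix t
  show "lookup p t = lookup (\<Sum>d\<in>D. hcomp w d p) t"
    using assms by (cases "t \<in> keys p") (auto simp: lookup_sum lookup_hcomp in_keys_iff)
qed

lemma hcomp_single_mult:
  "hcomp w d (single t c * p) = (if wdot w t \<le> d then single t c * hcomp w (d - wdot w t) p else 0)"
proof (cases "wdot w t \<le> d")
  case True
  define p' where "p' = p - hcomp w (d - wdot w t) p"
  have "hcomp w d (single t c * hcomp w (d - wdot w t) p) = single t c * hcomp w (d - wdot w t) p"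
    using keys_single_mult[of t c "hcomp w (d - wdot w t) p"] True
    by (intro hcomp_id) (auto simp: keys_hcomp wdot_add)
  moreover have "hcomp w d (single t c * p') = 0"
  proof (rule poly_mapping_eqI)
    fix u
    have "wdot w u \<noteq> d" if "u \<in> keys (single t c * p')"
      using that keys_single_mult[of t c p'] by (auto simp: p'_def wdot_add in_keys_iff lookup_minus lookup_hcomp split: if_splits)
    thus "lookup (hcomp w d (single t c * p')) u = lookup 0 u"
      by (auto simp: lookup_hcomp in_keys_iff)
  qed
  moreover have "single t c * p = single t c * hcomp w (d - wdot w t) p + single t c * p'"
    by (simp add: p'_def algebra_simps)
  ultimately show ?thesis using True by (simp add: hcomp_add)
next
  case False
  have "wdot w u \<noteq> d" if "u \<in> keys (single t c * p)" for u
    using that keys_single_mult[of t c p] False by (auto simp: wdot_add)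
  hence "hcomp w d (single t c * p) = 0"
    by (intro poly_mapping_eqI) (auto simp: lookup_hcomp in_keys_iff)
  thus ?thesis using False by simp
qed

definition tdeg :: "'n + 'n \<Rightarrow> nat" where "tdeg = weight_pair 1 1"

text \<open>
  If \<open>b\<close> is not the total degree but only a bound, the component of degree \<open>b\<close> vanishes. Such bounds are
  used throughout because they are compatible with powers: the component of degree \<open>k b\<close> of
  \<open>p ^ k\<close> is the \<open>k\<close>-th power of the component of degree \<open>b\<close> of \<open>p\<close>.
\<close>
lemma top_form_eq_hcomp:
  assumes "deg_le tdeg b p"
  shows "top_form p = hcomp tdeg b p \<or> hcomp tdeg b p = 0"
proof (cases "\<exists>t\<in>keys p. wdot tdeg t = b")
  case True
  hence "Max (wdot tdeg ` keys p) = b" using assms unfolding deg_le_def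
    by (intro Max_eqI) auto
  thus ?thesis by (simp add: top_form_def hcomp_def pm_restrict_def tdeg_def)
next
  case False
  hence "hcomp tdeg b p = 0" by (intro poly_mapping_eqI) (auto simp: lookup_hcomp in_keys_iff)
  thus ?thesis ..
qed

lemma top_form_is_hcomp: "\<exists>b. deg_le tdeg b p \<and> top_form p = hcomp tdeg b p"
proof (intro exI conjI)
  show "deg_le tdeg (Max (wdot tdeg ` keys p)) p" by (auto simp: deg_le_def)
  show "top_form p = hcomp tdeg (Max (wdot tdeg ` keys p)) p"
    by (simp add: top_form_def hcomp_def pm_restrict_def tdeg_def)
qed

lemma mpoly_additive_closed:
  fixes p :: "('v, 'k::comm_ring_1) mpoly"
  assumes "Q 0" "\<And>p q. Q p \<Longrightarrow> Q q \<Longrightarrow> Q (p + q)" "\<And>t c. Q (single t c)"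
  shows "Q p"
proof -
  have "Q (\<Sum>t\<in>A. single t (lookup p t))" if "finite A" for A
    using that by (induction A) (auto intro: assms)
  thus ?thesis using mpoly_sum_single[of p] finite_keys[of p] by metis
qed


section \<open>Dickson's lemma and term orders\<close>

lemma nat_seq_nondecreasing_subseq:
  fixes f :: "nat \<Rightarrow> nat"
  shows "\<exists>g :: nat \<Rightarrow> nat. strict_mono g \<and> (\<forall>i j. i \<le> j \<longrightarrow> f (g i) \<le> f (g j))"
proof -
  obtain g :: "nat \<Rightarrow> nat" where g: "strict_mono g" "monoseq (\<lambda>n. f (g n))" using seq_monosub[of f] by blast
  show ?thesis
  proof (cases "\<forall>i j. i \<le> j \<longrightarrow> f (g i) \<le> f (g j)")
    case False
    hence dec: "\<And>i j. i \<le> j \<Longrightarrow> f (g j) \<le> f (g i)" using g(2) unfolding monoseq_def by blast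
    obtain k where k: "\<And>i. f (g k) \<le> f (g i)"
      using ex_has_least_nat[of "\<lambda>_. True" 0 "\<lambda>i. f (g i)"] by blast
    have "strict_mono (\<lambda>i. g (k + i))" using g(1) by (simp add: strict_mono_def)
    moreover have "f (g (k + i)) = f (g k)" for i using k[of "k + i"] dec[of k "k + i"] by simp
    ultimately show ?thesis by (intro exI[of _ "\<lambda>i. g (k + i)"]) simp
  qed (use g in blast)
qed

text \<open>
  Passing to a nondecreasing subsequence for one coordinate after the other keeps the coordinates
  that have been treated before nondecreasing.
\<close>
lemma dickson_subseq:
  fixes f :: "nat \<Rightarrow> ('v::finite \<Rightarrow>\<^sub>0 nat)"
  shows "\<exists>g :: nat \<Rightarrow> nat. strict_mono g \<and> (\<forall>i j. i \<le> j \<longrightarrow> (\<forall>v\<in>A. lookup (f (g i)) v \<le> lookup (f (g j)) v))"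
proof -
  have "finite A" by simp
  thus ?thesis
  proof (induction A)
    case empty
    show ?case by (intro exI[of _ id]) (simp add: strict_mono_def)
  next
    case (insert a A)
    then obtain g :: "nat \<Rightarrow> nat" where g: "strict_mono g"
        "\<forall>i j. i \<le> j \<longrightarrow> (\<forall>v\<in>A. lookup (f (g i)) v \<le> lookup (f (g j)) v)" by (elim exE conjE)
    obtain h :: "nat \<Rightarrow> nat" where h: "strict_mono h"
        "\<forall>i j. i \<le> j \<longrightarrow> lookup (f (g (h i))) a \<le> lookup (f (g (h j))) a"
      using nat_seq_nondecreasing_subseq[of "\<lambda>i. lookup (f (g i)) a"] by (elim exE conjE)
    have "strict_mono (\<lambda>i. g (h i))" using g(1) h(1) by (simp add: strict_mono_def)
    moreover have "h i \<le> h j" if "i \<le> j" for i j using h(1) that by (simp add: strict_mono_less_eq)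
    ultimately show ?case using g(2) h(2) by (intro exI[of _ "\<lambda>i. g (h i)"]) auto
  qed
qed

text \<open>
  The term \<open>(v, j)\<close> stands for the monomial \<open>X\<^bsup>v\<^esup> e\<^sub>j\<close> of a free module with basis \<open>e\<^sub>0, e\<^sub>1, \<dots>\<close>.
\<close>

type_synonym 'v mterm = "('v \<Rightarrow>\<^sub>0 nat) \<times> nat"

definition term_dvd :: "'v mterm \<Rightarrow> 'v mterm \<Rightarrow> bool" where
  "term_dvd a b \<longleftrightarrow> (\<exists>t. b = (t + fst a, snd a))"

lemma dickson:
  fixes b :: "nat \<Rightarrow> 'v::finite mterm"
  assumes "\<And>i. snd (b i) < r"
  shows "\<exists>i j. i < j \<and> term_dvd (b i) (b j)"
proof -
  have "finite (range (\<lambda>i. snd (b i)))"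
    by (rule finite_subset[of _ "{..<r}"]) (use assms in auto)
  then obtain k where "infinite {i \<in> UNIV. snd (b i) = snd (b k)}"
    using pigeonhole_infinite[of UNIV "\<lambda>i. snd (b i)"] by auto
  hence inf: "infinite {i. snd (b i) = snd (b k)}" by simp
  define e where "e = enumerate {i. snd (b i) = snd (b k)}"
  have e: "strict_mono e" "\<And>i. snd (b (e i)) = snd (b k)"
    using enumerate_in_set[OF inf] strict_mono_enumerate[OF inf] by (auto simp: e_def)
  obtain g :: "nat \<Rightarrow> nat" where g: "strict_mono g"
      "\<forall>i j. i \<le> j \<longrightarrow> (\<forall>v\<in>UNIV. lookup (fst (b (e (g i)))) v \<le> lookup (fst (b (e (g j)))) v)"
    using dickson_subseq[where f = "\<lambda>i. fst (b (e i))" and A = UNIV] by (elim exE conjE)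
  have "term_dvd (b (e (g 0))) (b (e (g 1)))"
    unfolding term_dvd_def
  proof
    show "b (e (g 1)) = ((fst (b (e (g 1))) - fst (b (e (g 0)))) + fst (b (e (g 0))), snd (b (e (g 0))))"
      using g(2)[rule_format, of 0 1] e(2)
      by (auto simp: prod_eq_iff lookup_add lookup_minus intro!: poly_mapping_eqI)
  qed
  moreover have "e (g 0) < e (g 1)" using e(1) g(1) by (simp add: strict_mono_def)
  ultimately show ?thesis by blast
qed

definition term_ideal :: "'v mterm set \<Rightarrow> 'v mterm set" where
  "term_ideal A = {b. \<exists>a\<in>A. term_dvd a b}"

text \<open>
  The ascending chain condition for monomial submodules, in the form of an induction principle on
  finite generating sets: in an infinite sequence of proper enlargements no new generator would be
  divisible by an earlier one, contrary to Dickson's lemma.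
\<close>
lemma wf_term_ideal_extension:
  "wf {(insert b A, A) | b A. snd b < r \<and> (b :: 'v::finite mterm) \<notin> term_ideal A}"
  unfolding wf_iff_no_infinite_down_chain
proof
  assume "\<exists>f. \<forall>i. (f (Suc i), f i) \<in> {(insert b A, A) | b A. snd b < r \<and> (b :: 'v mterm) \<notin> term_ideal A}"
  then obtain f :: "nat \<Rightarrow> 'v mterm set" where
    f0: "\<forall>i. (f (Suc i), f i) \<in> {(insert b A, A) | b A. snd b < r \<and> (b :: 'v mterm) \<notin> term_ideal A}"
    by (elim exE)
  have "\<exists>b. f (Suc i) = insert b (f i) \<and> snd b < r \<and> b \<notin> term_ideal (f i)" for i
  proof -
    obtain b A where "f (Suc i) = insert b A" "f i = A" "snd b < r" "b \<notin> term_ideal A"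
      using f0[rule_format, of i] unfolding mem_Collect_eq prod.inject by (elim exE conjE)
    thus ?thesis by (intro exI[of _ b]) auto
  qed
  hence "\<exists>b. \<forall>i. f (Suc i) = insert (b i) (f i) \<and> snd (b i) < r \<and> b i \<notin> term_ideal (f i)"
    by (intro choice allI)
  then obtain b where f: "\<And>i. f (Suc i) = insert (b i) (f i)" "\<And>i. snd (b i) < r"
     "\<And>i. (b i :: 'v mterm) \<notin> term_ideal (f i)" by (elim exE) simp
  obtain i j where ij: "i < j" "term_dvd (b i) (b j)" using dickson[of b r] f(2) by blast
  have "f (Suc i) \<subseteq> f j" by (rule lift_Suc_mono_le[of f]) (use ij(1) f(1) in auto)
  hence "b i \<in> f j" unfolding f(1)[of i] by simp
  hence "b j \<in> term_ideal (f j)" using ij(2) unfolding term_ideal_def by (intro CollectI bexI)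
  thus False using f(3)[of j] by (rule notE[rotated])
qed

text \<open>
  The last axiom makes term orders extend divisibility, so that they are well-founded by
  Dickson's lemma.
\<close>
locale term_order =
  fixes lt :: "'v::finite mterm \<Rightarrow> 'v mterm \<Rightarrow> bool"
  assumes irrefl: "\<not> lt x x"
    and trans: "lt x y \<Longrightarrow> lt y z \<Longrightarrow> lt x z"
    and total: "x \<noteq> y \<Longrightarrow> lt x y \<or> lt y x"
    and shift: "lt (v, j) (w, k) \<Longrightarrow> lt (t + v, j) (t + w, k)"
    and pos: "t \<noteq> 0 \<Longrightarrow> lt (v, j) (t + v, j)"
begin

lemma wf_terms: "wf {(x, y). lt x y \<and> snd x < r \<and> snd y < r}"
  unfolding wf_iff_no_infinite_down_chain
proof
  assume "\<exists>f. \<forall>i. (f (Suc i), f i) \<in> {(x, y). lt x y \<and> snd x < r \<and> snd y < r}"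
  then obtain f where f: "\<And>i. lt (f (Suc i)) (f i)" "\<And>i. snd (f i) < r" by auto
  have less: "lt (f j) (f i)" if "i < j" for i j
    using that
  proof (induction j)
    case (Suc j)
    thus ?case using f(1)[of j] trans by (cases "i = j") auto
  qed simp
  obtain i j where ij: "i < j" "term_dvd (f i) (f j)" using dickson[of f r] f(2) by blast
  then obtain t where t: "f j = (t + fst (f i), snd (f i))" by (auto simp: term_dvd_def)
  hence "f i = f j \<or> lt (f i) (f j)" using pos[of t "fst (f i)" "snd (f i)"] by (cases "t = 0") auto
  thus False using less[OF ij(1)] trans[of "f i" "f j" "f i"] irrefl[of "f i"] by auto
qed

lemma ex_max:
  assumes "finite A" "A \<noteq> {}"
  shows "\<exists>b\<in>A. \<forall>a\<in>A. a = b \<or> lt a b"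
  using assms
proof (induction A rule: finite_ne_induct)
  case (insert x A)
  then obtain b where b: "b \<in> A" "\<And>a. a \<in> A \<Longrightarrow> a = b \<or> lt a b" by blast
  show ?case
  proof (cases "lt b x")
    case True
    thus ?thesis using b(2) trans[OF _ True] by (intro bexI[of _ x]) auto
  next
    case False
    thus ?thesis using b total[of b x] by (intro bexI[of _ b]) auto
  qed
qed auto

end

text \<open>
  Weights may vanish on some variables, so that the weight alone is far from being a term order. Any
  term order, here a lexicographic one, can be used to break the ties.
\<close>
lemma weight_term_order_exists:
  fixes w :: "'v::finite \<Rightarrow> nat"
  shows "\<exists>lt. term_order lt \<and> (\<forall>x y. lt x y \<longrightarrow> wdot w (fst x) \<le> wdot w (fst y))"
proof -
  obtain h :: "'v \<Rightarrow> nat" where h: "inj h"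
    using finite_imp_inj_to_nat_seg[of "UNIV :: 'v set"] by auto
  define lex where "lex s t \<longleftrightarrow> (\<exists>u. lookup s u < lookup t u \<and> (\<forall>u'. h u' < h u \<longrightarrow> lookup s u' = lookup t u'))"
    for s t :: "'v \<Rightarrow>\<^sub>0 nat"
  have lex_irrefl: "\<not> lex s s" for s by (auto simp: lex_def)
  have lex_trans: "lex s u" if "lex s t" "lex t u" for s t u
  proof -
    obtain a where a: "lookup s a < lookup t a" "\<And>u'. h u' < h a \<Longrightarrow> lookup s u' = lookup t u'"
      using \<open>lex s t\<close> unfolding lex_def by blast
    obtain b where b: "lookup t b < lookup u b" "\<And>u'. h u' < h b \<Longrightarrow> lookup t u' = lookup u u'"
      using \<open>lex t u\<close> unfolding lex_def by blast
    consider "h a < h b" | "h b < h a" | "a = b" using injD[OF h, of a b] by linarith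
    thus ?thesis
    proof cases
      case 1 thus ?thesis using a b unfolding lex_def by (intro exI[of _ a]) auto
    next
      case 2 thus ?thesis using a b unfolding lex_def by (intro exI[of _ b]) auto
    next
      case 3 thus ?thesis using a b unfolding lex_def by (intro exI[of _ a]) auto
    qed
  qed
  have lex_total: "lex s t \<or> lex t s" if "s \<noteq> t" for s t
  proof -
    obtain u0 where "lookup s u0 \<noteq> lookup t u0" using \<open>s \<noteq> t\<close> by (meson poly_mapping_eqI)
    then obtain u where u: "lookup s u \<noteq> lookup t u" "\<And>u'. lookup s u' \<noteq> lookup t u' \<Longrightarrow> h u \<le> h u'"
      using ex_has_least_nat[of "\<lambda>u. lookup s u \<noteq> lookup t u" u0 h] by blast
    hence u': "\<forall>v. h v < h u \<longrightarrow> lookup s v = lookup t v" using leD by blast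
    thus ?thesis
    proof (cases "lookup s u < lookup t u")
      case True
      thus ?thesis using u' unfolding lex_def by blast
    next
      case False
      hence "lookup t u < lookup s u" using u(1) by simp
      moreover have "\<forall>v. h v < h u \<longrightarrow> lookup t v = lookup s v" using u' by simp
      ultimately show ?thesis unfolding lex_def by blast
    qed
  qed
  have lex_shift: "lex (t + x) (t + y)" if "lex x y" for t x y
    using that by (simp add: lex_def lookup_add)
  have lex_pos: "lex x (t + x)" if "t \<noteq> 0" for t x
  proof -
    have "\<not> lex t 0" by (simp add: lex_def)
    hence "lex 0 t" using lex_total[OF that] by blast
    from lex_shift[OF this, of x] show ?thesis by (simp add: add.commute)
  qed
  define lt where "lt x y \<longleftrightarrow> wdot w (fst x) < wdot w (fst y) \<or> wdot w (fst x) = wdot w (fst y) \<and>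
      (lex (fst x) (fst y) \<or> fst x = fst y \<and> snd x < snd y)" for x y :: "'v mterm"
  have "term_order lt"
  proof
    fix x y z :: "'v mterm" and t v u j k
    show "\<not> lt x x" by (simp add: lt_def lex_irrefl)
    show "lt x z" if "lt x y" "lt y z" using that lex_trans by (auto simp: lt_def)
    show "lt x y \<or> lt y x" if "x \<noteq> y"
      using that lex_total[of "fst x" "fst y"] unfolding lt_def prod_eq_iff
      by (cases "wdot w (fst x)" "wdot w (fst y)" rule: linorder_cases; cases "snd x" "snd y" rule: linorder_cases) auto
    show "lt (t + v, j) (t + u, k)" if "lt (v, j) (u, k)"
      using that lex_shift by (auto simp: lt_def wdot_add)
    show "lt (v, j) (t + v, j)" if "t \<noteq> 0"
      using lex_pos[OF that] by (auto simp: lt_def wdot_add)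
  qed
  thus ?thesis by (intro exI[of _ lt]) (auto simp: lt_def)
qed


section \<open>Universal Groebner bases\<close>

text \<open>
  Vectors are functions on the index set of the basis. Only vectors with finitely many nonzero
  entries occur; this is stated where it matters, by a bound on the indices.
\<close>
definition vsupp :: "(nat \<Rightarrow> ('v, 'k::zero) mpoly) \<Rightarrow> 'v mterm set" where
  "vsupp x = {(v, j). v \<in> keys (x j)}"

definition is_lead :: "('v mterm \<Rightarrow> 'v mterm \<Rightarrow> bool) \<Rightarrow> (nat \<Rightarrow> ('v, 'k::zero) mpoly) \<Rightarrow> 'v mterm \<Rightarrow> bool" where
  "is_lead lt x b \<longleftrightarrow> b \<in> vsupp x \<and> (\<forall>b'\<in>vsupp x. b' = b \<or> lt b' b)"

lemma vsupp_iff: "b \<in> vsupp x \<longleftrightarrow> fst b \<in> keys (x (snd b))"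
  by (cases b) (simp add: vsupp_def)

lemma vsupp_diff:
  fixes x y :: "nat \<Rightarrow> ('v, 'k::comm_ring_1) mpoly"
  shows "vsupp (\<lambda>j. x j - y j) \<subseteq> vsupp x \<union> vsupp y"
  using keys_diff_subset by (fastforce simp: vsupp_def)

lemma vsupp_add:
  fixes x y :: "nat \<Rightarrow> ('v, 'k::comm_ring_1) mpoly"
  shows "vsupp (\<lambda>j. x j + y j) \<subseteq> vsupp x \<union> vsupp y"
  using keys_add_subset by (fastforce simp: vsupp_def)

lemma lookup_mconst_mult:
  fixes p :: "('v, 'k::comm_ring_1) mpoly"
  shows "lookup (mconst c * p) v = c * lookup p v"
  using lookup_single_mult[of 0 c p v] by (simp add: mconst_def)

lemma vsupp_scale:
  fixes x :: "nat \<Rightarrow> ('v, 'k::comm_ring_1) mpoly"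
  shows "vsupp (\<lambda>j. mconst c * x j) \<subseteq> vsupp x"
  by (auto simp: vsupp_def in_keys_iff lookup_mconst_mult)

lemma finite_vsupp:
  assumes "\<And>j. r \<le> j \<Longrightarrow> x j = 0"
  shows "finite (vsupp x)"
proof (rule finite_subset)
  have "j < r" if "v \<in> keys (x j)" for v j using assms[of j] that by (cases "r \<le> j") auto
  thus "vsupp x \<subseteq> (\<Union>j<r. (\<lambda>v. (v, j)) ` keys (x j))" by (auto simp: vsupp_def)
qed auto

lemma vsupp_empty: "vsupp x = {} \<longleftrightarrow> x = (\<lambda>j. 0)"
  by (auto simp: vsupp_def fun_eq_iff poly_mapping_eq_iff in_keys_iff)

lemma vsupp_snd_less:
  assumes "\<And>j. r \<le> j \<Longrightarrow> x j = 0" "b \<in> vsupp x"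
  shows "snd b < r"
  using assms by (metis keys_zero empty_iff not_le vsupp_iff)

text \<open>
  An abstract form of left multiplication by monomials in a ring with a monomial basis in which
  products of monomials equal the commutative product up to proper divisors of it. Proper divisors
  are smaller for every term order, so that multiplication by a monomial shifts leading terms and
  preserves leading coefficients.
\<close>
locale monomial_action =
  fixes T :: "('v::finite \<Rightarrow>\<^sub>0 nat) \<Rightarrow> ('v, 'k::field) mpoly \<Rightarrow> ('v, 'k) mpoly"
  assumes T_lower: "v' \<in> keys (T t p - single t 1 * p) \<Longrightarrow> \<exists>v\<in>keys p. \<exists>u. u \<noteq> 0 \<and> t + v = u + v'"
begin

lemma keys_T:
  assumes "v' \<in> keys (T t p)"
  shows "\<exists>v\<in>keys p. v' = t + v \<or> (\<exists>u. u \<noteq> 0 \<and> t + v = u + v')"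
proof (cases "v' \<in> keys (T t p - single t 1 * p)")
  case True
  thus ?thesis using T_lower by blast
next
  case False
  hence "v' \<in> keys (single t 1 * p)" using assms by (auto simp: in_keys_iff lookup_minus)
  thus ?thesis using keys_single_mult by blast
qed

lemma lookup_T_lead:
  assumes "term_order lt" "is_lead lt x (v, j)"
  shows "lookup (T t (x j)) (t + v) = lookup (x j) v"
proof -
  interpret term_order lt by fact
  have "t + v \<notin> keys (T t (x j) - single t 1 * x j)"
  proof
    assume "t + v \<in> keys (T t (x j) - single t 1 * x j)"
    then obtain v0 u where v0: "v0 \<in> keys (x j)" "u \<noteq> 0" "t + v0 = u + (t + v)"
      using T_lower[of "t + v" t "x j"] by blast
    from v0(3) have eq: "v0 = u + v" by (simp add: add.left_commute)
    hence "lt (v, j) (v0, j)" using pos[OF v0(2), of v j] by simp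
    moreover have "v0 = v \<or> lt (v0, j) (v, j)"
      using assms(2) v0(1) unfolding is_lead_def by (auto simp: vsupp_def)
    ultimately show False using irrefl[of "(v, j)"] trans[of "(v, j)" "(v0, j)" "(v, j)"] by auto
  qed
  hence "lookup (T t (x j)) (t + v) = lookup (single t 1 * x j) (t + v)"
    by (simp add: in_keys_iff lookup_minus)
  thus ?thesis by (simp add: lookup_single_mult)
qed

lemma vsupp_T_lead:
  assumes "term_order lt" "is_lead lt x (v, j)" "b \<in> vsupp (\<lambda>j. T t (x j))"
  shows "b = (t + v, j) \<or> lt b (t + v, j)"
proof -
  interpret term_order lt by fact
  obtain v' i where b: "b = (v', i)" "v' \<in> keys (T t (x i))" using assms(3) by (auto simp: vsupp_def)
  then obtain v0 where v0: "v0 \<in> keys (x i)" "v' = t + v0 \<or> (\<exists>u. u \<noteq> 0 \<and> t + v0 = u + v')"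
    using keys_T by blast
  have 1: "b = (t + v0, i) \<or> lt b (t + v0, i)"
    using v0(2) pos[where v = v' and j = i] b(1) by auto
  have "(v0, i) = (v, j) \<or> lt (v0, i) (v, j)"
    using assms(2) v0(1) unfolding is_lead_def by (auto simp: vsupp_def)
  hence "(t + v0, i) = (t + v, j) \<or> lt (t + v0, i) (t + v, j)" using shift by blast
  thus ?thesis using 1 trans[of b "(t + v0, i)" "(t + v, j)"] by auto
qed

lemma reduction_step:
  assumes "term_order lt" "is_lead lt u a" "term_dvd a b" "b \<in> vsupp h"
  obtains t c where "fst b = t + fst a" "b \<notin> vsupp (\<lambda>j. h j - mconst c * T t (u j))"
    "\<And>b'. b' \<in> vsupp (\<lambda>j. h j - mconst c * T t (u j)) \<Longrightarrow> b' \<in> vsupp h \<or> lt b' b"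
proof -
  obtain v j where a: "a = (v, j)" by (cases a)
  obtain t where b: "b = (t + v, j)" using assms(3) a by (auto simp: term_dvd_def)
  have lead: "lookup (u j) v \<noteq> 0" using assms(2) a by (auto simp: is_lead_def vsupp_def in_keys_iff)
  define c where "c = lookup (h j) (t + v) / lookup (u j) v"
  have "lookup (h j - mconst c * T t (u j)) (t + v) = 0"
    using lookup_T_lead[OF assms(1), of u v j t] assms(2) a lead
    by (simp add: lookup_minus lookup_mconst_mult c_def)
  hence 1: "b \<notin> vsupp (\<lambda>j. h j - mconst c * T t (u j))" by (simp add: b vsupp_iff in_keys_iff)
  moreover have "b' \<in> vsupp h \<or> lt b' b" if "b' \<in> vsupp (\<lambda>j. h j - mconst c * T t (u j))" for b'
  proof (cases "b' \<in> vsupp h")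
    case False
    hence "b' \<in> vsupp (\<lambda>j. T t (u j))"
      using that vsupp_diff[of h "\<lambda>j. mconst c * T t (u j)"] vsupp_scale[of c "\<lambda>j. T t (u j)"] by blast
    thus ?thesis using vsupp_T_lead[OF assms(1)] assms(2) that 1 unfolding a b by blast
  qed simp
  ultimately show thesis using that[of t c] by (simp add: a b)
qed

end

locale action_submodule = monomial_action T
  for T :: "('v::finite \<Rightarrow>\<^sub>0 nat) \<Rightarrow> ('v, 'k::field) mpoly \<Rightarrow> ('v, 'k) mpoly" +
  fixes N :: "(nat \<Rightarrow> ('v, 'k) mpoly) set" and r :: nat
  assumes N_zero: "(\<lambda>j. 0) \<in> N"
    and N_diff: "x \<in> N \<Longrightarrow> y \<in> N \<Longrightarrow> (\<lambda>j. x j - y j) \<in> N"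
    and N_scale: "x \<in> N \<Longrightarrow> (\<lambda>j. mconst c * x j) \<in> N"
    and N_T: "x \<in> N \<Longrightarrow> (\<lambda>j. T t (x j)) \<in> N"
    and N_bound: "x \<in> N \<Longrightarrow> r \<le> j \<Longrightarrow> x j = 0"
begin

lemma N_add: "x \<in> N \<Longrightarrow> y \<in> N \<Longrightarrow> (\<lambda>j. x j + y j) \<in> N"
  using N_diff[of x "\<lambda>j. 0 - y j"] N_diff[OF N_zero, of y] by simp

text \<open>
  The division algorithm: the largest term divisible by a leading term is removed repeatedly. Each
  step only introduces smaller terms, which gives the termination and the bound on the terms of
  the remainder.
\<close>
lemma normal_form:
  assumes lt: "term_order lt" and E: "\<And>u a. (u, a) \<in> E \<Longrightarrow> u \<in> N \<and> is_lead lt u a"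
    and h: "\<And>j. r \<le> j \<Longrightarrow> h j = 0"
  shows "\<exists>g. (\<lambda>j. h j - g j) \<in> N \<and> vsupp g \<inter> term_ideal (snd ` E) = {} \<and>
     (\<forall>b\<in>vsupp g. \<exists>b'\<in>vsupp h. b = b' \<or> lt b b')"
proof -
  interpret term_order lt by fact
  let ?I = "term_ideal (snd ` E)"
  have reducible: "\<exists>g. (\<lambda>j. h j - g j) \<in> N \<and> vsupp g \<inter> ?I = {} \<and>
      (\<forall>b\<in>vsupp g. \<exists>b'\<in>vsupp h. b = b' \<or> lt b b')"
    if "snd b < r" "b \<in> vsupp h \<inter> ?I" "\<forall>b'\<in>vsupp h \<inter> ?I. b' = b \<or> lt b' b" "\<And>j. r \<le> j \<Longrightarrow> h j = 0" for b h
    using that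
  proof (induction b arbitrary: h rule: wf_induct_rule[OF wf_terms[of r]])
    case (1 b h)
    obtain u a where ua: "(u, a) \<in> E" "term_dvd a b" using 1(3) by (auto simp: term_ideal_def)
    have "u \<in> N" "is_lead lt u a" using E[OF ua(1)] by blast+
    obtain t c where tc: "b \<notin> vsupp (\<lambda>j. h j - mconst c * T t (u j))"
      "\<And>b'. b' \<in> vsupp (\<lambda>j. h j - mconst c * T t (u j)) \<Longrightarrow> b' \<in> vsupp h \<or> lt b' b"
      using reduction_step[OF lt \<open>is_lead lt u a\<close> ua(2)] 1(3) by blast
    define n where "n = (\<lambda>j. mconst c * T t (u j))"
    define h' where "h' = (\<lambda>j. h j - n j)"
    have n: "n \<in> N" unfolding n_def by (intro N_scale N_T \<open>u \<in> N\<close>)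
    have h': "\<And>j. r \<le> j \<Longrightarrow> h' j = 0" using N_bound[OF n] 1(5) by (simp add: h'_def)
    have supp: "b \<notin> vsupp h'" "\<And>b'. b' \<in> vsupp h' \<Longrightarrow> b' \<in> vsupp h \<or> lt b' b"
      using tc by (simp_all add: h'_def n_def)
    have red: "lt b' b" if "b' \<in> vsupp h' \<inter> ?I" for b'
    proof (cases "b' \<in> vsupp h")
      case True
      hence "b' = b \<or> lt b' b" using that 1(4) by blast
      thus ?thesis using that supp(1) by auto
    next
      case False
      thus ?thesis using that supp(2)[of b'] by simp
    qed
    have "\<exists>g. (\<lambda>j. h' j - g j) \<in> N \<and> vsupp g \<inter> ?I = {} \<and>
        (\<forall>b\<in>vsupp g. \<exists>b'\<in>vsupp h'. b = b' \<or> lt b b')"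
    proof (cases "vsupp h' \<inter> ?I = {}")
      case True
      thus ?thesis using N_zero by (intro exI[of _ h']) auto
    next
      case False
      have "finite (vsupp h' \<inter> ?I)" using finite_vsupp[of r h'] h' by blast
      then obtain b1 where b1: "b1 \<in> vsupp h' \<inter> ?I" "\<forall>b'\<in>vsupp h' \<inter> ?I. b' = b1 \<or> lt b' b1"
        using ex_max[OF _ False] by blast
      have "snd b1 < r" using b1(1) vsupp_snd_less[of r h'] h' by blast
      moreover have "(b1, b) \<in> {(x, y). lt x y \<and> snd x < r \<and> snd y < r}"
        using red[OF b1(1)] \<open>snd b1 < r\<close> 1(2) by simp
      ultimately show ?thesis using b1 h' by (intro 1(1)[of b1 h'])
    qed
    then obtain g where g: "(\<lambda>j. h' j - g j) \<in> N" "vsupp g \<inter> ?I = {}"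
        "\<forall>b\<in>vsupp g. \<exists>b'\<in>vsupp h'. b = b' \<or> lt b b'" by blast
    have "(\<lambda>j. h j - g j) \<in> N" using N_add[OF g(1) n] by (simp add: h'_def)
    moreover have "\<exists>b2\<in>vsupp h. b' = b2 \<or> lt b' b2" if b': "b' \<in> vsupp g" for b'
    proof -
      obtain b2 where b2: "b2 \<in> vsupp h'" "b' = b2 \<or> lt b' b2" using g(3) b' by blast
      show ?thesis
      proof (cases "b2 \<in> vsupp h")
        case False
        hence "lt b2 b" using supp(2) b2(1) by blast
        hence "lt b' b" using b2(2) trans[of b' b2 b] by auto
        thus ?thesis using 1(3) by blast
      qed (use b2 in blast)
    qed
    ultimately show ?case using g(2) by blast
  qed
  show ?thesis
  proof (cases "vsupp h \<inter> ?I = {}")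
    case True
    thus ?thesis using N_zero by (intro exI[of _ h]) auto
  next
    case False
    have "finite (vsupp h \<inter> ?I)" using finite_vsupp[of r h] h by blast
    then obtain b where b: "b \<in> vsupp h \<inter> ?I" "\<forall>b'\<in>vsupp h \<inter> ?I. b' = b \<or> lt b' b"
      using ex_max[OF _ False] by blast
    moreover have "snd b < r" using b(1) vsupp_snd_less[of r h] h by blast
    ultimately show ?thesis using reducible[of b h] h by blast
  qed
qed

lemma ex_lead:
  assumes "term_order lt" "x \<in> N" "x \<noteq> (\<lambda>j. 0)"
  shows "\<exists>b. is_lead lt x b \<and> snd b < r"
proof -
  have "finite (vsupp x)" "vsupp x \<noteq> {}"
    using finite_vsupp[of r x] N_bound[OF assms(2)] assms(3) by (auto simp: vsupp_empty)
  from term_order.ex_max[OF assms(1) this] obtain b where b: "b \<in> vsupp x" "\<forall>a\<in>vsupp x. a = b \<or> lt a b" by blast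
  moreover have "snd b < r" using vsupp_snd_less[of r x] N_bound[OF assms(2)] b(1) by blast
  ultimately show ?thesis unfolding is_lead_def by blast
qed

text \<open>
  A leading term outside the monomial submodule spanned by the known ones is kept, while the rest of
  the element is replaced by its normal form. The point is that then none of the terms is divisible
  by a known leading term: whichever of them is the leading one for another term order, it is new.
\<close>
lemma reduced_element:
  assumes lt: "term_order lt" and E: "\<And>u a. (u, a) \<in> E \<Longrightarrow> u \<in> N \<and> is_lead lt u a"
    and f: "f \<in> N" "is_lead lt f b" "b \<notin> term_ideal (snd ` E)"
  shows "\<exists>g\<in>N. g \<noteq> (\<lambda>j. 0) \<and> vsupp g \<inter> term_ideal (snd ` E) = {}"
proof -
  interpret term_order lt by fact
  obtain v i where b: "b = (v, i)" by (cases b)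
  define l where "l = (\<lambda>j. if j = i then single v (lookup (f i) v) else 0)"
  define h where "h = (\<lambda>j. f j - l j)"
  have bf: "v \<in> keys (f i)" using f(2) b by (simp add: is_lead_def vsupp_iff)
  hence "i < r" using N_bound[OF f(1), of i] by (cases "r \<le> i") auto
  hence hb: "\<And>j. r \<le> j \<Longrightarrow> h j = 0" using N_bound[OF f(1)] by (auto simp: h_def l_def)
  have l: "vsupp l = {b}" using bf by (auto simp: l_def vsupp_iff b in_keys_iff lookup_single when_def split: if_splits)
  have "b \<notin> vsupp h" by (simp add: vsupp_iff b h_def l_def in_keys_iff lookup_minus)
  moreover have "vsupp h \<subseteq> vsupp f \<union> {b}" using vsupp_diff[of f l] l by (auto simp: h_def)
  ultimately have "\<And>b'. b' \<in> vsupp h \<Longrightarrow> b' \<noteq> b \<and> b' \<in> vsupp f" by blast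
  hence hlt: "lt b' b" if "b' \<in> vsupp h" for b' using f(2) that unfolding is_lead_def by fast
  have "\<exists>g. (\<lambda>j. h j - g j) \<in> N \<and> vsupp g \<inter> term_ideal (snd ` E) = {} \<and>
      (\<forall>b\<in>vsupp g. \<exists>b'\<in>vsupp h. b = b' \<or> lt b b')"
    by (rule normal_form[OF lt]) (fact E, fact hb)
  then obtain g where g: "(\<lambda>j. h j - g j) \<in> N" "vsupp g \<inter> term_ideal (snd ` E) = {}"
      "\<forall>b\<in>vsupp g. \<exists>b'\<in>vsupp h. b = b' \<or> lt b b'" by (elim exE conjE)
  have "b \<notin> vsupp g"
  proof
    assume "b \<in> vsupp g"
    then obtain b' where b': "b' \<in> vsupp h" "b = b' \<or> lt b b'" using g(3) by blast
    thus False using hlt[OF b'(1)] trans[of b b' b] irrefl[of b] by auto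
  qed
  define f' where "f' = (\<lambda>j. l j + g j)"
  have "f' \<in> N" using N_diff[OF f(1) g(1)] by (simp add: f'_def h_def algebra_simps)
  moreover have "lookup (f' i) v \<noteq> 0"
    using \<open>b \<notin> vsupp g\<close> bf by (simp add: f'_def l_def lookup_add b vsupp_iff in_keys_iff)
  hence "f' \<noteq> (\<lambda>j. 0)" by auto
  moreover have "vsupp f' \<inter> term_ideal (snd ` E) = {}"
    using vsupp_add[of l g] l g(2) f(3) by (auto simp: f'_def)
  ultimately show ?thesis by blast
qed

text \<open>
  The pairs in \<open>E\<close> prescribe the leading terms of finitely many elements and thereby single out a
  class of term orders. If the prescribed terms do not generate all leading terms for some order of the
  class, a reduced element splits the class into finitely many subclasses according to its
  leading term, and for each of them the prescribed terms generate a larger submodule. The tree of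
  these case distinctions is finite by the ascending chain condition.
\<close>
lemma universal_basis_aux:
  assumes "finite E" "fst ` E \<subseteq> N"
  shows "\<exists>U. finite U \<and> U \<subseteq> N \<and> (\<forall>lt. term_order lt \<longrightarrow> (\<forall>(u, a)\<in>E. is_lead lt u a) \<longrightarrow>
     (\<forall>f b. f \<in> N \<longrightarrow> is_lead lt f b \<longrightarrow> (\<exists>u\<in>U. \<exists>a. is_lead lt u a \<and> term_dvd a b)))"
  using assms
proof (induction "snd ` E" arbitrary: E rule: wf_induct_rule[OF wf_term_ideal_extension[of r]])
  case (1 E)
  show ?case
  proof (cases "\<forall>lt. term_order lt \<longrightarrow> (\<forall>(u, a)\<in>E. is_lead lt u a) \<longrightarrow>
     (\<forall>f b. f \<in> N \<longrightarrow> is_lead lt f b \<longrightarrow> b \<in> term_ideal (snd ` E))")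
    case True
    show ?thesis
    proof (intro exI[of _ "fst ` E"] conjI allI impI)
      fix lt f b
      assume *: "term_order lt" "\<forall>(u, a)\<in>E. is_lead lt u a" "f \<in> N" "is_lead lt f b"
      hence "b \<in> term_ideal (snd ` E)" using True by blast
      then obtain u a where "(u, a) \<in> E" "term_dvd a b" by (auto simp: term_ideal_def)
      moreover from this have "is_lead lt u a" using *(2) by blast
      ultimately show "\<exists>u\<in>fst ` E. \<exists>a. is_lead lt u a \<and> term_dvd a b"
        by (intro bexI[of _ u] exI[of _ a]) force+
    qed (use 1 in auto)
  next
    case False
    then obtain lt f b where *: "term_order lt" "\<forall>(u, a)\<in>E. is_lead lt u a" "f \<in> N" "is_lead lt f b"
      "b \<notin> term_ideal (snd ` E)" by blast
    have "\<And>u a. (u, a) \<in> E \<Longrightarrow> u \<in> N \<and> is_lead lt u a" using *(2) 1(3) by (metis (no_types, lifting) case_prodD fst_conv image_eqI subsetD)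
    from reduced_element[OF *(1) this *(3-5)] obtain g where
      g: "g \<in> N" "g \<noteq> (\<lambda>j. 0)" "vsupp g \<inter> term_ideal (snd ` E) = {}" by blast
    have fin: "finite (vsupp g)" using finite_vsupp[of r g] N_bound[OF g(1)] by blast
    have "\<exists>U. finite U \<and> U \<subseteq> N \<and> (\<forall>lt. term_order lt \<longrightarrow> (\<forall>(u, a)\<in>insert (g, b) E. is_lead lt u a) \<longrightarrow>
       (\<forall>f b. f \<in> N \<longrightarrow> is_lead lt f b \<longrightarrow> (\<exists>u\<in>U. \<exists>a. is_lead lt u a \<and> term_dvd a b)))"
      if b: "b \<in> vsupp g" for b
    proof (rule 1(1))
      have "snd b < r" using vsupp_snd_less[of r g] N_bound[OF g(1)] b by blast
      moreover have "b \<notin> term_ideal (snd ` E)" using g(3) b by blast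
      ultimately show "(snd ` insert (g, b) E, snd ` E) \<in> {(insert b A, A) |b A. snd b < r \<and> b \<notin> term_ideal A}"
        unfolding image_insert snd_conv by (intro CollectI exI[of _ b] exI[of _ "snd ` E"] conjI refl)
    qed (use 1 g in auto)
    then obtain U where U: "\<And>b. b \<in> vsupp g \<Longrightarrow> finite (U b) \<and> U b \<subseteq> N \<and>
       (\<forall>lt. term_order lt \<longrightarrow> (\<forall>(u, a)\<in>insert (g, b) E. is_lead lt u a) \<longrightarrow>
       (\<forall>f b'. f \<in> N \<longrightarrow> is_lead lt f b' \<longrightarrow> (\<exists>u\<in>U b. \<exists>a. is_lead lt u a \<and> term_dvd a b')))"
      by metis
    show ?thesis
    proof (intro exI[of _ "\<Union>b\<in>vsupp g. U b"] conjI allI impI)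
      show "finite (\<Union>b\<in>vsupp g. U b)" "(\<Union>b\<in>vsupp g. U b) \<subseteq> N" using U fin by blast+
      fix lt f b
      assume *: "term_order lt" "\<forall>(u, a)\<in>E. is_lead lt u a" "f \<in> N" "is_lead lt f b"
      obtain b0 where b0: "is_lead lt g b0" using ex_lead[OF *(1) g(1,2)] by blast
      hence "b0 \<in> vsupp g" by (simp add: is_lead_def)
      moreover have "\<forall>(u, a)\<in>insert (g, b0) E. is_lead lt u a" using b0 *(2) by blast
      ultimately have "\<exists>u\<in>U b0. \<exists>a. is_lead lt u a \<and> term_dvd a b" using U *(1,3,4) by blast
      thus "\<exists>u\<in>\<Union>b\<in>vsupp g. U b. \<exists>a. is_lead lt u a \<and> term_dvd a b" using \<open>b0 \<in> vsupp g\<close> by blast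
    qed
  qed
qed

theorem universal_groebner_basis:
  "\<exists>U. finite U \<and> U \<subseteq> N \<and> (\<forall>lt f b. term_order lt \<longrightarrow> f \<in> N \<longrightarrow> is_lead lt f b \<longrightarrow>
     (\<exists>u\<in>U. \<exists>a. is_lead lt u a \<and> term_dvd a b))"
proof -
  obtain U where U: "finite U" "U \<subseteq> N" "\<forall>lt. term_order lt \<longrightarrow>
     (\<forall>f b. f \<in> N \<longrightarrow> is_lead lt f b \<longrightarrow> (\<exists>u\<in>U. \<exists>a. is_lead lt u a \<and> term_dvd a b))"
    using universal_basis_aux[of "{}"] by auto
  show ?thesis
    using U(3)[rule_format] by (intro exI[of _ U] conjI allI impI U(1,2)) auto
qed

text \<open>
  The combinations of elements of \<open>U\<close> in which no cancellation of terms of weight more than \<open>d\<close> is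
  needed.
\<close>
inductive_set weighted_span :: "('v \<Rightarrow> nat) \<Rightarrow> nat \<Rightarrow> (nat \<Rightarrow> ('v, 'k) mpoly) set \<Rightarrow> (nat \<Rightarrow> ('v, 'k) mpoly) set"
  for w d U where
  zero: "(\<lambda>j. 0) \<in> weighted_span w d U"
| add: "x \<in> weighted_span w d U \<Longrightarrow> u \<in> U \<Longrightarrow> (\<And>b. b \<in> vsupp u \<Longrightarrow> wdot w t + wdot w (fst b) \<le> d) \<Longrightarrow>
    (\<lambda>j. x j + mconst c * T t (u j)) \<in> weighted_span w d U"

text \<open>
  Division by a universal Groebner basis with respect to a term order that refines the weight never
  increases the weighted degree. The set \<open>U\<close> does not depend on the weight.
\<close>
theorem universal_weighted_span:
  "\<exists>U. finite U \<and> U \<subseteq> N \<and>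
     (\<forall>w d. \<forall>n\<in>N. (\<forall>b\<in>vsupp n. wdot w (fst b) \<le> d) \<longrightarrow> n \<in> weighted_span w d U)"
proof -
  obtain U where U: "finite U" "U \<subseteq> N" and *: "\<forall>lt f b. term_order lt \<longrightarrow> f \<in> N \<longrightarrow> is_lead lt f b \<longrightarrow>
     (\<exists>u\<in>U. \<exists>a. is_lead lt u a \<and> term_dvd a b)" using universal_groebner_basis by (elim exE conjE)
  note U = U *[rule_format]
  have "n \<in> weighted_span w d U" if n: "n \<in> N" "\<forall>b\<in>vsupp n. wdot w (fst b) \<le> d" for w d n
  proof -
    obtain lt where lt: "term_order lt" "\<And>x y. lt x y \<Longrightarrow> wdot w (fst x) \<le> wdot w (fst y)"
      using weight_term_order_exists[of w] by blast
    interpret term_order lt by fact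
    have step: "n \<in> weighted_span w d U"
      if "is_lead lt n b" "snd b < r" "n \<in> N" "\<forall>b\<in>vsupp n. wdot w (fst b) \<le> d" for b n
      using that
    proof (induction b arbitrary: n rule: wf_induct_rule[OF wf_terms[of r]])
      case (1 b n)
      obtain u a where u: "u \<in> U" "is_lead lt u a" "term_dvd a b" using U(3)[OF lt(1) 1(4,2)] by (elim bexE exE conjE)
      have "b \<in> vsupp n" using 1(2) by (simp add: is_lead_def)
      obtain t c where tc: "fst b = t + fst a" "b \<notin> vsupp (\<lambda>j. n j - mconst c * T t (u j))"
        "\<And>b'. b' \<in> vsupp (\<lambda>j. n j - mconst c * T t (u j)) \<Longrightarrow> b' \<in> vsupp n \<or> lt b' b"
        using reduction_step[OF lt(1) u(2,3) \<open>b \<in> vsupp n\<close>] by blast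
      define n' where "n' = (\<lambda>j. n j - mconst c * T t (u j))"
      have n': "n' \<in> N" unfolding n'_def using U(2) u(1) 1(4) by (intro N_diff N_scale N_T) auto
      have less: "lt b' b" if "b' \<in> vsupp n'" for b'
      proof -
        have "b' \<noteq> b" "b' \<in> vsupp n \<or> lt b' b" using that tc(2,3) unfolding n'_def by fast+
        thus ?thesis using 1(2) unfolding is_lead_def by fast
      qed
      have bd: "wdot w (fst b) \<le> d" using 1(5) \<open>b \<in> vsupp n\<close> by blast
      have "n' \<in> weighted_span w d U"
      proof (cases "n' = (\<lambda>j. 0)")
        case True
        thus ?thesis using weighted_span.zero by simp
      next
        case False
        then obtain b1 where b1: "is_lead lt n' b1" "snd b1 < r" using ex_lead[OF lt(1) n'] by blast
        hence "lt b1 b" using less by (simp add: is_lead_def)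
        moreover have "\<forall>b\<in>vsupp n'. wdot w (fst b) \<le> d" using less lt(2) bd le_trans by blast
        moreover have "(b1, b) \<in> {(x, y). lt x y \<and> snd x < r \<and> snd y < r}"
          using \<open>lt b1 b\<close> b1(2) 1(3) by simp
        ultimately show ?thesis using b1 n' by (intro 1(1)[of b1 n'])
      qed
      hence "(\<lambda>j. n' j + mconst c * T t (u j)) \<in> weighted_span w d U"
      proof (rule weighted_span.add[OF _ u(1)])
        fix b' assume "b' \<in> vsupp u"
        hence "b' = a \<or> lt b' a" using u(2) by (auto simp: is_lead_def)
        hence "wdot w (fst b') \<le> wdot w (fst a)" using lt(2)[of b' a] by auto
        thus "wdot w t + wdot w (fst b') \<le> d" using bd tc(1) by (simp add: wdot_add)
      qed
      thus ?case by (simp add: n'_def)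
    qed
    show ?thesis
    proof (cases "n = (\<lambda>j. 0)")
      case True
      thus ?thesis using weighted_span.zero by simp
    next
      case False
      thus ?thesis using ex_lead[OF lt(1) n(1)] step n by blast
    qed
  qed
  thus ?thesis using U by blast
qed

end


section \<open>Multiplication in the Weyl algebra\<close>

lemma weyl_coeffs_sum_distrib: "weyl_coeffs (\<Sum>x\<in>A. f x) = (\<Sum>x\<in>A. weyl_coeffs (f x))"
  by (induction A rule: infinite_finite_induct) (simp_all add: weyl_coeffs_0 weyl_coeffs_add)

lemma weyl_coeffs_monom: "weyl_coeffs (weyl_monom t) = single t 1"
  using weyl_coeffs_scale_monom[of 1 t] by simp

lemma weyl_sum_mconst_mult:
  fixes p :: "('n::finite + 'n, 'k::comm_ring_1) mpoly"
  shows "weyl_sum (mconst c * p) = weyl_scale c (weyl_sum p)"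
proof -
  have "weyl_sum (mconst c * p) =
      (\<Sum>t\<in>keys p. weyl_scale (lookup (mconst c * p) t) (weyl_monom t))"
    by (rule weyl_sum_superset) (auto simp: in_keys_iff lookup_mconst_mult)
  thus ?thesis by (simp add: lookup_mconst_mult weyl_sum_def weyl_scale_sum weyl_scale_scale)
qed

lemma weyl_coeffs_scale: "weyl_coeffs (weyl_scale c w) = mconst c * weyl_coeffs w"
  by (metis weyl_coeffs_sum weyl_sum_coeffs weyl_sum_mconst_mult)

lemma weyl_sum_uminus: "weyl_sum (- p) = - weyl_sum (p :: ('n::finite + 'n, 'k::comm_ring_1) mpoly)"
  using weyl_sum_add[of p "- p"] by (simp add: eq_neg_iff_add_eq_0 add.commute)

lemma weyl_sum_diff: "weyl_sum (p - q) = weyl_sum p - weyl_sum (q :: ('n::finite + 'n, 'k::comm_ring_1) mpoly)"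
  using weyl_sum_add[of p "- q"] by (simp add: weyl_sum_uminus)

lemma weyl_coeffs_mult_right:
  "weyl_coeffs (v * w) = (\<Sum>t\<in>keys (weyl_coeffs w). mconst (lookup (weyl_coeffs w) t) * weyl_coeffs (v * weyl_monom t))"
proof -
  have "v * w = (\<Sum>t\<in>keys (weyl_coeffs w). weyl_scale (lookup (weyl_coeffs w) t) (v * weyl_monom t))"
    by (subst weyl_sum_coeffs[of w, symmetric]) (simp only: weyl_sum_def sum_distrib_left weyl_scale_mult_right)
  thus ?thesis by (simp add: weyl_coeffs_sum_distrib weyl_coeffs_scale)
qed

lemma weyl_coeffs_mult_left:
  "weyl_coeffs (v * w) = (\<Sum>t\<in>keys (weyl_coeffs v). mconst (lookup (weyl_coeffs v) t) * weyl_coeffs (weyl_monom t * w))"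
proof -
  have "v * w = (\<Sum>t\<in>keys (weyl_coeffs v). weyl_scale (lookup (weyl_coeffs v) t) (weyl_monom t * w))"
    by (subst weyl_sum_coeffs[of v, symmetric]) (simp only: weyl_sum_def sum_distrib_right weyl_scale_mult_left)
  thus ?thesis by (simp add: weyl_coeffs_sum_distrib weyl_coeffs_scale)
qed

lemma keys_sum_subset: "keys (\<Sum>x\<in>A. f x) \<subseteq> (\<Union>x\<in>A. keys (f x :: 'a \<Rightarrow>\<^sub>0 'b::comm_monoid_add))"
proof
  fix t assume "t \<in> keys (\<Sum>x\<in>A. f x)"
  hence "(\<Sum>x\<in>A. lookup (f x) t) \<noteq> 0" by (simp add: in_keys_iff lookup_sum)
  then obtain x where "x \<in> A" "lookup (f x) t \<noteq> 0" by (meson sum.neutral)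
  thus "t \<in> (\<Union>x\<in>A. keys (f x))" by (auto simp: in_keys_iff)
qed

lemma keys_mconst_mult: "keys (mconst c * p) \<subseteq> keys (p :: ('v, 'k::comm_ring_1) mpoly)"
  by (auto simp: in_keys_iff lookup_mconst_mult)

text \<open>
  Moving \<open>\<partial>\<^sub>i\<close> past \<open>\<xi>\<^sub>i\<close> produces, besides the reordered monomial, the one in which both have been
  cancelled. So these are the exponents of the correction terms when a product is put into the normal
  form \<open>\<xi>\<^bsup>\<lambda>\<^esup>\<partial>\<^bsup>\<mu>\<^esup>\<close>.
\<close>
definition contractions :: "(('n + 'n) \<Rightarrow>\<^sub>0 nat) \<Rightarrow> (('n + 'n) \<Rightarrow>\<^sub>0 nat) set" where
  "contractions t = {v. \<exists>i u. t = v + u + single (Inl i) 1 + single (Inr i) 1}"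

lemma contractionsI: "t = v + u + single (Inl i) 1 + single (Inr i) 1 \<Longrightarrow> v \<in> contractions t"
  unfolding contractions_def by blast

lemma contractions_shift: "v \<in> contractions t \<Longrightarrow> v + s \<in> contractions (t + s)"
  unfolding contractions_def by (auto simp: ac_simps) (metis add.assoc add.left_commute)

lemma wdot_contractions:
  assumes "v \<in> contractions t" "\<omega> \<in> Omega"
  shows "wdot \<omega> v < wdot \<omega> t"
proof -
  obtain i u where "t = v + u + single (Inl i) 1 + single (Inr i) 1"
    using assms(1) by (auto simp: contractions_def)
  hence "wdot \<omega> t = wdot \<omega> v + wdot \<omega> u + (\<omega> (Inl i) + \<omega> (Inr i))"
    by (simp add: wdot_add wdot_single)
  moreover have "\<omega> (Inl i) + \<omega> (Inr i) > 0" using assms(2) by (simp add: Omega_def)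
  ultimately show ?thesis by linarith
qed

definition has_symbol :: "('n::finite, 'k::field_char_0) weyl \<Rightarrow> (('n + 'n) \<Rightarrow>\<^sub>0 nat) \<Rightarrow> bool" where
  "has_symbol w t \<longleftrightarrow> (\<forall>s. keys (weyl_coeffs (w * weyl_monom s) - single (t + s) 1) \<subseteq> contractions (t + s))"

lemma minus_single_add:
  fixes t :: "'v \<Rightarrow>\<^sub>0 nat"
  assumes "lookup t v \<noteq> 0"
  shows "t - single v 1 + single v 1 = t"
  using assms by (intro poly_mapping_eqI) (auto simp: lookup_add lookup_minus lookup_single when_def)

lemma has_symbol_generator_mult:
  fixes w x :: "('n::finite, 'k::field_char_0) weyl"
  assumes w: "has_symbol w t"
    and x: "\<And>s. keys (weyl_coeffs (x * weyl_monom s) - single (s + e) 1) \<subseteq> contractions (s + e)"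
    and x': "\<And>s s'. s \<in> contractions s' \<Longrightarrow> keys (weyl_coeffs (x * weyl_monom s)) \<subseteq> contractions (s' + e)"
  shows "has_symbol (x * w) (t + e)"
  unfolding has_symbol_def
proof
  fix s
  define R where "R = weyl_coeffs (w * weyl_monom s) - single (t + s) 1"
  have R: "keys R \<subseteq> contractions (t + s)" using w unfolding R_def has_symbol_def by blast
  have eq: "w * weyl_monom s = weyl_monom (t + s) + weyl_sum R"
    by (simp add: R_def weyl_sum_diff weyl_sum_coeffs weyl_sum_single)
  have split: "weyl_coeffs (x * w * weyl_monom s) - single (t + e + s) 1 =
     (weyl_coeffs (x * weyl_monom (t + s)) - single (t + s + e) 1) + weyl_coeffs (x * weyl_sum R)"
    by (simp add: mult.assoc eq distrib_left weyl_coeffs_add ac_simps)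
  have lower: "keys (weyl_coeffs (x * weyl_sum R)) \<subseteq> contractions (t + s + e)"
  proof
    fix v assume "v \<in> keys (weyl_coeffs (x * weyl_sum R))"
    hence "v \<in> (\<Union>u\<in>keys R. keys (mconst (lookup R u) * weyl_coeffs (x * weyl_monom u)))"
      using subsetD[OF keys_sum_subset] weyl_coeffs_mult_right[of x "weyl_sum R"] unfolding weyl_coeffs_sum by simp
    then obtain u where u: "u \<in> keys R" "v \<in> keys (weyl_coeffs (x * weyl_monom u))"
      using keys_mconst_mult by blast
    thus "v \<in> contractions (t + s + e)" using x'[of u "t + s"] R by blast
  qed
  have "keys (weyl_coeffs (x * w * weyl_monom s) - single (t + e + s) 1) \<subseteq> contractions (t + s + e)"
    unfolding split using x[of "t + s"] lower by (intro order_trans[OF keys_add_subset] Un_least)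
  thus "keys (weyl_coeffs (x * w * weyl_monom s) - single (t + e + s) 1) \<subseteq> contractions (t + e + s)"
    by (simp only: add.assoc add.commute[of s e])
qed

lemma has_symbol_xi_mult:
  assumes "has_symbol w t"
  shows "has_symbol (weyl_xi i * w) (t + single (Inl i) 1)"
proof (rule has_symbol_generator_mult[OF assms])
  fix s s' :: "'a + 'a \<Rightarrow>\<^sub>0 nat"
  show "keys (weyl_coeffs (weyl_xi i * weyl_monom s) - single (s + single (Inl i) 1) 1)
      \<subseteq> contractions (s + single (Inl i) 1)"
    by (simp add: weyl_xi_monom weyl_coeffs_monom del: One_nat_def)
  assume "s \<in> contractions s'"
  thus "keys (weyl_coeffs (weyl_xi i * weyl_monom s)) \<subseteq> contractions (s' + single (Inl i) 1)"
    using contractions_shift by (simp add: weyl_xi_monom weyl_coeffs_monom del: One_nat_def)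
qed

lemma has_symbol_d_mult:
  fixes w :: "('n::finite, 'k::field_char_0) weyl"
  assumes "has_symbol w t"
  shows "has_symbol (weyl_d i * w) (t + single (Inr i) 1)"
proof (rule has_symbol_generator_mult[OF assms])
  fix s s' :: "'n + 'n \<Rightarrow>\<^sub>0 nat"
  let ?x = "single (Inl i) 1 :: 'n + 'n \<Rightarrow>\<^sub>0 nat" and ?y = "single (Inr i) 1 :: 'n + 'n \<Rightarrow>\<^sub>0 nat"
  have d: "weyl_coeffs (weyl_d i * weyl_monom s :: ('n, 'k) weyl) =
      single (s + ?y) 1 + single (s - ?x) (of_nat (lookup s (Inl i)))"
    unfolding weyl_d_monom weyl_coeffs_add weyl_scale_of_nat weyl_coeffs_scale_monom weyl_coeffs_monom ..
  have c: "s - ?x \<in> contractions (s + ?y)" if "lookup s (Inl i) \<noteq> 0"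
    using minus_single_add[OF that]
    by (intro contractionsI[of _ _ 0 i]) simp
  show "keys (weyl_coeffs (weyl_d i * weyl_monom s :: ('n, 'k) weyl) - single (s + ?y) 1)
      \<subseteq> contractions (s + ?y)"
    using c by (auto simp: d split: if_splits)
  assume s: "s \<in> contractions s'"
  then obtain j u where u: "s' = s + u + single (Inl j) 1 + single (Inr j) 1"
    by (auto simp: contractions_def)
  have "s - ?x \<in> contractions (s' + ?y)" if "lookup s (Inl i) \<noteq> 0"
  proof -
    define z where "z = s - ?x"
    have "s = z + ?x" unfolding z_def minus_single_add[OF that] ..
    hence "s' + ?y = z + (u + single (Inl j) 1 + single (Inr j) 1) + ?x + ?y"
      using u by (simp add: ac_simps)
    thus ?thesis unfolding z_def by (rule contractionsI)
  qed
  moreover have "s + ?y \<in> contractions (s' + ?y)" using s by (rule contractions_shift)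
  ultimately show "keys (weyl_coeffs (weyl_d i * weyl_monom s :: ('n, 'k) weyl)) \<subseteq> contractions (s' + ?y)"
    unfolding d by (intro order_trans[OF keys_add_subset]) (auto split: if_splits)
qed

text \<open>
  A monomial is built up from the left by multiplications with \<open>\<xi>\<^sub>i\<close> and \<open>\<partial>\<^sub>i\<close>. The factors \<open>\<partial>\<^sub>i\<close>
  have to be used up before the first \<open>\<xi>\<^sub>i\<close> occurs, for otherwise \<open>\<partial>\<^sub>i\<close> times the monomial would not be a
  monomial.
\<close>
lemma has_symbol_monom: "has_symbol (weyl_monom t :: ('n::finite, 'k::field_char_0) weyl) t"
proof (induction "wdot (\<lambda>_. 1) t" arbitrary: t)
  case 0
  hence "t = 0" by (intro poly_mapping_eqI) (simp add: wdot_def)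
  moreover have "weyl_monom 0 = (1 :: ('n, 'k) weyl)" by (simp add: weyl_monom_def weyl_pow_0)
  ultimately show ?case by (simp add: has_symbol_def weyl_coeffs_monom)
next
  case (Suc k)
  show ?case
  proof (cases "\<exists>i. lookup t (Inl i) \<noteq> 0")
    case True
    then obtain i where i: "lookup t (Inl i) \<noteq> 0" by blast
    define t' where "t' = t - single (Inl i) 1"
    have t: "t = t' + single (Inl i) 1" using minus_single_add[OF i] by (simp add: t'_def)
    have "wdot (\<lambda>_. 1) t = wdot (\<lambda>_. 1) t' + 1" unfolding t by (simp add: wdot_add wdot_single)
    hence "has_symbol (weyl_monom t' :: ('n, 'k) weyl) t'" using Suc by simp
    from has_symbol_xi_mult[OF this, of i] show ?thesis unfolding weyl_xi_monom t .
  next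
    case False
    have "\<exists>v. lookup t v \<noteq> 0"
    proof (rule ccontr)
      assume "\<nexists>v. lookup t v \<noteq> 0"
      thus False using Suc(2) by (simp add: wdot_def)
    qed
    then obtain v where "lookup t v \<noteq> 0" by blast
    then obtain i where i: "lookup t (Inr i) \<noteq> 0" using False by (cases v) auto
    define t' where "t' = t - single (Inr i) 1"
    have t: "t = t' + single (Inr i) 1" using minus_single_add[OF i] by (simp add: t'_def)
    have "wdot (\<lambda>_. 1) t = wdot (\<lambda>_. 1) t' + 1" unfolding t by (simp add: wdot_add wdot_single)
    hence "has_symbol (weyl_monom t' :: ('n, 'k) weyl) t'" using Suc by simp
    note * = has_symbol_d_mult[OF this, of i]
    have "lookup t' (Inl i) = 0" using False by (simp add: t'_def lookup_minus)
    hence "weyl_d i * weyl_monom t' = (weyl_monom t :: ('n, 'k) weyl)"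
      unfolding weyl_d_monom t by simp
    with * show ?thesis unfolding t by (simp only:)
  qed
qed

definition weyl_monom_act :: "(('n::finite + 'n) \<Rightarrow>\<^sub>0 nat) \<Rightarrow> ('n + 'n, 'k::field_char_0) mpoly \<Rightarrow> ('n + 'n, 'k) mpoly" where
  "weyl_monom_act t p = weyl_coeffs (weyl_monom t * weyl_sum p)"

lemma weyl_monom_act_lower:
  assumes "v' \<in> keys (weyl_monom_act t p - single t 1 * p)"
  shows "\<exists>v\<in>keys p. v' \<in> contractions (t + v)"
proof -
  have "weyl_monom_act t p = (\<Sum>v\<in>keys p. mconst (lookup p v) * weyl_coeffs (weyl_monom t * weyl_monom v))"
    using weyl_coeffs_mult_right[of "weyl_monom t" "weyl_sum p"] unfolding weyl_monom_act_def weyl_coeffs_sum .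
  moreover have "single t 1 * p = (\<Sum>v\<in>keys p. mconst (lookup p v) * single (t + v) 1)"
    unfolding single_mult_eq_sum mconst_mult_single by simp
  ultimately have "weyl_monom_act t p - single t 1 * p =
     (\<Sum>v\<in>keys p. mconst (lookup p v) * (weyl_coeffs (weyl_monom t * weyl_monom v) - single (t + v) 1))"
    by (simp add: sum_subtractf algebra_simps)
  hence "v' \<in> (\<Union>v\<in>keys p. keys (mconst (lookup p v) * (weyl_coeffs (weyl_monom t * weyl_monom v) - single (t + v) 1)))"
    using assms by (intro subsetD[OF keys_sum_subset]) simp
  then obtain v where v: "v \<in> keys p" "v' \<in> keys (weyl_coeffs (weyl_monom t * weyl_monom v) - single (t + v) (1::'b))"
    using keys_mconst_mult by blast
  moreover have "keys (weyl_coeffs (weyl_monom t * weyl_monom v) - single (t + v) (1::'b)) \<subseteq> contractions (t + v)"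
    using has_symbol_monom[of t] unfolding has_symbol_def by (rule spec)
  ultimately show ?thesis by blast
qed

interpretation weyl_action: monomial_action "weyl_monom_act :: _ \<Rightarrow> ('n::finite + 'n, 'k::field_char_0) mpoly \<Rightarrow> _"
proof
  fix v' t and p :: "('n + 'n, 'k) mpoly"
  assume "v' \<in> keys (weyl_monom_act t p - single t 1 * p)"
  then obtain v where v: "v \<in> keys p" "v' \<in> contractions (t + v)" using weyl_monom_act_lower by blast
  then obtain i u where u: "t + v = v' + u + single (Inl i) 1 + single (Inr i) 1"
    by (auto simp: contractions_def)
  have "lookup (u + single (Inl i) 1 + single (Inr i) 1) (Inl i) \<noteq> 0" by (simp add: lookup_add)
  hence "u + single (Inl i) 1 + single (Inr i) 1 \<noteq> 0" by (metis lookup_zero)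
  moreover have "t + v = (u + single (Inl i) 1 + single (Inr i) 1) + v'" using u by (simp add: ac_simps)
  ultimately show "\<exists>v\<in>keys p. \<exists>u. u \<noteq> 0 \<and> t + v = u + v'" using v(1) by blast
qed

text \<open>
  The associated graded ring is the commutative polynomial ring: for \<open>\<omega> \<in> \<Omega>\<close> a cancelled pair
  \<open>\<xi>\<^sub>i\<partial>\<^sub>i\<close> has positive weight, so that all correction terms drop in degree.
\<close>
lemma weyl_mult_leading:
  fixes p q :: "('n::finite + 'n, 'k::field_char_0) mpoly"
  assumes "\<omega> \<in> Omega" "deg_le \<omega> a p" "deg_le \<omega> b q"
  shows "deg_less \<omega> (a + b) (weyl_coeffs (weyl_sum p * weyl_sum q) - p * q)"
proof -
  have "weyl_coeffs (weyl_sum p * weyl_sum q) = (\<Sum>t\<in>keys p. mconst (lookup p t) * weyl_monom_act t q)"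
    unfolding weyl_monom_act_def weyl_coeffs_mult_left[of "weyl_sum p"] weyl_coeffs_sum ..
  moreover have "p * q = (\<Sum>t\<in>keys p. mconst (lookup p t) * (single t 1 * q))"
    by (subst mpoly_sum_single[of p]) (simp add: sum_distrib_right mconst_mult_single flip: mult.assoc)
  ultimately have eq: "weyl_coeffs (weyl_sum p * weyl_sum q) - p * q =
      (\<Sum>t\<in>keys p. mconst (lookup p t) * (weyl_monom_act t q - single t 1 * q))"
    by (simp add: sum_subtractf algebra_simps)
  show ?thesis
    unfolding deg_less_def
  proof
    fix v' assume "v' \<in> keys (weyl_coeffs (weyl_sum p * weyl_sum q) - p * q)"
    hence "v' \<in> (\<Union>t\<in>keys p. keys (mconst (lookup p t) * (weyl_monom_act t q - single t 1 * q)))"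
      unfolding eq by (rule subsetD[OF keys_sum_subset])
    then obtain t where t: "t \<in> keys p" "v' \<in> keys (weyl_monom_act t q - single t 1 * q)"
      using keys_mconst_mult by blast
    then obtain v where v: "v \<in> keys q" "v' \<in> contractions (t + v)" using weyl_monom_act_lower by blast
    have "wdot \<omega> v' < wdot \<omega> (t + v)" using wdot_contractions v(2) assms(1) by blast
    moreover have "wdot \<omega> t \<le> a" "wdot \<omega> v \<le> b" using assms t(1) v(1) by (auto simp: deg_le_def)
    ultimately show "wdot \<omega> v' < a + b" by (simp add: wdot_add)
  qed
qed


section \<open>Relations of a finitely generated module\<close>

lemma ex_lexicographic_max:
  fixes f g :: "'a \<Rightarrow> nat"
  assumes "finite V" "V \<noteq> {}"
  shows "\<exists>v0\<in>V. \<forall>v\<in>V. f v < f v0 \<or> (f v = f v0 \<and> g v \<le> g v0)"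
proof -
  let ?W = "{v \<in> V. f v = Max (f ` V)}"
  have "Max (f ` V) \<in> f ` V" using assms by (intro Max_in) auto
  hence "?W \<noteq> {}" by force
  hence W: "finite ?W" "?W \<noteq> {}" using assms(1) by simp_all
  have "Max (g ` ?W) \<in> g ` ?W" by (rule Max_in) (use W in auto)
  then obtain v0 where v0: "v0 \<in> ?W" "Max (g ` ?W) = g v0" by blast
  have "f v < f v0 \<or> (f v = f v0 \<and> g v \<le> g v0)" if "v \<in> V" for v
  proof (cases "f v = Max (f ` V)")
    case True
    hence "g v \<le> g v0" unfolding v0(2)[symmetric] using that W(1) by (intro Max_ge) auto
    thus ?thesis using True v0(1) by simp
  next
    case False
    moreover have "f v \<le> Max (f ` V)" using that assms(1) by (intro Max_ge) auto
    ultimately show ?thesis using v0(1) by simp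
  qed
  thus ?thesis using v0(1) by (intro bexI[of _ v0]) auto
qed

definition shifted_weight :: "('n + 'n \<Rightarrow> nat) \<Rightarrow> nat \<Rightarrow> 'n + 'n \<Rightarrow> nat" where
  "shifted_weight \<omega> s = (\<lambda>v. weight_pair 1 1 v + s * \<omega> v)"

lemma wdot_shifted_weight: "wdot (shifted_weight \<omega> s) t = wdot tdeg t + s * wdot \<omega> t"
  by (simp add: shifted_weight_def tdeg_def wdot_def sum.distrib sum_distrib_left distrib_right mult.assoc)

lemma wdot_pos_tdeg: "t \<noteq> 0 \<Longrightarrow> 0 < wdot tdeg t"
proof (rule ccontr)
  assume "t \<noteq> 0" "\<not> 0 < wdot tdeg t"
  hence "\<forall>v. tdeg v * lookup t v = 0" by (simp add: wdot_def)
  moreover have "tdeg v = 1" for v :: "'a + 'a" by (cases v) (simp_all add: tdeg_def weight_pair_def)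
  ultimately have "t = 0" by (intro poly_mapping_eqI) simp
  thus False using \<open>t \<noteq> 0\<close> by simp
qed

lemma hcomp_mconst_mult: "hcomp w d (mconst c * p) = mconst c * hcomp w d p"
  by (rule poly_mapping_eqI) (simp add: lookup_hcomp lookup_mconst_mult)

abbreviation bicomp :: "('n::finite + 'n \<Rightarrow> nat) \<Rightarrow> nat \<Rightarrow> nat \<Rightarrow> ('n + 'n, 'k::comm_ring_1) mpoly \<Rightarrow> ('n + 'n, 'k) mpoly" where
  "bicomp \<omega> a b p \<equiv> hcomp \<omega> a (hcomp tdeg b p)"

lemma lookup_bicomp:
  "lookup (bicomp \<omega> a b p) t = (if wdot \<omega> t = a \<and> wdot tdeg t = b then lookup p t else 0)"
  by (simp add: lookup_hcomp)

lemma (in left_module) act_zero_right: "act a 0 = 0"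
  using act_add_right[of a 0 0] by simp

lemma (in left_module) act_zero_left: "act 0 x = 0"
  using act_add_left[of 0 0 x] by simp

lemma (in left_module) act_diff_left: "act (a - b) x = act a x - act b x"
  using act_add_left[of "a - b" b x] by (simp add: algebra_simps)

lemma (in left_module) act_sum_right: "act a (\<Sum>j\<in>J. f j) = (\<Sum>j\<in>J. act a (f j))"
  by (induction J rule: infinite_finite_induct) (simp_all add: act_zero_right act_add_right)

locale generated_module = left_module act
  for act :: "('n::finite, 'k::field_char_0) weyl \<Rightarrow> 'm::ab_group_add \<Rightarrow> 'm" +
  fixes m :: "nat \<Rightarrow> 'm" and r :: nat
  assumes generated: "\<exists>a. x = (\<Sum>j<r. act (a j) (m j))"
begin

definition relations :: "(nat \<Rightarrow> ('n + 'n, 'k) mpoly) set" where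
  "relations = {n. (\<forall>j\<ge>r. n j = 0) \<and> (\<Sum>j<r. act (weyl_sum (n j)) (m j)) = 0}"

sublocale action_submodule weyl_monom_act relations r
proof
  fix x y :: "nat \<Rightarrow> ('n + 'n, 'k) mpoly" and c t j
  have T: "(\<lambda>j. weyl_coeffs (w * weyl_sum (x j))) \<in> relations" if "x \<in> relations" for w x
  proof -
    have "(\<Sum>j<r. act (w * weyl_sum (x j)) (m j)) = act w (\<Sum>j<r. act (weyl_sum (x j)) (m j))"
      by (simp add: act_sum_right act_act)
    thus ?thesis using that by (simp add: relations_def weyl_sum_coeffs act_zero_right weyl_coeffs_0)
  qed
  show "(\<lambda>j. 0) \<in> relations" by (simp add: relations_def act_zero_left)
  show "(\<lambda>j. x j - y j) \<in> relations" if "x \<in> relations" "y \<in> relations"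
    using that by (simp add: relations_def weyl_sum_diff act_diff_left sum_subtractf)
  show "(\<lambda>j. weyl_monom_act t (x j)) \<in> relations" if "x \<in> relations"
    using T[OF that, of "weyl_monom t"] by (simp add: weyl_monom_act_def)
  have "weyl_coeffs (weyl_scale c 1 * weyl_sum p) = mconst c * p" for p :: "('n + 'n, 'k) mpoly"
    by (simp add: weyl_scale_mult_left weyl_coeffs_scale weyl_coeffs_sum)
  thus "(\<lambda>j. mconst c * x j) \<in> relations" if "x \<in> relations"
    using T[OF that, of "weyl_scale c 1"] by simp
  show "x j = 0" if "x \<in> relations" "r \<le> j" using that by (simp add: relations_def)
qed

text \<open>
  The terms of bidegree \<open>(a, b)\<close>, meaning \<open>\<omega>\<close>-degree \<open>a\<close> and total degree \<open>b\<close>, and the terms that are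
  strictly below this bidegree for all weights \<open>(1|1) + s \<omega>\<close> with \<open>s > s0\<close> simultaneously. Letting \<open>s\<close>
  tend to infinity shows that the latter are smaller than \<open>(a, b)\<close> in the lexicographic order.
\<close>
definition bounded_by :: "nat \<Rightarrow> ('n + 'n \<Rightarrow> nat) \<Rightarrow> nat \<Rightarrow> nat \<Rightarrow> ('n + 'n \<Rightarrow>\<^sub>0 nat) \<Rightarrow> bool" where
  "bounded_by s0 \<omega> a b v \<longleftrightarrow> (wdot \<omega> v = a \<and> wdot tdeg v = b) \<or>
     (\<forall>s>s0. wdot (shifted_weight \<omega> s) v < b + s * a)"

text \<open>
  If \<open>n\<close> has degree at most \<open>b + s' a\<close> for the weight \<open>(1|1) + s' \<omega>\<close>, its component of bidegree \<open>(a, b)\<close> lies in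
  the highest possible degree. In a representation of \<open>n\<close> by a universal basis without cancellation above this
  degree, that component only comes from the summands whose leading form has bidegree \<open>(a, b)\<close>.
  Keeping just these summands gives a relation \<open>n'\<close> that is controlled for all \<open>s > s0\<close>, since the
  leading forms of the finitely many basis elements are the same for all these weights.
\<close>
lemma ex_bihomogeneous_lift:
  "\<exists>s0. \<forall>\<omega> s' n a b. s0 < s' \<longrightarrow> n \<in> relations \<longrightarrow>
      (\<forall>v\<in>vsupp n. wdot (shifted_weight \<omega> s') (fst v) \<le> b + s' * a) \<longrightarrow>
      (\<exists>n'\<in>relations. (\<forall>j. bicomp \<omega> a b (n' j) = bicomp \<omega> a b (n j)) \<and>
         (\<forall>v\<in>vsupp n'. bounded_by s0 \<omega> a b (fst v)))"
proof -
  obtain U where U: "finite U" "U \<subseteq> relations" and span: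
     "\<forall>w d. \<forall>n\<in>relations. (\<forall>b\<in>vsupp n. wdot w (fst b) \<le> d) \<longrightarrow> n \<in> weighted_span w d U"
    using universal_weighted_span by (elim exE conjE)
  have finU: "finite (vsupp u)" if "u \<in> U" for u
    using finite_vsupp[of r u] N_bound[of u] that U(2) by blast
  (* Summing over U and the supports just gives a common bound of all total degrees. *)
define s0 where "s0 = (\<Sum>u\<in>U. \<Sum>v\<in>vsupp u. wdot tdeg (fst v))"
  have s0: "wdot tdeg (fst v) \<le> s0" if "u \<in> U" "v \<in> vsupp u" for u v
  proof -
    have "wdot tdeg (fst v) \<le> (\<Sum>v\<in>vsupp u. wdot tdeg (fst v))"
      using finU that by (intro member_le_sum) auto
    also have "\<dots> \<le> s0" unfolding s0_def using U(1) that(1)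
      by (intro member_le_sum[of u U "\<lambda>u. \<Sum>v\<in>vsupp u. wdot tdeg (fst v)"]) auto
    finally show ?thesis .
  qed
  have lift: "\<exists>n'\<in>relations. (\<forall>j. bicomp \<omega> a b (n' j) = bicomp \<omega> a b (x j)) \<and>
         (\<forall>v\<in>vsupp n'. bounded_by s0 \<omega> a b (fst v))"
    if "s0 < s'" "x \<in> weighted_span (shifted_weight \<omega> s') (b + s' * a) U" for \<omega> s' x a b
    using that(2)
  proof induction
    case zero
    show ?case using N_zero by (intro bexI[of _ "\<lambda>j. 0"]) (auto simp: vsupp_def)
  next
    case (add x u t c)
    then obtain n' where n': "n' \<in> relations" "\<forall>j. bicomp \<omega> a b (n' j) = bicomp \<omega> a b (x j)"
         "\<forall>v\<in>vsupp n'. bounded_by s0 \<omega> a b (fst v)" by (elim bexE conjE)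
    have uN: "u \<in> relations" using add(2) U(2) by blast
    show ?case
    proof (cases "vsupp u = {}")
      case True
      hence "u = (\<lambda>j. 0)" by (simp only: vsupp_empty)
      hence "weyl_monom_act t (u j) = 0" for j by (simp add: weyl_monom_act_def weyl_coeffs_0)
      thus ?thesis using n' by (intro bexI[of _ n']) auto
    next
      case False
      from ex_lexicographic_max[OF finU[OF add(2)] False, of "\<lambda>v. wdot \<omega> (fst v)" "\<lambda>v. wdot tdeg (fst v)"]
      obtain v0 where v0: "v0 \<in> vsupp u" "\<And>v. v \<in> vsupp u \<Longrightarrow> wdot \<omega> (fst v) < wdot \<omega> (fst v0) \<or>
          (wdot \<omega> (fst v) = wdot \<omega> (fst v0) \<and> wdot tdeg (fst v) \<le> wdot tdeg (fst v0))" by blast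
      (* The bidegree of the leading form of u for all weights with s > s0. *)
define au bu where "au = wdot \<omega> (fst v0)" and "bu = wdot tdeg (fst v0)"
      have key: "wdot \<omega> v = au \<and> wdot tdeg v = bu \<or>
          (\<forall>s>s0. wdot (shifted_weight \<omega> s) v < bu + s * au)" if "v \<in> keys (u j)" for v j
      proof -
        have vj: "(v, j) \<in> vsupp u" using that by (simp add: vsupp_def)
        consider "wdot \<omega> v < au" | "wdot \<omega> v = au" "wdot tdeg v < bu" | "wdot \<omega> v = au" "wdot tdeg v = bu"
          using v0(2)[OF vj] unfolding au_def bu_def by force
        thus ?thesis
        proof cases
          case 1
          have "wdot (shifted_weight \<omega> s) v < bu + s * au" if "s0 < s" for s
          proof -
            have "wdot tdeg v + s * wdot \<omega> v < s + s * wdot \<omega> v"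
              using s0[OF add(2) vj] that by simp
            also have "\<dots> = s * Suc (wdot \<omega> v)" by simp
            also have "\<dots> \<le> s * au" using 1 by (intro mult_le_mono2) simp
            finally show ?thesis by (simp add: wdot_shifted_weight)
          qed
          thus ?thesis by blast
        qed (simp_all add: wdot_shifted_weight)
      qed
      have termkey: "wdot \<omega> v' = wdot \<omega> t + au \<and> wdot tdeg v' = wdot tdeg t + bu \<or>
          (\<forall>s>s0. wdot (shifted_weight \<omega> s) v' < (wdot tdeg t + bu) + s * (wdot \<omega> t + au))"
        if key_v': "v' \<in> keys (weyl_monom_act t (u j))" for v' j
      proof -
        obtain v where v: "v \<in> keys (u j)" "v' = t + v \<or> (\<exists>z. z \<noteq> 0 \<and> t + v = z + v')"
          using weyl_action.keys_T[OF key_v'] by blast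
        from v(2) show ?thesis
        proof
          assume "v' = t + v"
          thus ?thesis using key[OF v(1)] by (auto simp: wdot_add wdot_shifted_weight algebra_simps)
        next
          assume "\<exists>z. z \<noteq> 0 \<and> t + v = z + v'"
          then obtain z where z: "z \<noteq> 0" "t + v = z + v'" by blast
          have "wdot (shifted_weight \<omega> s) v' < (wdot tdeg t + bu) + s * (wdot \<omega> t + au)" if "s0 < s" for s
          proof -
            have "wdot (shifted_weight \<omega> s) v' < wdot (shifted_weight \<omega> s) (t + v)"
              using wdot_pos_tdeg[OF z(1)] unfolding z(2) wdot_add by (simp add: wdot_shifted_weight)
            also have "\<dots> \<le> wdot (shifted_weight \<omega> s) t + (bu + s * au)"
              using key[OF v(1)] that by (auto simp: wdot_add wdot_shifted_weight intro: less_imp_le)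
            finally show ?thesis by (simp add: wdot_shifted_weight algebra_simps)
          qed
          thus ?thesis by blast
        qed
      qed
      show ?thesis
      proof (cases "a = wdot \<omega> t + au \<and> b = wdot tdeg t + bu")
        case True
        show ?thesis
        proof (intro bexI[of _ "\<lambda>j. n' j + mconst c * weyl_monom_act t (u j)"] conjI allI ballI)
          show "(\<lambda>j. n' j + mconst c * weyl_monom_act t (u j)) \<in> relations"
            by (intro N_add N_scale N_T n' uN)
          show "bicomp \<omega> a b (n' j + mconst c * weyl_monom_act t (u j)) = bicomp \<omega> a b (x j + mconst c * weyl_monom_act t (u j))" for j
            using n'(2) by (simp add: hcomp_add)
          fix v assume "v \<in> vsupp (\<lambda>j. n' j + mconst c * weyl_monom_act t (u j))"
          hence "v \<in> vsupp n' \<or> v \<in> vsupp (\<lambda>j. weyl_monom_act t (u j))"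
            using vsupp_add[of n' "\<lambda>j. mconst c * weyl_monom_act t (u j)"] vsupp_scale[of c "\<lambda>j. weyl_monom_act t (u j)"] by blast
          thus "bounded_by s0 \<omega> a b (fst v)"
          proof
            assume "v \<in> vsupp (\<lambda>j. weyl_monom_act t (u j))"
            hence "fst v \<in> keys (weyl_monom_act t (u (snd v)))" by (simp add: vsupp_iff)
            from termkey[OF this] show ?thesis unfolding bounded_by_def True[THEN conjunct1, symmetric]
              True[THEN conjunct2, symmetric] .
          qed (use n'(3) in blast)
        qed
      next
        case False
        have "bicomp \<omega> a b (weyl_monom_act t (u j)) = 0" for j
        proof (rule poly_mapping_eqI)
          fix v'
          have "\<not> (v' \<in> keys (weyl_monom_act t (u j)) \<and> wdot \<omega> v' = a \<and> wdot tdeg v' = b)"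
          proof
            assume *: "v' \<in> keys (weyl_monom_act t (u j)) \<and> wdot \<omega> v' = a \<and> wdot tdeg v' = b"
            have "wdot (shifted_weight \<omega> s') t + wdot (shifted_weight \<omega> s') (fst v0) \<le> b + s' * a"
              using add(3)[OF v0(1)] .
            hence "(wdot tdeg t + bu) + s' * (wdot \<omega> t + au) \<le> wdot (shifted_weight \<omega> s') v'"
              using * by (simp add: wdot_shifted_weight au_def bu_def algebra_simps)
            thus False using termkey[OF conjunct1[OF *]] False * that(1) by force
          qed
          thus "lookup (bicomp \<omega> a b (weyl_monom_act t (u j))) v' = lookup 0 v'"
            by (auto simp: lookup_bicomp in_keys_iff)
        qed
        thus ?thesis using n' by (intro bexI[of _ n']) (auto simp: hcomp_add hcomp_mconst_mult)
      qed
    qed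
  qed
  show ?thesis
  proof (intro exI[of _ s0] allI impI)
    fix \<omega> s' n a b
    assume *: "s0 < s'" "n \<in> relations" "\<forall>v\<in>vsupp n. wdot (shifted_weight \<omega> s') (fst v) \<le> b + s' * a"
    have "n \<in> weighted_span (shifted_weight \<omega> s') (b + s' * a) U"
      using span[rule_format, OF *(2)] *(3) by blast
    from lift[OF *(1) this] show "\<exists>n'\<in>relations. (\<forall>j. bicomp \<omega> a b (n' j) = bicomp \<omega> a b (n j)) \<and>
         (\<forall>v\<in>vsupp n'. bounded_by s0 \<omega> a b (fst v))" .
  qed
qed

end


section \<open>Annihilators of associated graded modules\<close>

definition axis_vec :: "nat \<Rightarrow> ('v, 'k::zero) mpoly \<Rightarrow> nat \<Rightarrow> ('v, 'k) mpoly" where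
  "axis_vec k x = (\<lambda>j. if j = k then x else 0)"

lemma axis_vec_simps [simp]: "axis_vec k x k = x" "j \<noteq> k \<Longrightarrow> axis_vec k x j = 0"
  by (simp_all add: axis_vec_def)

lemma hcomp_axis_vec: "hcomp w d (axis_vec k x j) = axis_vec k (hcomp w d x) j"
  by (simp add: axis_vec_def)

text \<open>
  \<open>p\<close> will be homogeneous of degree \<open>b\<close>, and then \<open>p ^ k\<close> is the leading form of \<open>x\<close>, unless it is zero.
\<close>
definition approx_power :: "('v::finite \<Rightarrow> nat) \<Rightarrow> nat \<Rightarrow> ('v, 'k::comm_ring_1) mpoly \<Rightarrow> nat \<Rightarrow> ('v, 'k) mpoly \<Rightarrow> bool" where
  "approx_power w b p k x \<longleftrightarrow> deg_less w (k * b) (x - p ^ k)"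

lemma approx_power_deg_le:
  assumes "deg_le w b p" "approx_power w b p k x"
  shows "deg_le w (k * b) x"
proof -
  have "x = (x - p ^ k) + p ^ k" by simp
  thus ?thesis using assms deg_le_add deg_less_imp_le deg_le_power
    unfolding approx_power_def by metis
qed

lemma approx_power_mult:
  assumes p: "deg_le w b p" and x: "approx_power w b p k x" and y: "approx_power w b p l y"
  shows "approx_power w b p (k + l) (x * y)"
proof -
  have "x * y - p ^ (k + l) = x * (y - p ^ l) + (x - p ^ k) * p ^ l"
    by (simp add: algebra_simps power_add)
  moreover have "deg_less w (k * b + l * b) (x * (y - p ^ l))"
    using approx_power_deg_le[OF p x] y by (intro deg_le_less_mult) (simp_all add: approx_power_def)
  moreover have "deg_less w (k * b + l * b) ((x - p ^ k) * p ^ l)"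
    using x p by (intro deg_less_le_mult deg_le_power) (simp_all add: approx_power_def)
  ultimately show ?thesis by (simp add: approx_power_def deg_less_add distrib_right)
qed

lemma approx_power_diff:
  assumes "approx_power w b p k x" "deg_less w (k * b) y"
  shows "approx_power w b p k (x - y)"
proof -
  have "x - y - p ^ k = (x - p ^ k) - y" by (simp only: diff_diff_eq add.commute)
  thus ?thesis using assms deg_less_diff[of w "k * b" "x - p ^ k" y] unfolding approx_power_def
    by (simp only:)
qed

text \<open>
  Modulo \<open>G\<close>, the vectors \<open>v j\<close> are linear relations between the basis vectors in which the diagonal
  coefficients are powers of \<open>p\<close> up to lower degree and all others have smaller degree. Gaussian
  elimination without division preserves this shape, and in the end a power of \<open>p\<close>, up to lower
  degree, maps all basis vectors into \<open>G\<close>. The determinant of the system, as in the Cayley-Hamilton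
  theorem, would be such an element.
\<close>
lemma ex_annihilator_approx_power:
  fixes G :: "(nat \<Rightarrow> ('v::finite, 'k::comm_ring_1) mpoly) set"
  assumes p: "deg_le w b p"
    and G_diff: "\<And>x y. x \<in> G \<Longrightarrow> y \<in> G \<Longrightarrow> (\<lambda>j. x j - y j) \<in> G"
    and G_mult: "\<And>q x. x \<in> G \<Longrightarrow> (\<lambda>j. q * x j) \<in> G"
    and J: "finite J"
    and v: "\<And>j. j \<in> J \<Longrightarrow> v j \<in> G" "\<And>j i. j \<in> J \<Longrightarrow> i \<notin> J \<Longrightarrow> v j i = 0"
      "\<And>j. j \<in> J \<Longrightarrow> approx_power w b p (k j) (v j j)"
      "\<And>j i. j \<in> J \<Longrightarrow> i \<noteq> j \<Longrightarrow> deg_less w (k j * b) (v j i)"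
  shows "\<exists>y K. approx_power w b p K y \<and> (\<forall>j\<in>J. axis_vec j y \<in> G)"
  using J v
proof (induction J arbitrary: v k)
  case empty
  show ?case by (intro exI[of _ 1] exI[of _ 0]) (simp add: approx_power_def deg_less_def)
next
  case (insert j0 J v k)
  define x where "x = v j0 j0"
  define v' where "v' = (\<lambda>j i. x * v j i - v j j0 * v j0 i)"
  have x: "approx_power w b p (k j0) x" unfolding x_def by (rule insert.prems(3)) simp
  have lead0: "deg_less w (k j0 * b) (v j0 i)" if "i \<noteq> j0" for i
    by (rule insert.prems(4)) (use that in auto)
  have "\<exists>y K. approx_power w b p K y \<and> (\<forall>j\<in>J. axis_vec j y \<in> G)"
  proof (rule insert.IH[of v' "\<lambda>j. k j0 + k j"])
    fix j assume j: "j \<in> J"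
    hence ne: "j \<noteq> j0" using insert.hyps by blast
    have vj: "v j \<in> G" "v j0 \<in> G" using insert.prems(1) j by auto
    show "v' j \<in> G" unfolding v'_def by (intro G_diff G_mult vj)
    have off: "deg_less w (k j * b) (v j j0)" by (rule insert.prems(4)) (use j ne in auto)
    show "v' j i = 0" if "i \<notin> J" for i
    proof (cases "i = j0")
      case True
      thus ?thesis by (simp add: v'_def x_def mult.commute)
    next
      case False
      thus ?thesis using that insert.prems(2) j by (simp add: v'_def)
    qed
    have corr: "deg_less w ((k j0 + k j) * b) (v j j0 * v j0 i)" if "i \<noteq> j0" for i
      using deg_less_le_mult[OF off deg_less_imp_le[OF lead0[OF that]]]
      by (simp add: distrib_right add.commute)
    have "approx_power w b p (k j) (v j j)" by (rule insert.prems(3)) (use j in auto)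
    thus "approx_power w b p (k j0 + k j) (v' j j)"
      unfolding v'_def using corr[OF ne] by (intro approx_power_diff approx_power_mult[OF p x])
    fix i assume i: "i \<noteq> j"
    show "deg_less w ((k j0 + k j) * b) (v' j i)"
    proof (cases "i = j0")
      case True
      thus ?thesis by (simp add: v'_def x_def mult.commute deg_less_def)
    next
      case False
      have "deg_less w (k j * b) (v j i)" by (rule insert.prems(4)) (use j i in auto)
      hence "deg_less w ((k j0 + k j) * b) (x * v j i)"
        using deg_le_less_mult[OF approx_power_deg_le[OF p x]] by (simp add: distrib_right)
      thus ?thesis unfolding v'_def using corr[OF False] by (rule deg_less_diff)
    qed
  qed
  then obtain y K where y: "approx_power w b p K y" "\<And>j. j \<in> J \<Longrightarrow> axis_vec j y \<in> G" by blast
  have G_minus_sum: "(\<lambda>i. g i - (\<Sum>j\<in>A. c j * axis_vec j y i)) \<in> G" if "g \<in> G" "A \<subseteq> J" for g A c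
  proof -
    have "finite A" using that(2) insert.hyps(1) finite_subset by blast
    thus ?thesis using that(2)
    proof (induction A)
      case empty
      thus ?case using that(1) by simp
    next
      case (insert j A)
      have "(\<lambda>i. (g i - (\<Sum>j\<in>A. c j * axis_vec j y i)) - c j * axis_vec j y i) \<in> G"
        by (rule G_diff, rule insert.IH) (use insert.prems in \<open>auto intro!: G_mult y(2)\<close>)
      thus ?case using insert.hyps by (simp add: algebra_simps)
    qed
  qed
  have "(\<lambda>i. y * v j0 i - (\<Sum>j\<in>J. v j0 j * axis_vec j y i)) \<in> G"
    by (intro G_minus_sum G_mult insert.prems(1)) auto
  moreover have "(\<lambda>i. y * v j0 i - (\<Sum>j\<in>J. v j0 j * axis_vec j y i)) = axis_vec j0 (x * y)"
  proof
    fix i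
    have "(\<Sum>j\<in>J. v j0 j * axis_vec j y i) = (\<Sum>j\<in>J. if j = i then v j0 i * y else 0)"
      by (intro sum.cong) (auto simp: axis_vec_def)
    also have "\<dots> = (if i \<in> J then v j0 i * y else 0)" using insert.hyps(1) by simp
    finally show "y * v j0 i - (\<Sum>j\<in>J. v j0 j * axis_vec j y i) = axis_vec j0 (x * y) i"
      using insert.hyps(2) insert.prems(2)[of j0 i] by (auto simp: axis_vec_def x_def mult.commute)
  qed
  ultimately have "axis_vec j0 (x * y) \<in> G" by simp
  moreover have "axis_vec j (x * y) \<in> G" if "j \<in> J" for j
  proof -
    have "(\<lambda>i. x * axis_vec j y i) = axis_vec j (x * y)" by (auto simp: axis_vec_def)
    thus ?thesis using G_mult[OF y(2)[OF that], of x] by simp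
  qed
  ultimately show ?case using approx_power_mult[OF p x y(1)]
    by (intro exI[of _ "x * y"] exI[of _ "k j0 + K"]) auto
qed

context generated_module
begin

text \<open>
  The submodule \<open>gr\<^sup>\<omega> N\<close> of the free module over the polynomial ring. Membership is tested in each
  degree separately, because the homogeneous components of an element are leading forms of
  different relations.
\<close>
definition gr_relations :: "('n + 'n \<Rightarrow> nat) \<Rightarrow> (nat \<Rightarrow> ('n + 'n, 'k) mpoly) set" where
  "gr_relations \<omega> = {h. \<forall>a. \<exists>n\<in>relations. (\<forall>v\<in>vsupp n. wdot \<omega> (fst v) \<le> a) \<and>
     (\<forall>j. hcomp \<omega> a (n j) = hcomp \<omega> a (h j))}"

text \<open>
  The annihilator of the associated graded module for the filtration with the chosen generators in
  degree \<open>0\<close>.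
\<close>
definition symbol_ann :: "('n + 'n \<Rightarrow> nat) \<Rightarrow> ('n + 'n, 'k) mpoly set" where
  "symbol_ann \<omega> = {x. \<forall>k<r. axis_vec k x \<in> gr_relations \<omega>}"

lemma gr_relations_homogeneousI:
  assumes "n \<in> relations" "\<forall>v\<in>vsupp n. wdot \<omega> (fst v) \<le> a" "\<And>j. hcomp \<omega> a (n j) = h j"
  shows "h \<in> gr_relations \<omega>"
  unfolding gr_relations_def
proof (intro CollectI allI)
  fix a'
  have hh: "hcomp \<omega> a' (h j) = (if a' = a then h j else 0)" for j
    by (simp add: assms(3)[symmetric] hcomp_hcomp)
  show "\<exists>n\<in>relations. (\<forall>v\<in>vsupp n. wdot \<omega> (fst v) \<le> a') \<and> (\<forall>j. hcomp \<omega> a' (n j) = hcomp \<omega> a' (h j))"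
  proof (cases "a' = a")
    case True
    thus ?thesis using assms hh by (intro bexI[of _ n]) simp_all
  next
    case False
    thus ?thesis using hh N_zero by (intro bexI[of _ "\<lambda>j. 0"]) (simp_all add: vsupp_def)
  qed
qed

lemma gr_relations_diff:
  assumes "x \<in> gr_relations \<omega>" "y \<in> gr_relations \<omega>"
  shows "(\<lambda>j. x j - y j) \<in> gr_relations \<omega>"
  unfolding gr_relations_def
proof (intro CollectI allI)
  fix a
  obtain n where n: "n \<in> relations" "\<forall>v\<in>vsupp n. wdot \<omega> (fst v) \<le> a" "\<forall>j. hcomp \<omega> a (n j) = hcomp \<omega> a (x j)"
    using assms(1) unfolding gr_relations_def by fast
  obtain n' where n': "n' \<in> relations" "\<forall>v\<in>vsupp n'. wdot \<omega> (fst v) \<le> a" "\<forall>j. hcomp \<omega> a (n' j) = hcomp \<omega> a (y j)"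
    using assms(2) unfolding gr_relations_def by fast
  show "\<exists>n\<in>relations. (\<forall>v\<in>vsupp n. wdot \<omega> (fst v) \<le> a) \<and> (\<forall>j. hcomp \<omega> a (n j) = hcomp \<omega> a (x j - y j))"
  proof (intro bexI[of _ "\<lambda>j. n j - n' j"] conjI ballI allI)
    show "(\<lambda>j. n j - n' j) \<in> relations" using n(1) n'(1) by (rule N_diff)
    show "hcomp \<omega> a (n j - n' j) = hcomp \<omega> a (x j - y j)" for j using n(3) n'(3) by (simp add: hcomp_diff)
    show "wdot \<omega> (fst v) \<le> a" if "v \<in> vsupp (\<lambda>j. n j - n' j)" for v
      using that vsupp_diff[of n n'] n(2) n'(2) by blast
  qed
qed

lemma gr_relations_zero: "(\<lambda>j. 0) \<in> gr_relations \<omega>"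
  by (rule gr_relations_homogeneousI[of "\<lambda>j. 0" \<omega> 0]) (auto simp: N_zero vsupp_def)

lemma gr_relations_add:
  assumes "x \<in> gr_relations \<omega>" "y \<in> gr_relations \<omega>"
  shows "(\<lambda>j. x j + y j) \<in> gr_relations \<omega>"
  using gr_relations_diff[OF assms(1) gr_relations_diff[OF gr_relations_zero assms(2)]] by simp

lemma weyl_sum_single_1: "weyl_sum (single t 1) = (weyl_monom t :: ('n, 'k) weyl)"
  by (simp add: weyl_sum_single)

lemma deg_le_single: "deg_le \<omega> (wdot \<omega> t) (single t c)"
  by (auto simp: deg_le_def split: if_splits)

lemma gr_relations_single_mult:
  assumes \<omega>: "\<omega> \<in> Omega" and "x \<in> gr_relations \<omega>"
  shows "(\<lambda>j. single t c * x j) \<in> gr_relations \<omega>"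
  unfolding gr_relations_def
proof (intro CollectI allI)
  fix a
  show "\<exists>n\<in>relations. (\<forall>v\<in>vsupp n. wdot \<omega> (fst v) \<le> a) \<and> (\<forall>j. hcomp \<omega> a (n j) = hcomp \<omega> a (single t c * x j))"
  proof (cases "wdot \<omega> t \<le> a")
    case False
    thus ?thesis using N_zero by (intro bexI[of _ "\<lambda>j. 0"]) (simp_all add: vsupp_def hcomp_single_mult)
  next
    case True
    obtain n where n: "n \<in> relations" "\<forall>v\<in>vsupp n. wdot \<omega> (fst v) \<le> a - wdot \<omega> t"
        "\<forall>j. hcomp \<omega> (a - wdot \<omega> t) (n j) = hcomp \<omega> (a - wdot \<omega> t) (x j)"
      using assms(2) unfolding gr_relations_def by fast
    have lower: "deg_less \<omega> a (weyl_monom_act t (n j) - single t 1 * n j)"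
      and deg: "deg_le \<omega> a (single t 1 * n j)" for j
    proof -
      have "deg_le \<omega> (a - wdot \<omega> t) (n j)" using n(2) by (auto simp: deg_le_def vsupp_def)
      from weyl_mult_leading[OF \<omega> deg_le_single this, of t 1] deg_le_mult[OF deg_le_single this, of t 1]
      show "deg_less \<omega> a (weyl_monom_act t (n j) - single t 1 * n j)" "deg_le \<omega> a (single t 1 * n j)"
        using True by (simp_all add: weyl_monom_act_def weyl_sum_single_1)
    qed
    have comp: "hcomp \<omega> a (weyl_monom_act t (n j)) = single t 1 * hcomp \<omega> (a - wdot \<omega> t) (x j)" for j
      using hcomp_eq_0[OF lower[of j]] n(3) True by (simp add: hcomp_diff hcomp_single_mult)
    show ?thesis
    proof (intro bexI[of _ "\<lambda>j. mconst c * weyl_monom_act t (n j)"] conjI ballI allI)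
      show "(\<lambda>j. mconst c * weyl_monom_act t (n j)) \<in> relations" by (intro N_scale N_T n)
      show "hcomp \<omega> a (mconst c * weyl_monom_act t (n j)) = hcomp \<omega> a (single t c * x j)" for j
        using True by (simp add: hcomp_mconst_mult comp hcomp_single_mult mconst_mult_single flip: mult.assoc)
      fix v assume "v \<in> vsupp (\<lambda>j. mconst c * weyl_monom_act t (n j))"
      hence "fst v \<in> keys (weyl_monom_act t (n (snd v)))" using keys_mconst_mult by (force simp: vsupp_iff)
      moreover have "deg_le \<omega> a (weyl_monom_act t (n (snd v)))"
        using deg_le_add[OF deg_less_imp_le[OF lower[of "snd v"]] deg[of "snd v"]] by simp
      ultimately show "wdot \<omega> (fst v) \<le> a" by (auto simp: deg_le_def)
    qed
  qed
qed

lemma gr_relations_mult: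
  assumes \<omega>: "\<omega> \<in> Omega" and "x \<in> gr_relations \<omega>"
  shows "(\<lambda>j. q * x j) \<in> gr_relations \<omega>"
proof (induction q rule: mpoly_additive_closed)
  case 1
  show ?case by (simp add: gr_relations_zero)
next
  case (2 p q)
  from gr_relations_add[OF this] show ?case by (simp add: distrib_right)
next
  case (3 t c)
  show ?case by (rule gr_relations_single_mult[OF assms])
qed

definition lift_bound :: "nat \<Rightarrow> bool" where
  "lift_bound s0 \<longleftrightarrow> (\<forall>\<omega> s' n a b. s0 < s' \<longrightarrow> n \<in> relations \<longrightarrow>
      (\<forall>v\<in>vsupp n. wdot (shifted_weight \<omega> s') (fst v) \<le> b + s' * a) \<longrightarrow>
      (\<exists>n'\<in>relations. (\<forall>j. bicomp \<omega> a b (n' j) = bicomp \<omega> a b (n j)) \<and>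
         (\<forall>v\<in>vsupp n'. bounded_by s0 \<omega> a b (fst v))))"

lemma ex_lift_bound: "\<exists>s0. lift_bound s0"
  unfolding lift_bound_def by (rule ex_bihomogeneous_lift)

lemma bounded_by_leading:
  assumes "\<And>v. v \<in> keys p \<Longrightarrow> bounded_by s0 \<omega> a b v" "s0 < s"
  shows "hcomp (shifted_weight \<omega> s) (b + s * a) p = bicomp \<omega> a b p" "deg_le (shifted_weight \<omega> s) (b + s * a) p"
proof -
  have k: "wdot \<omega> v = a \<and> wdot tdeg v = b \<or> wdot (shifted_weight \<omega> s) v < b + s * a" if "v \<in> keys p" for v
    using assms(1)[OF that] assms(2) unfolding bounded_by_def by blast
  show "deg_le (shifted_weight \<omega> s) (b + s * a) p"
    unfolding deg_le_def using k by (fastforce simp: wdot_shifted_weight)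
  show "hcomp (shifted_weight \<omega> s) (b + s * a) p = bicomp \<omega> a b p"
  proof (rule poly_mapping_eqI)
    fix v
    show "lookup (hcomp (shifted_weight \<omega> s) (b + s * a) p) v = lookup (bicomp \<omega> a b p) v"
      using k[of v] by (cases "v \<in> keys p") (auto simp: lookup_hcomp wdot_shifted_weight in_keys_iff)
  qed
qed

lemma bicomp_in_symbol_ann:
  assumes "s0 < s" "\<And>k. k < r \<Longrightarrow> \<exists>n\<in>relations. (\<forall>j. bicomp \<omega> a b (n j) = axis_vec k (bicomp \<omega> a b x) j) \<and>
     (\<forall>v\<in>vsupp n. bounded_by s0 \<omega> a b (fst v))"
  shows "bicomp \<omega> a b x \<in> symbol_ann (shifted_weight \<omega> s)"
  unfolding symbol_ann_def
proof (intro CollectI allI impI)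
  fix k assume "k < r"
  obtain n where n: "n \<in> relations" "\<forall>j. bicomp \<omega> a b (n j) = axis_vec k (bicomp \<omega> a b x) j"
    "\<forall>v\<in>vsupp n. bounded_by s0 \<omega> a b (fst v)" using assms(2)[OF \<open>k < r\<close>] by (elim bexE conjE)
  have bd: "bounded_by s0 \<omega> a b v" if "v \<in> keys (n j)" for v j
    using n(3) that by (force simp: vsupp_def)
  have lead: "hcomp (shifted_weight \<omega> s) (b + s * a) (n j) = bicomp \<omega> a b (n j)"
    "deg_le (shifted_weight \<omega> s) (b + s * a) (n j)" for j
    using bounded_by_leading[of "n j" s0 \<omega> a b s] bd assms(1) by blast+
  show "axis_vec k (bicomp \<omega> a b x) \<in> gr_relations (shifted_weight \<omega> s)"
  proof (rule gr_relations_homogeneousI[OF n(1)])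
    show "\<forall>v\<in>vsupp n. wdot (shifted_weight \<omega> s) (fst v) \<le> b + s * a"
      using lead(2) by (auto simp: vsupp_def deg_le_def)
    show "hcomp (shifted_weight \<omega> s) (b + s * a) (n j) = axis_vec k (bicomp \<omega> a b x) j" for j
      using lead(1)[of j] n(2) by simp
  qed
qed

text \<open>
  The relation with leading form \<open>p e\<^sub>k\<close> is replaced by one whose leading form is a bihomogeneous
  component of \<open>p e\<^sub>k\<close>; in particular the annihilator for \<open>(1|1) + s \<omega>\<close> is bigraded.
\<close>
lemma symbol_ann_shifted_lift:
  assumes "lift_bound s0" "s0 < s" "p \<in> symbol_ann (shifted_weight \<omega> s)" "k < r"
  shows "\<exists>n\<in>relations. (\<forall>j. bicomp \<omega> a b (n j) = axis_vec k (bicomp \<omega> a b p) j) \<and>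
     (\<forall>v\<in>vsupp n. bounded_by s0 \<omega> a b (fst v))"
proof -
  let ?w = "shifted_weight \<omega> s" and ?e = "b + s * a"
  have "axis_vec k p \<in> gr_relations ?w" using assms(3,4) by (simp add: symbol_ann_def)
  then obtain n where n: "n \<in> relations" "\<forall>v\<in>vsupp n. wdot ?w (fst v) \<le> ?e"
      "\<forall>j. hcomp ?w ?e (n j) = hcomp ?w ?e (axis_vec k p j)"
    unfolding gr_relations_def by fast
  have absorb: "bicomp \<omega> a b (hcomp ?w ?e q) = bicomp \<omega> a b q" for q :: "('n + 'n, 'k) mpoly"
    by (rule poly_mapping_eqI) (simp add: lookup_hcomp wdot_shifted_weight)
  have "bicomp \<omega> a b (n j) = axis_vec k (bicomp \<omega> a b p) j" for j
    using absorb[of "n j"] absorb[of "axis_vec k p j"] n(3) by (simp add: hcomp_axis_vec)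
  moreover obtain n' where "n' \<in> relations" "\<forall>j. bicomp \<omega> a b (n' j) = bicomp \<omega> a b (n j)"
     "\<forall>v\<in>vsupp n'. bounded_by s0 \<omega> a b (fst v)"
    using assms(1)[unfolded lift_bound_def, rule_format, OF assms(2) n(1), of \<omega> b a] n(2) by blast
  ultimately show ?thesis by (intro bexI[of _ n']) simp_all
qed

lemma symbol_ann_shifted_bicomp:
  assumes "lift_bound s0" "s0 < s" "p \<in> symbol_ann (shifted_weight \<omega> s)"
  shows "bicomp \<omega> a b p \<in> symbol_ann (shifted_weight \<omega> s)"
  using symbol_ann_shifted_lift[OF assms] by (rule bicomp_in_symbol_ann[OF assms(2)])

text \<open>
  Top forms of elements of \<open>A\<^sub>\<omega>\<close> have their bihomogeneous components in the annihilator for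
  \<open>(1|1) + s \<omega>\<close>. The relation with leading
  \<open>\<omega>\<close>-form \<open>f\<^sub>a e\<^sub>k\<close> has the top form of the latter as leading form for the weight with a sufficiently large
  \<open>s'\<close>, and the lift transports this from \<open>s'\<close> to \<open>s\<close>.
\<close>
lemma symbol_ann_top_form_shifted:
  assumes "lift_bound s0" "s0 < s" "f \<in> symbol_ann \<omega>" "deg_le tdeg b f"
  shows "bicomp \<omega> a b f \<in> symbol_ann (shifted_weight \<omega> s)"
proof (rule bicomp_in_symbol_ann[OF assms(2)])
  fix k assume "k < r"
  hence "axis_vec k f \<in> gr_relations \<omega>" using assms(3) by (simp add: symbol_ann_def)
  then obtain n where n: "n \<in> relations" "\<forall>v\<in>vsupp n. wdot \<omega> (fst v) \<le> a"
      "\<forall>j. hcomp \<omega> a (n j) = hcomp \<omega> a (axis_vec k f j)"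
    unfolding gr_relations_def by fast
  have fin: "finite (vsupp n)" using finite_vsupp[of r n] N_bound[OF n(1)] by blast
  (* So large that a term of smaller \<omega>-degree cannot catch up by its total degree. *)
define s' where "s' = Suc (s0 + (\<Sum>v\<in>vsupp n. wdot tdeg (fst v)))"
  have "wdot (shifted_weight \<omega> s') (fst v) \<le> b + s' * a" if v: "v \<in> vsupp n" for v
  proof (cases "wdot \<omega> (fst v) = a")
    case True
    have "fst v \<in> keys (hcomp \<omega> a (n (snd v)))" using v True by (simp add: vsupp_iff keys_hcomp)
    hence "fst v \<in> keys f" unfolding n(3)[rule_format]
      by (cases "snd v = k") (simp_all add: hcomp_axis_vec keys_hcomp)
    thus ?thesis using True assms(4) by (simp add: wdot_shifted_weight deg_le_def)
  next
    case False
    hence "Suc (wdot \<omega> (fst v)) \<le> a" using n(2) v by (simp add: le_neq_implies_less Suc_leI)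
    moreover have "wdot tdeg (fst v) \<le> (\<Sum>v\<in>vsupp n. wdot tdeg (fst v))"
      using fin v by (intro member_le_sum) auto
    hence "wdot tdeg (fst v) \<le> s'" by (simp add: s'_def)
    ultimately have "wdot tdeg (fst v) + s' * wdot \<omega> (fst v) \<le> s' * a"
      by (metis add_le_mono1 le_trans mult_Suc_right mult_le_mono2)
    thus ?thesis by (simp add: wdot_shifted_weight)
  qed
  moreover have "s0 < s'" by (simp add: s'_def)
  ultimately obtain n' where n': "n' \<in> relations" "\<forall>j. bicomp \<omega> a b (n' j) = bicomp \<omega> a b (n j)"
     "\<forall>v\<in>vsupp n'. bounded_by s0 \<omega> a b (fst v)"
    using assms(1)[unfolded lift_bound_def, rule_format, of s' n \<omega> b a] n(1) by blast
  have "bicomp \<omega> a b (n j) = axis_vec k (bicomp \<omega> a b f) j" for j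
    using n(3) by (simp add: hcomp_commute[of \<omega> a tdeg b] hcomp_axis_vec)
  thus "\<exists>n\<in>relations. (\<forall>j. bicomp \<omega> a b (n j) = axis_vec k (bicomp \<omega> a b f) j) \<and>
     (\<forall>v\<in>vsupp n. bounded_by s0 \<omega> a b (fst v))"
    using n' by (intro bexI[of _ n']) simp_all
qed

lemma bounded_by_weights:
  assumes "bounded_by s0 \<omega> a b v"
  shows "wdot \<omega> v \<le> a" "wdot \<omega> v = a \<Longrightarrow> wdot tdeg v \<le> b"
proof -
  show "wdot \<omega> v = a \<Longrightarrow> wdot tdeg v \<le> b"
    using assms unfolding bounded_by_def wdot_shifted_weight by (auto dest: spec[of _ "Suc s0"])
  show "wdot \<omega> v \<le> a"
  proof (rule ccontr)
    assume "\<not> wdot \<omega> v \<le> a"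
    hence "Suc a \<le> wdot \<omega> v" by simp
    hence "(s0 + b + 1) * Suc a \<le> (s0 + b + 1) * wdot \<omega> v" by (rule mult_le_mono2)
    moreover have "wdot tdeg v + (s0 + b + 1) * wdot \<omega> v < b + (s0 + b + 1) * a"
      using assms \<open>\<not> wdot \<omega> v \<le> a\<close> unfolding bounded_by_def wdot_shifted_weight
      by (auto dest: spec[of _ "s0 + b + 1"])
    ultimately show False by simp
  qed
qed

text \<open>
  The lifted relations, cut down to their leading \<open>\<omega>\<close>-forms, have the top form \<open>p e\<^sub>k\<close> with the
  bihomogeneous component \<open>p\<close> in question. So they express \<open>p e\<^sub>k\<close> modulo \<open>gr\<^sup>\<omega> N\<close> by vectors of smaller
  total degree, and elimination applies.
\<close>
lemma symbol_ann_shifted_power: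
  assumes \<omega>: "\<omega> \<in> Omega" and "lift_bound s0" "s0 < s" "p \<in> symbol_ann (shifted_weight \<omega> s)"
  shows "\<exists>x K. x \<in> symbol_ann \<omega> \<and> approx_power tdeg b (bicomp \<omega> a b p) K x"
proof -
  let ?p = "bicomp \<omega> a b p"
  have "\<forall>k. \<exists>n. k < r \<longrightarrow> n \<in> relations \<and> (\<forall>j. bicomp \<omega> a b (n j) = axis_vec k ?p j) \<and>
     (\<forall>v\<in>vsupp n. bounded_by s0 \<omega> a b (fst v))"
    using symbol_ann_shifted_lift[OF assms(2-4), of _ a b] by blast
  then obtain n where n: "\<And>k. k < r \<Longrightarrow> n k \<in> relations"
    "\<And>k j. k < r \<Longrightarrow> bicomp \<omega> a b (n k j) = axis_vec k ?p j"
    "\<And>k v. k < r \<Longrightarrow> v \<in> vsupp (n k) \<Longrightarrow> bounded_by s0 \<omega> a b (fst v)" by metis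
  define g where "g k = (\<lambda>j. hcomp \<omega> a (n k j))" for k
  have p: "deg_le tdeg b ?p" by (auto simp: deg_le_def keys_hcomp)
  have g_deg: "deg_le tdeg b (g k j)" if "k < r" for k j
    unfolding deg_le_def
  proof
    fix v assume "v \<in> keys (g k j)"
    hence "(v, j) \<in> vsupp (n k)" "wdot \<omega> v = a" by (auto simp: g_def keys_hcomp vsupp_def)
    thus "wdot tdeg v \<le> b" using bounded_by_weights(2)[OF n(3)[OF that, of "(v, j)"]] by simp
  qed
  have g_top: "hcomp tdeg b (g k j) = axis_vec k ?p j" if "k < r" for k j
    using n(2)[OF that, of j] by (simp add: g_def hcomp_commute[of tdeg b])
  have "\<exists>y K. approx_power tdeg b ?p K y \<and> (\<forall>j\<in>{..<r}. axis_vec j y \<in> gr_relations \<omega>)"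
  proof (rule ex_annihilator_approx_power[where v = g and k = "\<lambda>_. 1", OF p gr_relations_diff gr_relations_mult[OF \<omega>]])
    fix k assume "k \<in> {..<r}"
    hence k: "k < r" by simp
    show "g k \<in> gr_relations \<omega>"
    proof (rule gr_relations_homogeneousI[OF n(1)[OF k]])
      show "\<forall>v\<in>vsupp (n k). wdot \<omega> (fst v) \<le> a" using bounded_by_weights(1) n(3)[OF k] by blast
    qed (simp add: g_def)
    show "g k i = 0" if "i \<notin> {..<r}" for i using N_bound[OF n(1)[OF k], of i] that by (simp add: g_def)
    show "approx_power tdeg b ?p 1 (g k k)"
      using deg_less_diff_hcomp[OF g_deg[OF k, of k]] g_top[OF k, of k] by (simp add: approx_power_def)
    show "deg_less tdeg (1 * b) (g k i)" if "i \<noteq> k" for i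
      using deg_less_diff_hcomp[OF g_deg[OF k, of i]] g_top[OF k, of i] that by simp
  qed simp_all
  thus ?thesis unfolding symbol_ann_def by blast
qed

end


section \<open>Prime ideals, filtrations and annihilators\<close>

lemma primeideal_poly_ringD:
  assumes "primeideal Q (poly_ring :: ('v, 'k::comm_ring_1) mpoly ring)"
  shows "0 \<in> Q" "x \<in> Q \<Longrightarrow> y \<in> Q \<Longrightarrow> x + y \<in> Q" "x * y \<in> Q \<Longrightarrow> x \<in> Q \<or> y \<in> Q" "1 \<notin> Q"
proof -
  interpret primeideal Q poly_ring by fact
  show "0 \<in> Q" using additive_subgroup.zero_closed[OF additive_subgroup_axioms] by (simp add: poly_ring_def)
  show "x + y \<in> Q" if "x \<in> Q" "y \<in> Q" using additive_subgroup.a_closed[OF additive_subgroup_axioms that] by (simp add: poly_ring_def)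
  show "x \<in> Q \<or> y \<in> Q" if "x * y \<in> Q" using I_prime[of x y] that by (simp add: poly_ring_def)
  show "1 \<notin> Q"
  proof
    assume "1 \<in> Q"
    hence "x \<in> Q" for x using I_l_closed[of 1 x] by (simp add: poly_ring_def)
    hence "carrier poly_ring = Q" by (auto simp: poly_ring_def)
    thus False using I_notcarr by blast
  qed
qed

lemma primeideal_power:
  assumes "primeideal Q (poly_ring :: ('v, 'k::comm_ring_1) mpoly ring)" "x ^ k \<in> Q"
  shows "x \<in> Q"
  using assms(2)
  by (induction k) (use primeideal_poly_ringD(3,4)[OF assms(1)] in auto)

lemma primeideal_sum:
  assumes "primeideal Q (poly_ring :: ('v, 'k::comm_ring_1) mpoly ring)" "\<And>i. i \<in> A \<Longrightarrow> f i \<in> Q"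
  shows "(\<Sum>i\<in>A. f i) \<in> Q"
  using assms(2)
  by (induction A rule: infinite_finite_induct) (use primeideal_poly_ringD(1,2)[OF assms(1)] in auto)

text \<open>
  For a prime ideal \<open>Q\<close> this says that \<open>Q\<close> belongs to the critical cone defined by \<open>I\<close>. If
  it holds for \<open>x ^ k\<close> with the bound \<open>k b\<close>, it holds for \<open>x\<close> with the bound \<open>b\<close>, so that passing from \<open>I\<close> to
  its radical does not change it.
\<close>
definition tops_in :: "('n::finite + 'n, 'k::comm_ring_1) mpoly set \<Rightarrow> ('n + 'n, 'k) mpoly set \<Rightarrow> bool" where
  "tops_in I Q \<longleftrightarrow> (\<forall>x\<in>I. \<forall>b. deg_le tdeg b x \<longrightarrow> hcomp tdeg b x \<in> Q)"

lemma Var_gr_ideal_radical: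
  "Var (gr_ideal (poly_radical I)) = {Q. primeideal Q poly_ring \<and> tops_in I Q}"
proof -
  have "gr_ideal (poly_radical I) \<subseteq> Q \<longleftrightarrow> tops_in I Q" if Q: "primeideal Q poly_ring" for Q
  proof -
    have "ideal Q poly_ring" using Q by (rule primeideal.axioms(1))
    hence "gr_ideal (poly_radical I) \<subseteq> Q \<longleftrightarrow> top_form ` poly_radical I \<subseteq> Q"
      unfolding gr_ideal_def genideal_def by blast
    also have "\<dots> \<longleftrightarrow> tops_in I Q"
    proof
      assume *: "top_form ` poly_radical I \<subseteq> Q"
      show "tops_in I Q"
        unfolding tops_in_def
      proof (intro ballI allI impI)
        fix x b assume x: "x \<in> I" "deg_le tdeg b x"
        have "x ^ 1 \<in> I" using x(1) by simp
        hence "top_form x \<in> Q" using * unfolding poly_radical_def by blast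
        thus "hcomp tdeg b x \<in> Q"
          using top_form_eq_hcomp[OF x(2)] primeideal_poly_ringD(1)[OF Q] by auto
      qed
    next
      assume *: "tops_in I Q"
      show "top_form ` poly_radical I \<subseteq> Q"
      proof (rule image_subsetI)
        fix x assume "x \<in> poly_radical I"
        then obtain k where k: "x ^ k \<in> I" by (auto simp: poly_radical_def)
        obtain b where b: "deg_le tdeg b x" "top_form x = hcomp tdeg b x"
          using top_form_is_hcomp[of x] by blast
        have "hcomp tdeg (k * b) (x ^ k) \<in> Q" using * k deg_le_power[OF b(1)] unfolding tops_in_def by blast
        hence "hcomp tdeg b x ^ k \<in> Q" by (simp add: hcomp_power_top[OF b(1)])
        thus "top_form x \<in> Q" unfolding b(2) by (rule primeideal_power[OF Q])
      qed
    qed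
    finally show ?thesis .
  qed
  thus ?thesis unfolding Var_def by blast
qed

lemma mem_if_hcomps_mem:
  assumes "primeideal Q poly_ring" "\<And>d. hcomp w d x \<in> Q"
  shows "x \<in> Q"
proof -
  have "x = (\<Sum>d\<in>wdot w ` keys x. hcomp w d x)" by (rule sum_hcomp) auto
  also have "\<dots> \<in> Q" using assms(2) by (rule primeideal_sum[OF assms(1)])
  finally show ?thesis .
qed

definition homogeneous :: "('v::finite \<Rightarrow> nat) \<Rightarrow> nat \<Rightarrow> ('v, 'k::comm_ring_1) mpoly \<Rightarrow> bool" where
  "homogeneous w d p \<longleftrightarrow> hcomp w d p = p"

lemma homogeneous_hcomp: "homogeneous w d (hcomp w d p)"
  by (simp add: homogeneous_def hcomp_hcomp)

lemma homogeneous_deg_le: "homogeneous w d p \<Longrightarrow> deg_le w d p"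
  by (metis homogeneous_def deg_le_hcomp)

lemma homogeneous_power: "homogeneous w d p \<Longrightarrow> homogeneous w (k * d) (p ^ k)"
  by (simp add: homogeneous_def hcomp_power_top[OF homogeneous_deg_le[unfolded homogeneous_def]])

lemma hcomp_homogeneous: "homogeneous w d p \<Longrightarrow> hcomp w e p = (if e = d then p else 0)"
  by (metis homogeneous_def hcomp_hcomp)

text \<open>
  For graded ideals this means that \<open>I\<close> is contained in the radical of \<open>J\<close>. Since
  elements are sums of their homogeneous components, a prime ideal that contains \<open>J\<close> then contains
  \<open>I\<close>, and likewise for the top forms.
\<close>
definition power_dominated :: "('n::finite + 'n \<Rightarrow> nat) \<Rightarrow> ('n + 'n, 'k::comm_ring_1) mpoly set \<Rightarrow> ('n + 'n, 'k) mpoly set \<Rightarrow> bool" where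
  "power_dominated w I J \<longleftrightarrow> (\<forall>x\<in>I. \<forall>d. hcomp w d x \<in> I) \<and>
     (\<forall>x\<in>I. \<forall>d. homogeneous w d x \<longrightarrow> (\<exists>k. x ^ k \<in> J))"

lemma power_dominated_subset:
  assumes "power_dominated w I J" "primeideal Q poly_ring" "J \<subseteq> Q"
  shows "I \<subseteq> Q"
proof
  fix x assume x: "x \<in> I"
  show "x \<in> Q"
  proof (rule mem_if_hcomps_mem[OF assms(2)])
    fix d
    have "hcomp w d x \<in> I" using assms(1) x unfolding power_dominated_def by blast
    then obtain k where "hcomp w d x ^ k \<in> J"
      using assms(1) homogeneous_hcomp unfolding power_dominated_def by blast
    thus "hcomp w d x \<in> Q" using assms(3) primeideal_power[OF assms(2)] by blast
  qed
qed

lemma power_dominated_tops_in: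
  assumes "power_dominated w I J" "primeideal Q poly_ring" "tops_in J Q"
  shows "tops_in I Q"
  unfolding tops_in_def
proof (intro ballI allI impI)
  fix x b assume x: "x \<in> I" "deg_le tdeg b x"
  show "hcomp tdeg b x \<in> Q"
  proof (rule mem_if_hcomps_mem[OF assms(2), of w])
    fix d
    have "hcomp w d x \<in> I" using assms(1) x unfolding power_dominated_def by blast
    then obtain k where k: "hcomp w d x ^ k \<in> J"
      using assms(1) homogeneous_hcomp unfolding power_dominated_def by blast
    have deg: "deg_le tdeg b (hcomp w d x)" using x(2) by (simp add: deg_le_def keys_hcomp)
    have "hcomp tdeg (k * b) (hcomp w d x ^ k) \<in> Q"
      using assms(3) k deg_le_power[OF deg] unfolding tops_in_def by blast
    hence "hcomp tdeg b (hcomp w d x) ^ k \<in> Q" by (simp add: hcomp_power_top[OF deg])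
    thus "hcomp w d (hcomp tdeg b x) \<in> Q"
      unfolding hcomp_commute[of w d] by (rule primeideal_power[OF assms(2)])
  qed
qed

lemma weyl_sum_filt_le: "deg_le \<omega> e p \<Longrightarrow> weyl_sum p \<in> weyl_filt \<omega> (int e)"
  by (auto simp: weyl_filt_iff weyl_coeffs_sum deg_le_def)

lemma weyl_sum_filt_less: "deg_less \<omega> e p \<Longrightarrow> weyl_sum p \<in> weyl_filt \<omega> (int e - 1)"
  by (fastforce simp: weyl_filt_iff weyl_coeffs_sum deg_less_def)

lemma weyl_filt_diff: "v \<in> weyl_filt \<omega> i \<Longrightarrow> w \<in> weyl_filt \<omega> i \<Longrightarrow> v - w \<in> weyl_filt \<omega> i"
  using weyl_filt_add[OF _ weyl_filt_uminus, of v \<omega> i w] by simp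

lemma weyl_filt_neg: "w \<in> weyl_filt \<omega> i \<Longrightarrow> i < 0 \<Longrightarrow> w = 0"
proof -
  assume "w \<in> weyl_filt \<omega> i" "i < 0"
  hence "keys (weyl_coeffs w) = {}" unfolding weyl_filt_iff by force
  hence "weyl_coeffs w = 0" by simp
  thus "w = 0" by (metis weyl_sum_coeffs weyl_sum_0)
qed

lemma weyl_mult_filt:
  assumes "\<omega> \<in> Omega" "deg_le \<omega> a p" "deg_le \<omega> b q"
  shows "weyl_sum p * weyl_sum q - weyl_sum (p * q) \<in> weyl_filt \<omega> (int (a + b) - 1)"
  using weyl_sum_filt_less[OF weyl_mult_leading[OF assms]] by (simp add: weyl_sum_diff weyl_sum_coeffs)

lemma weyl_commutator_filt:
  assumes "\<omega> \<in> Omega" "deg_le \<omega> d q" "w \<in> weyl_filt \<omega> i"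
  shows "weyl_sum q * w - w * weyl_sum q \<in> weyl_filt \<omega> (int d + i - 1)"
proof (cases "i < 0")
  case True
  thus ?thesis using weyl_filt_neg[OF assms(3)] by (simp add: weyl_filt_0)
next
  case False
  define p where "p = weyl_coeffs w"
  have w: "w = weyl_sum p" by (simp add: p_def weyl_sum_coeffs)
  have p: "deg_le \<omega> (nat i) p" using assms(3) False by (auto simp: deg_le_def p_def weyl_filt_iff)
  have "weyl_sum q * w - w * weyl_sum q =
     (weyl_sum q * weyl_sum p - weyl_sum (q * p)) - (weyl_sum p * weyl_sum q - weyl_sum (p * q))"
    by (simp add: w mult.commute)
  also have "\<dots> \<in> weyl_filt \<omega> (int (d + nat i) - 1)"
    using weyl_mult_filt[OF assms(1,2) p] weyl_mult_filt[OF assms(1) p assms(2)]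
    unfolding add.commute[of "nat i" d] by (rule weyl_filt_diff)
  finally show ?thesis using False by simp
qed

lemma weyl_sum_1: "weyl_sum 1 = (1 :: ('n::finite, 'k::comm_ring_1) weyl)"
  using weyl_sum_single[of "0 :: 'n + 'n \<Rightarrow>\<^sub>0 nat" "1 :: 'k"] by (simp add: weyl_monom_def weyl_pow_0)

lemma weyl_power_filt:
  assumes "\<omega> \<in> Omega" "deg_le \<omega> d q"
  shows "weyl_sum (q ^ k) - weyl_sum q ^ k \<in> weyl_filt \<omega> (int (k * d) - 1)"
proof (induction k)
  case 0
  show ?case by (simp add: weyl_sum_1 weyl_filt_0)
next
  case (Suc k)
  have "weyl_sum (q ^ Suc k) - weyl_sum q ^ Suc k =
     weyl_sum q * (weyl_sum (q ^ k) - weyl_sum q ^ k) - (weyl_sum q * weyl_sum (q ^ k) - weyl_sum (q * q ^ k))"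
    by (simp add: algebra_simps)
  also have "\<dots> \<in> weyl_filt \<omega> (int (d + k * d) - 1)"
  proof (rule weyl_filt_diff)
    show "weyl_sum q * (weyl_sum (q ^ k) - weyl_sum q ^ k) \<in> weyl_filt \<omega> (int (d + k * d) - 1)"
      using weyl_filt_mult[OF weyl_sum_filt_le[OF assms(2)] Suc] by (simp add: add_diff_eq)
  qed (rule weyl_mult_filt[OF assms deg_le_power[OF assms(2)]])
  finally show ?case by simp
qed

lemma module_filtrationD:
  assumes "module_filtration \<omega> act F"
  shows "0 \<in> F i" "x \<in> F i \<Longrightarrow> y \<in> F i \<Longrightarrow> x - y \<in> F i" "x \<in> F i \<Longrightarrow> y \<in> F i \<Longrightarrow> x + y \<in> F i"
    "i \<le> j \<Longrightarrow> x \<in> F i \<Longrightarrow> x \<in> F j" "\<exists>i. x \<in> F i"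
    "w \<in> weyl_filt \<omega> i \<Longrightarrow> x \<in> F j \<Longrightarrow> act w x \<in> F (i + j)"
proof -
  have zero: "0 \<in> F i" for i using assms unfolding module_filtration_def by blast
  have diff: "x \<in> F i \<Longrightarrow> y \<in> F i \<Longrightarrow> x - y \<in> F i" for x y i
    using assms unfolding module_filtration_def by blast
  show "0 \<in> F i" by (rule zero)
  show "x \<in> F i \<Longrightarrow> y \<in> F i \<Longrightarrow> x - y \<in> F i" by (rule diff)
  show "x \<in> F i \<Longrightarrow> y \<in> F i \<Longrightarrow> x + y \<in> F i" using diff[of x i "0 - y"] diff[OF zero, of y i] by simp
  show "i \<le> j \<Longrightarrow> x \<in> F i \<Longrightarrow> x \<in> F j" using assms unfolding module_filtration_def by blast
  show "w \<in> weyl_filt \<omega> i \<Longrightarrow> x \<in> F j \<Longrightarrow> act w x \<in> F (i + j)"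
    using assms unfolding module_filtration_def by blast
  show "\<exists>i. x \<in> F i" using assms unfolding module_filtration_def by blast
qed

lemma module_filtration_sum:
  assumes "module_filtration \<omega> act F" "\<And>x. x \<in> A \<Longrightarrow> f x \<in> F i"
  shows "(\<Sum>x\<in>A. f x) \<in> F i"
  using assms(2)
  by (induction A rule: infinite_finite_induct)
    (use module_filtrationD(1,3)[OF assms(1)] in auto)

lemma gr_weyl_of_poly_eq:
  "gr_weyl_of_poly \<omega> p d = (if 0 \<le> d then weyl_sum (hcomp \<omega> (nat d) p) else 0) +o weyl_filt \<omega> (d - 1)"
proof -
  have "(\<Sum>t | t \<in> keys p \<and> int (wdot \<omega> t) = d. weyl_scale (lookup p t) (weyl_monom t)) =
     (if 0 \<le> d then weyl_sum (hcomp \<omega> (nat d) p) else 0)"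
  proof (cases "0 \<le> d")
    case True
    hence "{t. t \<in> keys p \<and> int (wdot \<omega> t) = d} = keys (hcomp \<omega> (nat d) p)" by (auto simp: keys_hcomp)
    thus ?thesis using True unfolding weyl_sum_def
      by (simp add: lookup_hcomp) (intro sum.cong, auto simp: keys_hcomp)
  next
    case False
    hence "{t. t \<in> keys p \<and> int (wdot \<omega> t) = d} = {}" by auto
    thus ?thesis using False by (simp only: if_False sum.empty)
  qed
  thus ?thesis by (simp add: gr_weyl_of_poly_def)
qed

text \<open>
  The annihilator is tested on elements of the associated graded module that are concentrated in one
  degree, which turns the condition on cosets into one on the filtration.
\<close>
lemma gr_annihilator_iff:
  fixes act :: "('n::finite, 'k::field_char_0) weyl \<Rightarrow> 'm::ab_group_add \<Rightarrow> 'm"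
  assumes "left_module act" and F: "module_filtration \<omega> act F"
  shows "p \<in> gr_annihilator \<omega> act F \<longleftrightarrow>
     (\<forall>d i. \<forall>x\<in>F i. act (weyl_sum (hcomp \<omega> d p)) x \<in> F (i + int d - 1))"
proof -
  interpret left_module act by fact
  note FD = module_filtrationD[OF F]
  define P where "P d = (if 0 \<le> d then weyl_sum (hcomp \<omega> (nat d) p) else 0)" for d :: int
  define f where "f = gr_weyl_of_poly \<omega> p"
  let ?E = "weyl_filt \<omega> :: int \<Rightarrow> ('n, 'k) weyl set"
  let ?I = "{i. f i \<noteq> ?E (i - 1)}"
  have f: "f d = P d +o ?E (d - 1)" for d by (simp add: f_def gr_weyl_of_poly_eq P_def)
  have Pf: "P d \<in> f d" for d using weyl_filt_0 by (auto simp: f elt_set_plus_def intro: bexI[of _ 0])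
  have "f d = ?E (d - 1)" if "d \<notin> int ` wdot \<omega> ` keys p" for d
  proof -
    have "hcomp \<omega> (nat d) p = 0" if "0 \<le> d"
      using \<open>d \<notin> int ` wdot \<omega> ` keys p\<close> that
      by (intro poly_mapping_eqI) (force simp: lookup_hcomp in_keys_iff image_iff)
    thus ?thesis by (simp add: f P_def)
  qed
  hence "?I \<subseteq> int ` wdot \<omega> ` keys p" by blast
  hence fin: "finite ?I" by (rule finite_subset) simp
  have act_eq: "gr_poly_act \<omega> act F p g k =
      F (k - 1) + {sum s ?I | s. \<forall>i\<in>?I. s i \<in> {act a x | a x. a \<in> f i \<and> x \<in> g (k - i)}}" for g k
    unfolding gr_poly_act_def gr_act_def f_def[symmetric] set_sum_alt[OF fin] ..
  show ?thesis
  proof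
    assume p: "p \<in> gr_annihilator \<omega> act F"
    show "\<forall>d i. \<forall>x\<in>F i. act (weyl_sum (hcomp \<omega> d p)) x \<in> F (i + int d - 1)"
    proof (intro allI ballI)
      fix d i x assume x: "x \<in> F i"
      define k where "k = i + int d"
      have Pd: "P (int d) = weyl_sum (hcomp \<omega> d p)" by (simp add: P_def)
      show "act (weyl_sum (hcomp \<omega> d p)) x \<in> F (i + int d - 1)"
      proof (cases "int d \<in> ?I")
        case False
        hence "P (int d) \<in> ?E (int d - 1)" using Pf[of "int d"] by simp
        from FD(6)[OF this x] show ?thesis by (simp add: Pd algebra_simps)
      next
        case True
        define g where "g = (\<lambda>j. if j = i then x +o F (i - 1) else F (j - 1))"
        have "g \<in> gr_carrier F"
          unfolding gr_carrier_def
        proof (intro CollectI conjI allI)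
          show "\<exists>y\<in>F j. g j = y +o F (j - 1)" for j
          proof (cases "j = i")
            case True
            thus ?thesis using x by (auto simp: g_def)
          next
            case False
            thus ?thesis using FD(1)[of j] by (intro bexI[of _ 0]) (simp_all add: g_def)
          qed
          show "finite {j. g j \<noteq> F (j - 1)}" by (rule finite_subset[of _ "{i}"]) (auto simp: g_def)
        qed
        hence "gr_poly_act \<omega> act F p g k = F (k - 1)"
          using p unfolding gr_annihilator_def gr_zero_def by simp
        moreover define s where "s = (\<lambda>j. if j = int d then act (P j) x else 0)"
        have "s j \<in> {act a y | a y. a \<in> f j \<and> y \<in> g (k - j)}" for j
        proof (cases "j = int d")
          case True
          have "x \<in> g i" using FD(1)[of "i - 1"] by (auto simp: g_def elt_set_plus_def intro: bexI[of _ 0])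
          thus ?thesis using Pf[of j] True by (auto simp: s_def k_def)
        next
          case False
          hence "k - j \<noteq> i" by (simp add: k_def)
          hence "0 \<in> g (k - j)" using FD(1) by (simp add: g_def)
          moreover have "s j = act (P j) 0" using False by (simp add: s_def act_zero_right)
          ultimately show ?thesis using Pf[of j] by blast
        qed
        hence "0 + sum s ?I \<in> gr_poly_act \<omega> act F p g k"
          unfolding act_eq using FD(1) by (intro set_plus_intro) auto
        moreover have "sum s ?I = act (P (int d)) x" using fin True by (simp add: s_def)
        ultimately show ?thesis by (simp add: Pd k_def)
      qed
    qed
  next
    assume H: "\<forall>d i. \<forall>x\<in>F i. act (weyl_sum (hcomp \<omega> d p)) x \<in> F (i + int d - 1)"
    show "p \<in> gr_annihilator \<omega> act F"
      unfolding gr_annihilator_def gr_zero_def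
    proof (intro CollectI ballI ext)
      fix g k assume g: "g \<in> gr_carrier F"
      let ?S = "{sum s ?I | s. \<forall>i\<in>?I. s i \<in> {act a x | a x. a \<in> f i \<and> x \<in> g (k - i)}}"
      have gF: "g j \<subseteq> F j" "g j \<noteq> {}" for j
      proof -
        obtain y where y: "y \<in> F j" "g j = y +o F (j - 1)" using g unfolding gr_carrier_def by blast
        show "g j \<subseteq> F j" using y FD(3)[OF y(1)] FD(4)[of "j - 1" j] by (auto simp: elt_set_plus_def)
        show "g j \<noteq> {}" using y FD(1)[of "j - 1"] by (auto simp: elt_set_plus_def)
      qed
      have summand: "act a x \<in> F (k - 1)" if ax: "a \<in> f i" "x \<in> g (k - i)" for a x i
      proof -
        obtain e where e: "e \<in> ?E (i - 1)" "a = P i + e" using ax(1) by (auto simp: f elt_set_plus_def)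
        have x: "x \<in> F (k - i)" using gF(1) ax(2) by blast
        have "act (P i) x \<in> F (k - 1)"
        proof (cases "0 \<le> i")
          case True
          thus ?thesis using H[rule_format, OF x, of "nat i"] by (simp add: P_def)
        next
          case False
          thus ?thesis using FD(1) by (simp add: P_def act_zero_left)
        qed
        moreover have "act e x \<in> F (k - 1)" using FD(6)[OF e(1) x] by simp
        ultimately show ?thesis unfolding e(2) act_add_left by (rule FD(3))
      qed
      have S: "?S \<subseteq> F (k - 1)"
      proof
        fix y assume "y \<in> ?S"
        then obtain s where s: "y = sum s ?I" "\<forall>i\<in>?I. s i \<in> {act a x | a x. a \<in> f i \<and> x \<in> g (k - i)}"
          by blast
        show "y \<in> F (k - 1)" unfolding s(1)
        proof (rule module_filtration_sum[OF F])
          fix i assume "i \<in> ?I"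
          hence "s i \<in> {act a x | a x. a \<in> f i \<and> x \<in> g (k - i)}" using s(2) by (rule bspec[rotated])
          then obtain a x where "s i = act a x" "a \<in> f i" "x \<in> g (k - i)" by blast
          thus "s i \<in> F (k - 1)" using summand[of a i x] by simp
        qed
      qed
      have "\<exists>s. \<forall>i. s i \<in> {act a x | a x. a \<in> f i \<and> x \<in> g (k - i)}"
      proof (rule choice, rule allI)
        fix i
        show "\<exists>y. y \<in> {act a x | a x. a \<in> f i \<and> x \<in> g (k - i)}" using Pf[of i] gF(2)[of "k - i"] by blast
      qed
      then obtain y where y: "y \<in> ?S" by blast
      have "F (k - 1) + ?S = F (k - 1)"
      proof
        show "F (k - 1) + ?S \<subseteq> F (k - 1)" using S FD(3) by (auto elim!: set_plus_elim)
        show "F (k - 1) \<subseteq> F (k - 1) + ?S"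
        proof
          fix x assume "x \<in> F (k - 1)"
          hence "x - y \<in> F (k - 1)" using S y FD(2) by blast
          from set_plus_intro[OF this y] show "x \<in> F (k - 1) + ?S" by simp
        qed
      qed
      thus "gr_poly_act \<omega> act F p g k = F (k - 1)" unfolding act_eq .
    qed
  qed
qed


section \<open>Independence of the good filtration and the main result\<close>

text \<open>
  The finitely many generators of a good filtration lie in some step of the other filtration.
\<close>
lemma good_filtration_subset_shift:
  fixes act :: "('n::finite, 'k::field_char_0) weyl \<Rightarrow> 'm::ab_group_add \<Rightarrow> 'm"
  assumes "good_filtration \<omega> act F" and F': "module_filtration \<omega> act F'"
  shows "\<exists>c. \<forall>i. F i \<subseteq> F' (i + int c)"
proof -
  note FD = module_filtrationD[OF F']
  obtain S :: "('m \<times> int) set" where S: "finite S" and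
    F: "\<And>i. F i = {\<Sum>(x, p)\<in>S. act (a (x, p)) x | a. \<forall>(x, p)\<in>S. a (x, p) \<in> weyl_filt \<omega> (i - p)}"
    using assms(1) unfolding good_filtration_def by (elim conjE exE) simp
  have "\<exists>e. \<forall>x. x \<in> F' (e x)" using FD(5) by (intro choice allI)
  then obtain e where e: "\<And>x. x \<in> F' (e x)" by blast
  define c where "c = (\<Sum>y\<in>S. nat (\<bar>e (fst y)\<bar> + \<bar>snd y\<bar>))"
  have c: "e x - p \<le> int c" if "(x, p) \<in> S" for x p
  proof -
    have "nat (\<bar>e (fst (x, p))\<bar> + \<bar>snd (x, p)\<bar>) \<le> c"
      unfolding c_def using S that by (intro member_le_sum[of "(x, p)" S "\<lambda>y. nat (\<bar>e (fst y)\<bar> + \<bar>snd y\<bar>)"]) auto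
    thus ?thesis by simp
  qed
  have "F i \<subseteq> F' (i + int c)" for i
  proof
    fix y assume "y \<in> F i"
    then obtain a where a: "y = (\<Sum>(x, p)\<in>S. act (a (x, p)) x)" "\<forall>(x, p)\<in>S. a (x, p) \<in> weyl_filt \<omega> (i - p)"
      unfolding F by blast
    show "y \<in> F' (i + int c)" unfolding a(1)
    proof (rule module_filtration_sum[OF F'])
      fix z assume z: "z \<in> S"
      obtain x p where xp: "z = (x, p)" by (cases z)
      have "a (x, p) \<in> weyl_filt \<omega> (i - p)" using a(2) z xp by blast
      from FD(6)[OF this e] have "act (a (x, p)) x \<in> F' (i - p + e x)" .
      hence "act (a (x, p)) x \<in> F' (i + int c)" by (rule FD(4)[rotated]) (use c z xp in force)
      thus "(case z of (x, p) \<Rightarrow> act (a (x, p)) x) \<in> F' (i + int c)" by (simp add: xp)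
    qed
  qed
  thus ?thesis by blast
qed

lemma power_act_lowers:
  assumes "left_module act"
    and step: "\<And>i x. x \<in> F i \<Longrightarrow> act q x \<in> F (i + int d - 1)" and "x \<in> F i"
  shows "act (q ^ k) x \<in> F (i + int (k * d) - int k)"
proof (induction k)
  case 0
  thus ?case using assms(3) left_module.act_one[OF assms(1)] by simp
next
  case (Suc k)
  have "act (q ^ Suc k) x = act q (act (q ^ k) x)" by (simp add: left_module.act_act[OF assms(1)])
  thus ?case using step[OF Suc] by (simp add: algebra_simps)
qed

lemma gr_annihilator_hcomp:
  fixes act :: "('n::finite, 'k::field_char_0) weyl \<Rightarrow> 'm::ab_group_add \<Rightarrow> 'm"
  assumes "left_module act" and F: "module_filtration \<omega> act F" and "p \<in> gr_annihilator \<omega> act F"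
  shows "hcomp \<omega> d p \<in> gr_annihilator \<omega> act F"
proof -
  interpret left_module act by fact
  show ?thesis
    using assms(3) module_filtrationD(1)[OF F]
    unfolding gr_annihilator_iff[OF assms(1) F] by (auto simp: hcomp_hcomp act_zero_left)
qed

lemma gr_annihilator_homogeneous_iff:
  fixes act :: "('n::finite, 'k::field_char_0) weyl \<Rightarrow> 'm::ab_group_add \<Rightarrow> 'm"
  assumes "left_module act" and F: "module_filtration \<omega> act F" and p: "homogeneous \<omega> d p"
  shows "p \<in> gr_annihilator \<omega> act F \<longleftrightarrow> (\<forall>i. \<forall>x\<in>F i. act (weyl_sum p) x \<in> F (i + int d - 1))"
proof -
  interpret left_module act by fact
  show ?thesis
    unfolding gr_annihilator_iff[OF assms(1) F] hcomp_homogeneous[OF p]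
    using module_filtrationD(1)[OF F] by (auto simp: act_zero_left)
qed

context generated_module
begin

definition generator_filt :: "('n + 'n \<Rightarrow> nat) \<Rightarrow> int \<Rightarrow> 'm set" where
  "generator_filt \<omega> i = {\<Sum>j<r. act (a j) (m j) | a. \<forall>j<r. a j \<in> weyl_filt \<omega> i}"

lemma generator_filtI: "(\<And>j. j < r \<Longrightarrow> a j \<in> weyl_filt \<omega> i) \<Longrightarrow> (\<Sum>j<r. act (a j) (m j)) \<in> generator_filt \<omega> i"
  unfolding generator_filt_def by blast

lemma generator_filtE:
  assumes "x \<in> generator_filt \<omega> i"
  obtains a where "x = (\<Sum>j<r. act (a j) (m j))" "\<And>j. j < r \<Longrightarrow> a j \<in> weyl_filt \<omega> i"
  using assms unfolding generator_filt_def by blast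

lemma generator_filtration: "module_filtration \<omega> act (generator_filt \<omega>)"
  unfolding module_filtration_def
proof (intro conjI allI ballI impI)
  fix i j :: int and x y w
  show "0 \<in> generator_filt \<omega> i"
    using generator_filtI[of "\<lambda>_. 0" \<omega> i] by (simp add: weyl_filt_0 act_zero_left)
  show "x - y \<in> generator_filt \<omega> i" if xy: "x \<in> generator_filt \<omega> i" "y \<in> generator_filt \<omega> i"
  proof -
    obtain a where a: "x = (\<Sum>j<r. act (a j) (m j))" "\<And>j. j < r \<Longrightarrow> a j \<in> weyl_filt \<omega> i"
      using xy(1) by (rule generator_filtE) blast
    obtain b where b: "y = (\<Sum>j<r. act (b j) (m j))" "\<And>j. j < r \<Longrightarrow> b j \<in> weyl_filt \<omega> i"
      using xy(2) by (rule generator_filtE) blast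
    have "(\<Sum>j<r. act (a j - b j) (m j)) \<in> generator_filt \<omega> i"
      by (intro generator_filtI weyl_filt_diff a b)
    thus ?thesis by (simp add: a(1) b(1) act_diff_left sum_subtractf)
  qed
  show "generator_filt \<omega> i \<subseteq> generator_filt \<omega> j" if "i \<le> j"
    using that weyl_filt_mono unfolding generator_filt_def by blast
  show "act w x \<in> generator_filt \<omega> (i + j)" if wx: "w \<in> weyl_filt \<omega> i" "x \<in> generator_filt \<omega> j"
  proof -
    obtain a where a: "x = (\<Sum>j<r. act (a j) (m j))" "\<And>k. k < r \<Longrightarrow> a k \<in> weyl_filt \<omega> j"
      using wx(2) by (rule generator_filtE) blast
    have "(\<Sum>j<r. act (w * a j) (m j)) \<in> generator_filt \<omega> (i + j)"
      by (intro generator_filtI weyl_filt_mult a wx)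
    thus ?thesis by (simp add: a(1) act_sum_right act_act)
  qed
next
  have "\<exists>i. x \<in> generator_filt \<omega> i" for x
  proof -
    obtain a where a: "x = (\<Sum>j<r. act (a j) (m j))" using generated by blast
    have "\<exists>e. \<forall>j. a j \<in> weyl_filt \<omega> (e j)" by (intro choice allI weyl_filt_exhaustive)
    then obtain e where e: "\<And>j. a j \<in> weyl_filt \<omega> (e j)" by blast
    have "e j \<le> (\<Sum>j<r. \<bar>e j\<bar>)" if "j < r" for j
      using member_le_sum[of j "{..<r}" "\<lambda>j. \<bar>e j\<bar>"] that by simp
    hence "x \<in> generator_filt \<omega> (\<Sum>j<r. \<bar>e j\<bar>)"
      unfolding a by (intro generator_filtI weyl_filt_mono[OF _ e])
    thus ?thesis by blast
  qed
  thus "(\<Union>i. generator_filt \<omega> i) = UNIV" by blast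
qed

lemma generator_in_filt: "k < r \<Longrightarrow> m k \<in> generator_filt \<omega> 0"
proof -
  assume k: "k < r"
  have "(\<Sum>j<r. act (if j = k then 1 else 0) (m j)) \<in> generator_filt \<omega> 0"
  proof (rule generator_filtI)
    fix j
    have "weyl_sum (1 :: ('n + 'n, 'k) mpoly) \<in> weyl_filt \<omega> (int 0)"
      by (rule weyl_sum_filt_le) (auto simp: deg_le_def wdot_def simp flip: single_one)
    thus "(if j = k then 1 else 0) \<in> (weyl_filt \<omega> 0 :: ('n, 'k) weyl set)"
      by (simp add: weyl_filt_0 weyl_sum_1)
  qed
  moreover have "(\<Sum>j<r. act (if j = k then 1 else 0) (m j)) = (\<Sum>j<r. if j = k then m k else 0)"
    by (intro sum.cong) (auto simp: act_one act_zero_left)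
  ultimately show ?thesis using k by simp
qed

lemma generator_filt_subset_shift:
  assumes "module_filtration \<omega> act F"
  shows "\<exists>c. \<forall>i. generator_filt \<omega> i \<subseteq> F (i + int c)"
proof -
  note FD = module_filtrationD[OF assms]
  have "\<exists>e. \<forall>j. m j \<in> F (e j)" using FD(5) by (intro choice allI)
  then obtain e where e: "\<And>j. m j \<in> F (e j)" by blast
  define c where "c = (\<Sum>j<r. nat \<bar>e j\<bar>)"
  have c: "e j \<le> int c" if "j < r" for j
  proof -
    have "nat \<bar>e j\<bar> \<le> c" unfolding c_def using that by (intro member_le_sum[of j "{..<r}" "\<lambda>j. nat \<bar>e j\<bar>"]) auto
    thus ?thesis by simp
  qed
  have "generator_filt \<omega> i \<subseteq> F (i + int c)" for i
  proof
    fix x assume "x \<in> generator_filt \<omega> i"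
    then obtain a where a: "x = (\<Sum>j<r. act (a j) (m j))" "\<And>j. j < r \<Longrightarrow> a j \<in> weyl_filt \<omega> i"
      by (rule generator_filtE) blast
    show "x \<in> F (i + int c)" unfolding a(1)
    proof (rule module_filtration_sum[OF assms])
      fix j assume "j \<in> {..<r}"
      hence j: "j < r" by simp
      have "act (a j) (m j) \<in> F (i + e j)" by (rule FD(6)[OF a(2)[OF j] e])
      thus "act (a j) (m j) \<in> F (i + int c)" by (rule FD(4)[rotated]) (use c[OF j] in simp)
    qed
  qed
  thus ?thesis by blast
qed

lemma symbol_ann_hcomp: "x \<in> symbol_ann \<omega> \<Longrightarrow> hcomp \<omega> d x \<in> symbol_ann \<omega>"
  unfolding symbol_ann_def
proof (intro CollectI allI impI)
  fix k assume "x \<in> {x. \<forall>k<r. axis_vec k x \<in> gr_relations \<omega>}" "k < r"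
  hence "axis_vec k x \<in> gr_relations \<omega>" by blast
  then obtain n where n: "n \<in> relations" "\<forall>v\<in>vsupp n. wdot \<omega> (fst v) \<le> d"
      "\<forall>j. hcomp \<omega> d (n j) = hcomp \<omega> d (axis_vec k x j)"
    unfolding gr_relations_def by fast
  show "axis_vec k (hcomp \<omega> d x) \<in> gr_relations \<omega>"
    by (rule gr_relations_homogeneousI[OF n(1,2)]) (simp add: n(3) hcomp_axis_vec)
qed

lemma sum_act_axis_vec: "k < r \<Longrightarrow> (\<Sum>j<r. act (weyl_sum (axis_vec k p j)) (m j)) = act (weyl_sum p) (m k)"
proof -
  assume "k < r"
  have "(\<Sum>j<r. act (weyl_sum (axis_vec k p j)) (m j)) = (\<Sum>j<r. if j = k then act (weyl_sum p) (m k) else 0)"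
    by (intro sum.cong) (auto simp: axis_vec_def act_zero_left)
  thus ?thesis using \<open>k < r\<close> by simp
qed

text \<open>
  Subtracting from \<open>x e\<^sub>k\<close> a relation with leading form \<open>x e\<^sub>k\<close> writes \<open>x m\<^sub>k\<close> with coefficients of smaller
  degree, and conversely.
\<close>
lemma symbol_ann_homogeneous_iff:
  assumes x: "homogeneous \<omega> d x"
  shows "x \<in> symbol_ann \<omega> \<longleftrightarrow> (\<forall>k<r. act (weyl_sum x) (m k) \<in> generator_filt \<omega> (int d - 1))"
proof
  assume "x \<in> symbol_ann \<omega>"
  show "\<forall>k<r. act (weyl_sum x) (m k) \<in> generator_filt \<omega> (int d - 1)"
  proof (intro allI impI)
    fix k assume k: "k < r"
    hence "axis_vec k x \<in> gr_relations \<omega>" using \<open>x \<in> symbol_ann \<omega>\<close> by (simp add: symbol_ann_def)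
    then obtain n where n: "n \<in> relations" "\<forall>v\<in>vsupp n. wdot \<omega> (fst v) \<le> d"
        "\<forall>j. hcomp \<omega> d (n j) = hcomp \<omega> d (axis_vec k x j)"
      unfolding gr_relations_def by fast
    have "deg_less \<omega> d (axis_vec k x j - n j)" for j
    proof -
      have "hcomp \<omega> d (n j) = axis_vec k x j"
        using n(3) x by (simp add: hcomp_axis_vec homogeneous_def)
      moreover have "deg_le \<omega> d (n j)" using n(2) by (auto simp: deg_le_def vsupp_def)
      ultimately have "deg_less \<omega> d (n j - axis_vec k x j)" using deg_less_diff_hcomp by metis
      thus ?thesis by (auto simp: deg_less_def in_keys_iff lookup_minus)
    qed
    hence "(\<Sum>j<r. act (weyl_sum (axis_vec k x j - n j)) (m j)) \<in> generator_filt \<omega> (int d - 1)"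
      by (intro generator_filtI weyl_sum_filt_less)
    moreover have "(\<Sum>j<r. act (weyl_sum (axis_vec k x j - n j)) (m j)) = act (weyl_sum x) (m k)"
      using n(1) sum_act_axis_vec[OF k, of x]
      by (simp add: weyl_sum_diff act_diff_left sum_subtractf relations_def)
    ultimately show "act (weyl_sum x) (m k) \<in> generator_filt \<omega> (int d - 1)" by simp
  qed
next
  assume *: "\<forall>k<r. act (weyl_sum x) (m k) \<in> generator_filt \<omega> (int d - 1)"
  show "x \<in> symbol_ann \<omega>"
    unfolding symbol_ann_def
  proof (intro CollectI allI impI)
    fix k assume k: "k < r"
    then obtain a where a: "act (weyl_sum x) (m k) = (\<Sum>j<r. act (a j) (m j))"
        "\<And>j. j < r \<Longrightarrow> a j \<in> weyl_filt \<omega> (int d - 1)"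
      using * generator_filtE by blast
    define n where "n = (\<lambda>j. if j < r then axis_vec k x j - weyl_coeffs (a j) else 0)"
    have a_less: "deg_less \<omega> d (weyl_coeffs (a j))" if "j < r" for j
      using a(2)[OF that] by (force simp: deg_less_def weyl_filt_iff)
    have x_le: "deg_le \<omega> d (axis_vec k x j)" for j
      using homogeneous_deg_le[OF x] by (simp add: axis_vec_def deg_le_def)
    have "(\<Sum>j<r. act (weyl_sum (n j)) (m j)) =
        (\<Sum>j<r. act (weyl_sum (axis_vec k x j)) (m j)) - (\<Sum>j<r. act (a j) (m j))"
      by (simp add: n_def weyl_sum_diff weyl_sum_coeffs act_diff_left sum_subtractf)
    hence "n \<in> relations" using sum_act_axis_vec[OF k, of x] a(1) by (simp add: relations_def n_def)
    moreover have "deg_le \<omega> d (n j)" for j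
    proof (cases "j < r")
      case True
      thus ?thesis using deg_le_diff[OF x_le deg_less_imp_le[OF a_less[OF True]], of j] by (simp add: n_def)
    qed (simp add: n_def deg_le_def)
    hence "\<forall>v\<in>vsupp n. wdot \<omega> (fst v) \<le> d" by (auto simp: vsupp_def deg_le_def)
    moreover have "hcomp \<omega> d (n j) = axis_vec k x j" for j
    proof (cases "j < r")
      case True
      thus ?thesis using x hcomp_eq_0[OF a_less[OF True]]
        by (simp add: n_def hcomp_diff hcomp_axis_vec homogeneous_def)
    next
      case False
      thus ?thesis using k by (auto simp: n_def axis_vec_def)
    qed
    ultimately show "axis_vec k x \<in> gr_relations \<omega>" by (rule gr_relations_homogeneousI)
  qed
qed

text \<open>
  It suffices to consider the generators, since commutators lose one degree.
\<close>
lemma symbol_ann_lowers_filt: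
  assumes \<omega>: "\<omega> \<in> Omega" and q: "homogeneous \<omega> d q" "q \<in> symbol_ann \<omega>" and "x \<in> generator_filt \<omega> i"
  shows "act (weyl_sum q) x \<in> generator_filt \<omega> (i + int d - 1)"
proof -
  note GD = module_filtrationD[OF generator_filtration]
  obtain a where a: "x = (\<Sum>j<r. act (a j) (m j))" "\<And>j. j < r \<Longrightarrow> a j \<in> weyl_filt \<omega> i"
    using assms(4) by (rule generator_filtE) blast
  have "act (weyl_sum q) x = (\<Sum>j<r. act (weyl_sum q) (act (a j) (m j)))"
    by (simp add: a(1) act_sum_right)
  also have "\<dots> \<in> generator_filt \<omega> (i + int d - 1)"
  proof (rule module_filtration_sum[OF generator_filtration])
    fix j assume "j \<in> {..<r}"
    hence j: "j < r" by simp
    have "act (weyl_sum q) (act (a j) (m j)) =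
        act (a j) (act (weyl_sum q) (m j)) + act (weyl_sum q * a j - a j * weyl_sum q) (m j)"
      by (simp add: act_act act_diff_left)
    moreover have "act (weyl_sum q) (m j) \<in> generator_filt \<omega> (int d - 1)"
      using symbol_ann_homogeneous_iff[OF q(1)] q(2) j by blast
    from GD(6)[OF a(2)[OF j] this] have "act (a j) (act (weyl_sum q) (m j)) \<in> generator_filt \<omega> (i + int d - 1)"
      by (simp add: algebra_simps)
    moreover have "act (weyl_sum q * a j - a j * weyl_sum q) (m j) \<in> generator_filt \<omega> (i + int d - 1)"
      using GD(6)[OF weyl_commutator_filt[OF \<omega> homogeneous_deg_le[OF q(1)] a(2)[OF j]] generator_in_filt[OF j]]
      by (simp add: algebra_simps)
    ultimately show "act (weyl_sum q) (act (a j) (m j)) \<in> generator_filt \<omega> (i + int d - 1)"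
      using GD(3) by simp
  qed
  finally show ?thesis .
qed

text \<open>
  The two filtrations are contained in shifts of each other by \<open>c1\<close> and \<open>c2\<close>. An element that lowers the
  expected degree by one in one of them lowers it by \<open>k\<close> when its \<open>k\<close>-th power is taken; for
  \<open>k > c1 + c2\<close> this makes up for the shifts forth and back.
\<close>
lemma annihilators_power_dominated:
  assumes \<omega>: "\<omega> \<in> Omega" and good: "good_filtration \<omega> act F"
  shows "power_dominated \<omega> (gr_annihilator \<omega> act F) (symbol_ann \<omega>)"
    and "power_dominated \<omega> (symbol_ann \<omega>) (gr_annihilator \<omega> act F)"
proof -
  have lm: "left_module act" by unfold_locales
  have F: "module_filtration \<omega> act F" using good by (simp add: good_filtration_def)
  note FD = module_filtrationD[OF F] and GD = module_filtrationD[OF generator_filtration[of \<omega>]]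
  obtain c1 where c1: "\<And>i. F i \<subseteq> generator_filt \<omega> (i + int c1)"
    using good_filtration_subset_shift[OF good generator_filtration] by blast
  obtain c2 where c2: "\<And>i. generator_filt \<omega> i \<subseteq> F (i + int c2)"
    using generator_filt_subset_shift[OF F] by blast
  define k where "k = Suc (c1 + c2)"
  have power: "act (weyl_sum (q ^ k)) x \<in> F' (i + int (k * d) - 1)"
    if q: "homogeneous \<omega> d q" and x: "x \<in> F' i" and F': "module_filtration \<omega> act F'"
      and "act (weyl_sum q ^ k) x \<in> F' (i + int (c1 + c2) + int (k * d) - int k)" for q d x i F'
  proof -
    have "act (weyl_sum q ^ k) x \<in> F' (i + int (k * d) - 1)" using that(4) by (simp add: k_def algebra_simps)
    moreover have "act (weyl_sum (q ^ k) - weyl_sum q ^ k) x \<in> F' (i + int (k * d) - 1)"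
      using module_filtrationD(6)[OF F' weyl_power_filt[OF \<omega> homogeneous_deg_le[OF q], of k] x]
      by (simp add: algebra_simps)
    ultimately have "act (weyl_sum q ^ k) x + act (weyl_sum (q ^ k) - weyl_sum q ^ k) x \<in> F' (i + int (k * d) - 1)"
      by (rule module_filtrationD(3)[OF F'])
    thus ?thesis by (simp add: act_diff_left)
  qed
  show "power_dominated \<omega> (gr_annihilator \<omega> act F) (symbol_ann \<omega>)"
    unfolding power_dominated_def
  proof (intro conjI ballI allI impI)
    fix q d assume q: "q \<in> gr_annihilator \<omega> act F"
    show "hcomp \<omega> d q \<in> gr_annihilator \<omega> act F" by (rule gr_annihilator_hcomp[OF lm F q])
    assume hom: "homogeneous \<omega> d q"
    have low: "act (weyl_sum q) x \<in> F (i + int d - 1)" if "x \<in> F i" for x i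
      using q that unfolding gr_annihilator_homogeneous_iff[OF lm F hom] by blast
    have "q ^ k \<in> symbol_ann \<omega>"
      unfolding symbol_ann_homogeneous_iff[OF homogeneous_power[OF hom]]
    proof (intro allI impI)
      fix j assume j: "j < r"
      have "m j \<in> F (int c2)" using c2[of 0] generator_in_filt[OF j] by auto
      from power_act_lowers[OF lm low this, of k]
      have "act (weyl_sum q ^ k) (m j) \<in> F (int c2 + int (k * d) - int k)" by simp
      hence "act (weyl_sum q ^ k) (m j) \<in> generator_filt \<omega> (0 + int (c1 + c2) + int (k * d) - int k)"
        using c1[of "int c2 + int (k * d) - int k"] by (auto simp: algebra_simps)
      from power[OF hom generator_in_filt[OF j] generator_filtration this]
      show "act (weyl_sum (q ^ k)) (m j) \<in> generator_filt \<omega> (int (k * d) - 1)" by simp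
    qed
    thus "\<exists>k. q ^ k \<in> symbol_ann \<omega>" ..
  qed
  show "power_dominated \<omega> (symbol_ann \<omega>) (gr_annihilator \<omega> act F)"
    unfolding power_dominated_def
  proof (intro conjI ballI allI impI)
    fix q d assume q: "q \<in> symbol_ann \<omega>"
    show "hcomp \<omega> d q \<in> symbol_ann \<omega>" by (rule symbol_ann_hcomp[OF q])
    assume hom: "homogeneous \<omega> d q"
    have "q ^ k \<in> gr_annihilator \<omega> act F"
      unfolding gr_annihilator_homogeneous_iff[OF lm F homogeneous_power[OF hom]]
    proof (intro allI ballI)
      fix i x assume x: "x \<in> F i"
      hence "x \<in> generator_filt \<omega> (i + int c1)" using c1 by blast
      from power_act_lowers[OF lm symbol_ann_lowers_filt[OF \<omega> hom q] this, of k]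
      have "act (weyl_sum q ^ k) x \<in> F (i + int (c1 + c2) + int (k * d) - int k)"
        using c2[of "i + int c1 + int (k * d) - int k"] by (auto simp: algebra_simps)
      from power[OF hom x F this] show "act (weyl_sum (q ^ k)) x \<in> F (i + int (k * d) - 1)" .
    qed
    thus "\<exists>k. q ^ k \<in> gr_annihilator \<omega> act F" ..
  qed
qed

lemma module_finitely_generated: "finitely_generated act"
  unfolding finitely_generated_def
proof (intro exI[of _ "m ` {..<r}"] conjI allI)
  fix x
  obtain a where a: "x = (\<Sum>j<r. act (a j) (m j))" using generated by blast
  have "(\<Sum>y\<in>m ` {..<r}. act (\<Sum>j\<in>{j \<in> {..<r}. m j = y}. a j) y) =
      (\<Sum>y\<in>m ` {..<r}. \<Sum>j\<in>{j \<in> {..<r}. m j = y}. act (a j) (m j))"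
  proof (intro sum.cong refl)
    fix y
    have "act (\<Sum>j\<in>J. a j) y = (\<Sum>j\<in>J. act (a j) y)" for J
      by (induction J rule: infinite_finite_induct) (simp_all add: act_zero_left act_add_left)
    thus "act (\<Sum>j\<in>{j \<in> {..<r}. m j = y}. a j) y = (\<Sum>j\<in>{j \<in> {..<r}. m j = y}. act (a j) (m j))"
      by (auto intro: sum.cong)
  qed
  also have "\<dots> = x" unfolding a by (rule sum.image_gen[symmetric]) simp
  finally show "\<exists>a. x = (\<Sum>y\<in>m ` {..<r}. act (a y) y)" by (intro exI[of _ "\<lambda>y. \<Sum>j\<in>{j \<in> {..<r}. m j = y}. a j"]) simp
qed auto

lemma
  assumes "\<omega> \<in> Omega"
  shows char_variety_eq: "char_variety \<omega> act = {Q. primeideal Q poly_ring \<and> symbol_ann \<omega> \<subseteq> Q}"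
    and critical_cone_eq: "critical_cone \<omega> act = {Q. primeideal Q poly_ring \<and> tops_in (symbol_ann \<omega>) Q}"
proof -
  define F where "F = (SOME F. good_filtration \<omega> act F)"
  have "left_module act" by unfold_locales
  hence "good_filtration \<omega> act F"
    unfolding F_def by (intro someI_ex[of "good_filtration \<omega> act"] good_filtration_exists module_finitely_generated)
  note dom = annihilators_power_dominated[OF assms this]
  show "char_variety \<omega> act = {Q. primeideal Q poly_ring \<and> symbol_ann \<omega> \<subseteq> Q}"
    unfolding char_variety_def gr_module_annihilator_def F_def[symmetric] Var_def
    using power_dominated_subset[OF dom(1)] power_dominated_subset[OF dom(2)] by blast
  show "critical_cone \<omega> act = {Q. primeideal Q poly_ring \<and> tops_in (symbol_ann \<omega>) Q}"
    unfolding critical_cone_def gr_module_annihilator_def F_def[symmetric] Var_gr_ideal_radical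
    using power_dominated_tops_in[OF dom(1)] power_dominated_tops_in[OF dom(2)] by blast
qed

text \<open>
  Both directions are tested on bihomogeneous components: those of the top forms of \<open>A\<^sub>\<omega>\<close> lie in the
  annihilator for \<open>(1|1) + s \<omega>\<close>, and those of elements of the latter have powers that are components
  of elements of \<open>A\<^sub>\<omega>\<close> in their greatest possible total degree.
\<close>
lemma tops_in_iff_shifted:
  assumes "\<omega> \<in> Omega" "lift_bound s0" "s0 < s" and Q: "primeideal Q poly_ring"
  shows "tops_in (symbol_ann \<omega>) Q \<longleftrightarrow> symbol_ann (shifted_weight \<omega> s) \<subseteq> Q"
proof
  assume *: "tops_in (symbol_ann \<omega>) Q"
  show "symbol_ann (shifted_weight \<omega> s) \<subseteq> Q"
  proof
    fix p assume p: "p \<in> symbol_ann (shifted_weight \<omega> s)"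
    have "bicomp \<omega> a b p \<in> Q" for a b
    proof -
      let ?q = "bicomp \<omega> a b p"
      obtain x K where x: "x \<in> symbol_ann \<omega>" "approx_power tdeg b ?q K x"
        using symbol_ann_shifted_power[OF assms(1-3) p] by blast
      have q: "deg_le tdeg b ?q" by (auto simp: deg_le_def keys_hcomp)
      have "hcomp tdeg (K * b) x \<in> Q"
        using * x(1) approx_power_deg_le[OF q x(2)] unfolding tops_in_def by blast
      moreover have "hcomp tdeg (K * b) (x - ?q ^ K) = 0"
        using x(2) unfolding approx_power_def by (rule hcomp_eq_0)
      hence "hcomp tdeg (K * b) x = hcomp tdeg b ?q ^ K"
        by (simp add: hcomp_diff hcomp_power_top[OF q])
      moreover have "hcomp tdeg b ?q = ?q" by (rule hcomp_id) (simp add: keys_hcomp)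
      ultimately have "?q ^ K \<in> Q" by simp
      thus ?thesis by (rule primeideal_power[OF Q])
    qed
    hence "hcomp tdeg b p \<in> Q" for b by (rule mem_if_hcomps_mem[OF Q])
    thus "p \<in> Q" by (rule mem_if_hcomps_mem[OF Q])
  qed
next
  assume *: "symbol_ann (shifted_weight \<omega> s) \<subseteq> Q"
  show "tops_in (symbol_ann \<omega>) Q"
    unfolding tops_in_def
  proof (intro ballI allI impI)
    fix x b assume "x \<in> symbol_ann \<omega>" "deg_le tdeg b x"
    hence "bicomp \<omega> a b x \<in> Q" for a using symbol_ann_top_form_shifted[OF assms(2,3)] * by blast
    thus "hcomp tdeg b x \<in> Q" by (rule mem_if_hcomps_mem[OF Q])
  qed
qed

lemma tops_in_shifted_iff:
  assumes "lift_bound s0" "s0 < s" and Q: "primeideal Q poly_ring"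
  shows "tops_in (symbol_ann (shifted_weight \<omega> s)) Q \<longleftrightarrow> symbol_ann (shifted_weight \<omega> s) \<subseteq> Q"
proof
  assume *: "tops_in (symbol_ann (shifted_weight \<omega> s)) Q"
  show "symbol_ann (shifted_weight \<omega> s) \<subseteq> Q"
  proof
    fix p assume p: "p \<in> symbol_ann (shifted_weight \<omega> s)"
    have "bicomp \<omega> a b p \<in> Q" for a b
    proof -
      have "deg_le tdeg b (bicomp \<omega> a b p)" by (auto simp: deg_le_def keys_hcomp)
      hence "hcomp tdeg b (bicomp \<omega> a b p) \<in> Q"
        using * symbol_ann_shifted_bicomp[OF assms(1,2) p] unfolding tops_in_def by blast
      moreover have "hcomp tdeg b (bicomp \<omega> a b p) = bicomp \<omega> a b p"
        by (rule hcomp_id) (simp add: keys_hcomp)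
      ultimately show ?thesis by simp
    qed
    hence "hcomp tdeg b p \<in> Q" for b by (rule mem_if_hcomps_mem[OF Q])
    thus "p \<in> Q" by (rule mem_if_hcomps_mem[OF Q])
  qed
next
  assume *: "symbol_ann (shifted_weight \<omega> s) \<subseteq> Q"
  show "tops_in (symbol_ann (shifted_weight \<omega> s)) Q"
    unfolding tops_in_def
  proof (intro ballI allI impI)
    fix x b assume "x \<in> symbol_ann (shifted_weight \<omega> s)"
    hence "bicomp \<omega> a b x \<in> Q" for a using symbol_ann_shifted_bicomp[OF assms(1,2)] * by blast
    thus "hcomp tdeg b x \<in> Q" by (rule mem_if_hcomps_mem[OF Q])
  qed
qed

end

lemma shifted_weight_in_Omega: "shifted_weight \<omega> s \<in> Omega"
  by (simp add: Omega_def shifted_weight_def weight_pair_def)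

theorem corollary4p10:
  fixes act :: "('n::finite, 'k::field_char_0) weyl \<Rightarrow> 'm::ab_group_add \<Rightarrow> 'm"
  assumes "left_module act" and "finitely_generated act"
  shows "\<exists>s0::nat. \<forall>\<omega>\<in>Omega. \<forall>s::nat. s > s0 \<longrightarrow>
           critical_cone \<omega> act = char_variety (\<lambda>v. weight_pair 1 1 v + s * \<omega> v) act \<and>
           char_variety (\<lambda>v. weight_pair 1 1 v + s * \<omega> v) act =
             critical_cone (\<lambda>v. weight_pair 1 1 v + s * \<omega> v) act"
proof -
  obtain S where S: "finite S" "\<forall>x. \<exists>a. x = (\<Sum>y\<in>S. act (a y) y)"
    using assms(2) unfolding finitely_generated_def by (elim exE conjE)
  obtain m where m: "bij_betw m {0..<card S} S" using ex_bij_betw_nat_finite[OF S(1)] by blast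
  have "\<exists>a. x = (\<Sum>j<card S. act (a j) (m j))" for x
  proof -
    obtain a where a: "x = (\<Sum>y\<in>S. act (a y) y)" using S(2) by blast
    also have "\<dots> = (\<Sum>j\<in>{0..<card S}. act (a (m j)) (m j))"
      by (rule sum.reindex_bij_betw[OF m, symmetric])
    finally show ?thesis by (intro exI[of _ "\<lambda>j. a (m j)"]) (simp add: atLeast0LessThan)
  qed
  then interpret generated_module act m "card S"
    using assms(1) by (simp add: generated_module_def generated_module_axioms_def)
  obtain s0 where s0: "lift_bound s0" using ex_lift_bound by blast
  show ?thesis
    unfolding shifted_weight_def[symmetric]
  proof (intro exI[of _ s0] ballI allI impI conjI)
    fix \<omega> :: "'n + 'n \<Rightarrow> nat" and s assume \<omega>: "\<omega> \<in> Omega" and s: "s0 < s"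
    show "critical_cone \<omega> act = char_variety (shifted_weight \<omega> s) act"
      unfolding critical_cone_eq[OF \<omega>] char_variety_eq[OF shifted_weight_in_Omega]
      using tops_in_iff_shifted[OF \<omega> s0 s] by blast
    show "char_variety (shifted_weight \<omega> s) act = critical_cone (shifted_weight \<omega> s) act"
      unfolding critical_cone_eq[OF shifted_weight_in_Omega] char_variety_eq[OF shifted_weight_in_Omega]
      using tops_in_shifted_iff[OF s0 s] by blast
  qed
qed

end
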